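(* Suppose that $\mathrm{E}[v_1'^2(\Sigma)]>0$ and that for some $\delta>0$, as $n\to\infty$, $$\max\left\{\frac{\mathrm{E}|e_1'(\Sigma)|^{2+\delta}}{(\mathrm{E}[e_1'^2(\Sigma)])^{(2+\delta)/2}},\ \frac{\mathrm{E}|v_1'(\Sigma)|^{2+\delta}}{(\mathrm{E}[v_1'^2(\Sigma)])^{(2+\delta)/2}}\right\}=o\left(N^{(\delta+\min\{2,\delta\})/4}\right).$$ Then under $H_0:\ \sigma_{ij}=0$ for all $|i-j|\ge\tau$, $-2\log L_3(\Sigma_0)$ converges in distribution to a chi-square distribution with two degrees of freedom as $n\to\infty$, where $\Sigma_0$ is any matrix such that $\Sigma_0^{(\tau)}=0$. If, in addition, $$\mathrm{E}\Big\{\sum_{i=1}^N\big(e_i^{*\prime}(\Sigma)-e_i'(\Sigma)\big)^2+\Big[\sum_{i=1}^N\big(e_i^{*\prime}(\Sigma)-e_i'(\Sigma)\big)\Big]^2\Big\}=o\big(N\,\mathrm{E}[e_1'^2(\Sigma)]\big)$$ and $$\mathrm{E}\Big\{\sum_{i=1}^N\big(v_i^{*\prime}(\Sigma)-v_i'(\Sigma)\big)^2+\Big[\sum_{i=1}^N\big(v_i^{*\prime}(\Sigma)-v_i'(\Sigma)\big)\Big]^2\Big\}=o\big(N\,\mathrm{E}[v_1'^2(\Sigma)]\big),$$ then under the same $H_0$, $-2\log L_4(\Sigma_0)$ also converges in distribution to a chi-square distribution with two degrees of freedom as $n\to\infty$.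
   Context: For each $n$, $X_1,\dots,X_n$ are i.i.d. random vectors in $\mathbb{R}^p$ with mean $\mu$ and covariance matrix $\Sigma=(\sigma_{ij})_{1\le i,j\le p}$. The dimension $p$, and hence $\mu$, $\Sigma$, $\Sigma_0$ and the distribution of $X_1$, may depend on $n$ ($p$ may be fixed or divergent); $\tau<p$ is given and may depend on $n$. Let $N=[n/2]$ (integer part) and $\mathbf{1}_p=(1,\dots,1)^T\in\mathbb{R}^p$. For a $p\times p$ matrix $M$, $M^{(\tau)}$ is the matrix with entries $(M^{(\tau)})_{ij}=(M)_{ij}I(|i-j|\ge\tau)$; superscript $(\tau)$ on $Y_i$, $Y_i^*$ means this operation. $Y_i=(X_i-\mu)(X_i-\mu)^T$ for $i=1,\dots,n$; $\overline{X}^1=\frac1N\sum_{i=1}^NX_i$, $\overline{X}^2=\frac1N\sum_{i=N+1}^{2N}X_i$; for $i=1,\dots,N$, $Y_i^*=(X_i-\overline{X}^1)(X_i-\overline{X}^1)^T$, $Y_{N+i}^*=(X_{N+i}-\overline{X}^2)(X_{N+i}-\overline{X}^2)^T$. For a $p\times p$ matrix $M$ and $i=1,\dots,N$: $$e_i'(M)=\mathrm{tr}\big((Y_i^{(\tau)}-M^{(\tau)})(Y_{N+i}^{(\tau)}-M^{(\tau)})\big),\quad v_i'(M)=\mathbf{1}_p^T\big(Y_i^{(\tau)}+Y_{N+i}^{(\tau)}-2M^{(\tau)}\big)\mathbf{1}_p,$$ $$e_i^{*\prime}(M)=\mathrm{tr}\Big(\big(Y_i^{*(\tau)}-\tfrac{N-1}{N}M^{(\tau)}\big)\big(Y_{N+i}^{*(\tau)}-\tfrac{N-1}{N}M^{(\tau)}\big)\Big),\quad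 v_i^{*\prime}(M)=\mathbf{1}_p^T\Big(Y_i^{*(\tau)}+Y_{N+i}^{*(\tau)}-\tfrac{2(N-1)}{N}M^{(\tau)}\Big)\mathbf{1}_p.$$ With $R_i'(M)=(e_i'(M),v_i'(M))^T$, $$L_3(M)=\sup\Big\{\prod_{i=1}^N(Np_i):\ \sum_{i=1}^Np_i=1,\ \sum_{i=1}^Np_iR_i'(M)=0,\ p_i\ge0,\ i=1,\dots,N\Big\},$$ and $L_4(M)$ is defined in the same way with $R_i'(M)$ replaced by $R_i^{*\prime}(M)=(e_i^{*\prime}(M),v_i^{*\prime}(M))^T$. Convention: $\sup\emptyset=0$ and $-2\log 0=+\infty$. *)

theory Defs
  imports "HOL-Probability.Probability" "HOL-Library.Landau_Symbols"
begin

text \<open>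
  Since the dimension p varies with the sample size, vectors are functions
  \<open>nat \<Rightarrow> real\<close> and matrices functions \<open>nat \<Rightarrow> nat \<Rightarrow> real\<close>, with indices ranging
  over \<open>{1..p}\<close>; entries outside that range are never used. A sample \<open>x\<close> has
  observations \<open>x i\<close>, \<open>i \<in> {1..n}\<close>, with coordinates \<open>x i k\<close>.
\<close>

type_synonym rvec = "nat \<Rightarrow> real"
type_synonym rmat = "nat \<Rightarrow> nat \<Rightarrow> real"

definition mat_mult :: "nat \<Rightarrow> rmat \<Rightarrow> rmat \<Rightarrow> rmat" where
  "mat_mult p A B = (\<lambda>k l. \<Sum>m=1..p. A k m * B m l)"

definition mat_trace :: "nat \<Rightarrow> rmat \<Rightarrow> real" where
  "mat_trace p A = (\<Sum>k=1..p. A k k)"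

definition quad_form :: "nat \<Rightarrow> rmat \<Rightarrow> rvec \<Rightarrow> real" where
  "quad_form p A u = (\<Sum>k=1..p. \<Sum>l=1..p. u k * A k l * u l)"

definition off_band :: "nat \<Rightarrow> rmat \<Rightarrow> rmat" where
  "off_band \<tau> A = (\<lambda>k l. if int \<tau> \<le> \<bar>int k - int l\<bar> then A k l else 0)"

text \<open>Each random vector is a measurable map into the product space
  \<open>\<Pi>\<^sub>M k\<in>{1..p}. borel\<close>; its measurability is part of \<open>indep_vars\<close>. Finite second
  moments are what makes mean and covariance meaningful.\<close>

definition iid_sample ::
  "'a measure \<Rightarrow> nat \<Rightarrow> nat \<Rightarrow> ('a \<Rightarrow> nat \<Rightarrow> rvec) \<Rightarrow> rvec \<Rightarrow> rmat \<Rightarrow> bool" where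
  "iid_sample M n p X \<mu> S \<longleftrightarrow>
     prob_space M \<and>
     prob_space.indep_vars M (\<lambda>_. \<Pi>\<^sub>M k\<in>{1..p}. (borel :: real measure)) (\<lambda>i \<omega>. X \<omega> i) {1..n} \<and>
     (\<forall>i\<in>{1..n}. distr M (\<Pi>\<^sub>M k\<in>{1..p}. (borel :: real measure)) (\<lambda>\<omega>. X \<omega> i) =
                 distr M (\<Pi>\<^sub>M k\<in>{1..p}. (borel :: real measure)) (\<lambda>\<omega>. X \<omega> 1)) \<and>
     (\<forall>i\<in>{1..n}. \<forall>k\<in>{1..p}. integrable M (\<lambda>\<omega>. (X \<omega> i k)\<^sup>2)) \<and>
     (\<forall>i\<in>{1..n}. \<forall>k\<in>{1..p}. (\<integral>\<omega>. X \<omega> i k \<partial>M) = \<mu> k) \<and>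
     (\<forall>i\<in>{1..n}. \<forall>k\<in>{1..p}. \<forall>l\<in>{1..p}.
        (\<integral>\<omega>. (X \<omega> i k - \<mu> k) * (X \<omega> i l - \<mu> l) \<partial>M) = S k l)"

definition outer_Y :: "rvec \<Rightarrow> (nat \<Rightarrow> rvec) \<Rightarrow> nat \<Rightarrow> rmat" where
  "outer_Y \<mu> x i = (\<lambda>k l. (x i k - \<mu> k) * (x i l - \<mu> l))"

definition mean_first :: "nat \<Rightarrow> (nat \<Rightarrow> rvec) \<Rightarrow> rvec" where
  "mean_first N x = (\<lambda>k. (\<Sum>i=1..N. x i k) / real N)"

definition mean_second :: "nat \<Rightarrow> (nat \<Rightarrow> rvec) \<Rightarrow> rvec" where
  "mean_second N x = (\<lambda>k. (\<Sum>i=N+1..2*N. x i k) / real N)"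

definition outer_Y_star :: "nat \<Rightarrow> (nat \<Rightarrow> rvec) \<Rightarrow> nat \<Rightarrow> rmat" where
  "outer_Y_star N x i =
     (if i \<le> N then outer_Y (mean_first N x) x i else outer_Y (mean_second N x) x i)"

text \<open>The two statistics formed from a pair \<open>A\<close>, \<open>B\<close> of outer products. The factor
  \<open>c\<close> is 1 when the mean is known and \<open>(N - 1) / N\<close> when it is estimated.\<close>

definition pair_trace :: "nat \<Rightarrow> nat \<Rightarrow> real \<Rightarrow> rmat \<Rightarrow> rmat \<Rightarrow> rmat \<Rightarrow> real" where
  "pair_trace p \<tau> c A B C = mat_trace p (mat_mult p
     (\<lambda>k l. off_band \<tau> A k l - c * off_band \<tau> C k l)
     (\<lambda>k l. off_band \<tau> B k l - c * off_band \<tau> C k l))"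

definition pair_ones :: "nat \<Rightarrow> nat \<Rightarrow> real \<Rightarrow> rmat \<Rightarrow> rmat \<Rightarrow> rmat \<Rightarrow> real" where
  "pair_ones p \<tau> c A B C = quad_form p
     (\<lambda>k l. off_band \<tau> A k l + off_band \<tau> B k l - 2 * c * off_band \<tau> C k l) (\<lambda>_. 1)"

definition e_prime :: "nat \<Rightarrow> nat \<Rightarrow> nat \<Rightarrow> rvec \<Rightarrow> (nat \<Rightarrow> rvec) \<Rightarrow> rmat \<Rightarrow> nat \<Rightarrow> real" where
  "e_prime n p \<tau> \<mu> x C i =
     pair_trace p \<tau> 1 (outer_Y \<mu> x i) (outer_Y \<mu> x (n div 2 + i)) C"

definition v_prime :: "nat \<Rightarrow> nat \<Rightarrow> nat \<Rightarrow> rvec \<Rightarrow> (nat \<Rightarrow> rvec) \<Rightarrow> rmat \<Rightarrow> nat \<Rightarrow> real" where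
  "v_prime n p \<tau> \<mu> x C i =
     pair_ones p \<tau> 1 (outer_Y \<mu> x i) (outer_Y \<mu> x (n div 2 + i)) C"

definition e_star :: "nat \<Rightarrow> nat \<Rightarrow> nat \<Rightarrow> (nat \<Rightarrow> rvec) \<Rightarrow> rmat \<Rightarrow> nat \<Rightarrow> real" where
  "e_star n p \<tau> x C i = (let N = n div 2 in
     pair_trace p \<tau> ((real N - 1) / real N) (outer_Y_star N x i) (outer_Y_star N x (N + i)) C)"

definition v_star :: "nat \<Rightarrow> nat \<Rightarrow> nat \<Rightarrow> (nat \<Rightarrow> rvec) \<Rightarrow> rmat \<Rightarrow> nat \<Rightarrow> real" where
  "v_star n p \<tau> x C i = (let N = n div 2 in
     pair_ones p \<tau> ((real N - 1) / real N) (outer_Y_star N x i) (outer_Y_star N x (N + i)) C)"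

text \<open>The supremum of the empty set is set to 0 by hand, since \<open>Sup {}\<close> is
  unspecified on the reals. A nonempty constraint set gives values in \<open>[0, 1]\<close>.\<close>

definition el_ratio :: "nat \<Rightarrow> (nat \<Rightarrow> real \<times> real) \<Rightarrow> real" where
  "el_ratio N R = (let V = {(\<Prod>i=1..N. real N * w i) | w :: nat \<Rightarrow> real.
       (\<Sum>i=1..N. w i) = 1 \<and> (\<Sum>i=1..N. w i *\<^sub>R R i) = 0 \<and> (\<forall>i\<in>{1..N}. 0 \<le> w i)}
     in if V = {} then 0 else Sup V)"

definition L3 :: "nat \<Rightarrow> nat \<Rightarrow> nat \<Rightarrow> rvec \<Rightarrow> (nat \<Rightarrow> rvec) \<Rightarrow> rmat \<Rightarrow> real" where
  "L3 n p \<tau> \<mu> x C = el_ratio (n div 2) (\<lambda>i. (e_prime n p \<tau> \<mu> x C i, v_prime n p \<tau> \<mu> x C i))"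

definition L4 :: "nat \<Rightarrow> nat \<Rightarrow> nat \<Rightarrow> (nat \<Rightarrow> rvec) \<Rightarrow> rmat \<Rightarrow> real" where
  "L4 n p \<tau> x C = el_ratio (n div 2) (\<lambda>i. (e_star n p \<tau> x C i, v_star n p \<tau> x C i))"

definition neg2_log :: "real \<Rightarrow> ereal" where
  "neg2_log y = (if y = 0 then \<infinity> else ereal (- 2 * ln y))"

definition chi_square :: "nat \<Rightarrow> real measure" where
  "chi_square k = distr (\<Pi>\<^sub>M i\<in>{..<k}. std_normal_distribution) borel (\<lambda>z. \<Sum>i<k. (z i)\<^sup>2)"

text \<open>Convergence in distribution of random variables with values in the extended reals
  (on possibly different probability spaces) to a law on the reals. As the limit cdf tends
  to 1, convergence of the cdfs at real arguments forces the mass at \<open>\<infinity>\<close> to vanish.\<close>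

definition converges_in_distribution ::
  "(nat \<Rightarrow> 'a measure) \<Rightarrow> (nat \<Rightarrow> 'a \<Rightarrow> ereal) \<Rightarrow> real measure \<Rightarrow> bool" where
  "converges_in_distribution M W \<nu> \<longleftrightarrow>
     (\<forall>n. W n \<in> borel_measurable (M n)) \<and>
     weak_conv (\<lambda>n t. measure (M n) {\<omega> \<in> space (M n). W n \<omega> \<le> ereal t}) (cdf \<nu>)"

end

theory Submission
  imports Defs
begin

text \<open>
  Both statistics are sums of the features \<open>F\<^sub>k\<^sub>l(x) = (x\<^sub>k - \<mu>\<^sub>k)(x\<^sub>l - \<mu>\<^sub>l)\<close>, \<open>|k - l| \<ge> \<tau>\<close>, over an
  independent pair: the trace statistic is \<open>\<Sum> F(X\<^sub>i) F(X\<^sub>N\<^sub>+\<^sub>i)\<close> and the total-sum statistic is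
  \<open>\<Sum> F(X\<^sub>i) + F(X\<^sub>N\<^sub>+\<^sub>i)\<close>. Under the null hypothesis the features are centered, so by Fubini the two
  statistics are centered and uncorrelated, and the first degenerates only if the second does. The
  exponent in the moment condition is at most \<open>\<delta>/2\<close>; hence, after division by the standard deviations,
  the pairs form a triangular array with Lyapunov's condition.

  For such an array the likelihood ratio is squeezed between two explicit quadratic bounds, one from
  weak duality with multiplier equal to the sample mean, the other from feasible linear weights. On
  an event of probability close to one both bounds equal the squared norm of the normalized sum up to
  a small error, and this is stable under the perturbation caused by estimating the mean. The law of
  the squared norm is found from its Laplace transform, which is a Gaussian average of the
  characteristic functions of linear combinations.
\<close>

section \<open>Empirical likelihood ratio: expansion and measurability\<close>

text \<open>Two features of the statement shape the proof. The probability spaces, the dimension and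
  the law change with n, so every estimate on a row is an explicit inequality in N and a few
  moments, never a limit on one fixed space. And the ratio is a supremum over a set that may be
  empty: finiteness of -2 log has to come from exhibited weights, while measurability is owed for
  every n, however small.

  The two statistics live on different scales, but the ratio is invariant under separate rescaling
  of the coordinates. Since they are uncorrelated, two scalar standardizations already give identity
  covariance, and then the sample mean is nearly the optimal multiplier.

  Constants are fixed in the order \<epsilon> and \<gamma>, then K from \<gamma> (bounding the
  normalized sums), then \<eta> or \<theta> from \<epsilon> and K, and last n. The ratio of the
  perturbed statistics is compared with the squared norm of the unperturbed sums, so one limit
  theorem serves both claims. The limit depends only on a sum of two squares, which is why scalar
  linear combinations suffice.\<close>

lemma ln_one_plus_ge_quadratic:
  fixes u \<kappa> :: real
  assumes u: "\<bar>u\<bar> \<le> \<kappa>" and k: "\<kappa> \<le> 1/2"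
  shows "u - (1/2 + \<kappa>) * u\<^sup>2 \<le> ln (1 + u)"
proof -
  \<comment> \<open>The derivative of \<open>f\<close> is z times a factor that is nonnegative for
    |z| \<le> \<kappa> \<le> 1/2, because (1 + 2\<kappa>)(1 - \<kappa>) \<ge> 1; hence
    \<open>f\<close> is minimal at 0. As \<kappa> shrinks, 1/2 + \<kappa> tends to the Taylor
    coefficient, so the two bounds on the ratio agree to leading order.\<close>
  define f where "f = (\<lambda>u::real. ln (1 + u) - u + (1/2 + \<kappa>) * u\<^sup>2)"
  have k0: "0 \<le> \<kappa>" using u by linarith
  have D: "(f has_real_derivative z * (1 + 2 * \<kappa> - 1 / (1 + z))) (at z)" if "\<bar>z\<bar> \<le> \<kappa>" for z
  proof -
    have z: "1 + z > 0" using that k by linarith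
    have "(f has_real_derivative (1 / (1 + z) - 1 + (1/2 + \<kappa>) * (2 * z))) (at z)"
      unfolding f_def using z by (auto intro!: derivative_eq_intros)
    moreover have "1 / (1 + z) - 1 + (1/2 + \<kappa>) * (2 * z) = z * (1 + 2 * \<kappa> - 1 / (1 + z))"
      using z by (simp add: field_simps)
    ultimately show ?thesis by simp
  qed
  have P: "0 \<le> 1 + 2 * \<kappa> - 1 / (1 + z)" if "\<bar>z\<bar> \<le> \<kappa>" for z
  proof -
    have "0 \<le> \<kappa> * (1 - 2 * \<kappa>)" using k k0 by simp
    then have "1 \<le> (1 + 2 * \<kappa>) * (1 - \<kappa>)" by (simp add: algebra_simps)
    also have "\<dots> \<le> (1 + 2 * \<kappa>) * (1 + z)" using that k0 by (intro mult_left_mono) auto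
    finally show ?thesis using that k by (simp add: field_simps)
  qed
  have "f 0 \<le> f u"
  proof (cases "0 \<le> u")
    case True
    show ?thesis
    proof (rule DERIV_nonneg_imp_nondecreasing[OF True])
      fix x assume "0 \<le> x" "x \<le> u"
      then have "\<bar>x\<bar> \<le> \<kappa>" using u by linarith
      then show "\<exists>y. (f has_real_derivative y) (at x) \<and> 0 \<le> y"
        using D[of x] mult_nonneg_nonneg[OF \<open>0 \<le> x\<close> P[of x]] by auto
    qed
  next
    case False
    then have "u \<le> 0" by simp
    then show ?thesis
    proof (rule DERIV_nonpos_imp_nonincreasing)
      fix x assume "u \<le> x" "x \<le> 0"
      then have "\<bar>x\<bar> \<le> \<kappa>" using u by linarith
      then show "\<exists>y. (f has_real_derivative y) (at x) \<and> y \<le> 0"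
        using D[of x] mult_nonpos_nonneg[OF \<open>x \<le> 0\<close> P[of x]] by auto
    qed
  qed
  then show ?thesis by (simp add: f_def)
qed

section \<open>Deterministic two-sided bounds on the likelihood ratio\<close>

definition el_values :: "nat \<Rightarrow> (nat \<Rightarrow> real \<times> real) \<Rightarrow> real set" where
  "el_values N R = {(\<Prod>i=1..N. real N * w i) | w :: nat \<Rightarrow> real.
       (\<Sum>i=1..N. w i) = 1 \<and> (\<Sum>i=1..N. w i *\<^sub>R R i) = 0 \<and> (\<forall>i\<in>{1..N}. 0 \<le> w i)}"

lemma el_ratio_eq_Sup: "el_ratio N R = (if el_values N R = {} then 0 else Sup (el_values N R))"
  unfolding el_ratio_def el_values_def Let_def ..

lemma el_values_pairE:
  assumes "z \<in> el_values N (\<lambda>i. (A i, B i))"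
  obtains w where "z = (\<Prod>i=1..N. real N * w i)" "(\<Sum>i=1..N. w i) = 1"
    "(\<Sum>i=1..N. w i * A i) = 0" "(\<Sum>i=1..N. w i * B i) = 0" "\<And>i. i \<in> {1..N} \<Longrightarrow> 0 \<le> w i"
  using assms by (auto simp: el_values_def zero_prod_def sum_prod)

lemma el_values_pairI:
  assumes "(\<Sum>i=1..N. w i) = 1"
    "(\<Sum>i=1..N. w i * A i) = 0" "(\<Sum>i=1..N. w i * B i) = 0" "\<And>i. i \<in> {1..N} \<Longrightarrow> 0 \<le> w i"
  shows "(\<Prod>i=1..N. real N * w i) \<in> el_values N (\<lambda>i. (A i, B i))"
  using assms by (auto simp: el_values_def zero_prod_def sum_prod intro!: exI[of _ w])

text \<open>Weak duality: \<open>log x \<le> x - 1\<close> applied to \<open>N w\<^sub>i (1 + a A\<^sub>i + b B\<^sub>i)\<close>, whose average is 1.\<close>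

lemma el_values_le_dual:
  assumes z: "z \<in> el_values N (\<lambda>i. (A i, B i))"
    and pos: "\<And>i. i \<in> {1..N} \<Longrightarrow> 0 < 1 + (a * A i + b * B i)"
  shows "z \<le> exp (- (\<Sum>i=1..N. ln (1 + (a * A i + b * B i))))"
proof -
  obtain w where w: "z = (\<Prod>i=1..N. real N * w i)" "(\<Sum>i=1..N. w i) = 1"
    "(\<Sum>i=1..N. w i * A i) = 0" "(\<Sum>i=1..N. w i * B i) = 0" "\<And>i. i \<in> {1..N} \<Longrightarrow> 0 \<le> w i"
    by (rule el_values_pairE[OF z]) blast
  show ?thesis
  proof (cases "\<exists>i\<in>{1..N}. w i = 0")
    case True
    then have "z = 0" unfolding w(1) by (intro prod_zero) auto
    then show ?thesis by simp
  next
    case False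
    then have wp: "0 < w i" if "i \<in> {1..N}" for i using w(5)[OF that] that by force
    have Np: "0 < real N" using w(2) by (cases N) auto
    have "(\<Sum>i=1..N. ln (real N * w i) + ln (1 + (a * A i + b * B i)))
        \<le> (\<Sum>i=1..N. real N * (w i * (1 + (a * A i + b * B i))) - 1)"
    proof (rule sum_mono)
      fix i assume i: "i \<in> {1..N}"
      have "ln (real N * w i) + ln (1 + (a * A i + b * B i)) = ln (real N * (w i * (1 + (a * A i + b * B i))))"
        using wp[OF i] pos[OF i] Np by (simp add: ln_mult)
      also have "\<dots> \<le> real N * (w i * (1 + (a * A i + b * B i))) - 1"
        using wp[OF i] pos[OF i] Np by (intro ln_le_minus_one mult_pos_pos)
      finally show "ln (real N * w i) + ln (1 + (a * A i + b * B i))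
        \<le> real N * (w i * (1 + (a * A i + b * B i))) - 1" .
    qed
    also have "\<dots> = real N * ((\<Sum>i=1..N. w i) + a * (\<Sum>i=1..N. w i * A i) + b * (\<Sum>i=1..N. w i * B i)) - real N"
      by (simp add: sum_subtractf sum.distrib sum_distrib_left algebra_simps)
    also have "\<dots> = 0" using w by simp
    finally have "(\<Sum>i=1..N. ln (real N * w i)) \<le> - (\<Sum>i=1..N. ln (1 + (a * A i + b * B i)))"
      by (simp add: sum.distrib)
    moreover have "z = exp (\<Sum>i=1..N. ln (real N * w i))"
      unfolding w(1) using wp Np by (auto simp: exp_sum intro!: prod.cong)
    ultimately show ?thesis by simp
  qed
qed

text \<open>The lower bound on \<open>L\<close> is positive, so the infinite branch of
  \<open>neg2_log\<close> is excluded.\<close>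

lemma neg2_log_bounds:
  assumes "exp (- u / 2) \<le> L" "L \<le> exp (- l / 2)"
  shows "neg2_log L = ereal (- 2 * ln L)" "l \<le> - 2 * ln L" "- 2 * ln L \<le> u"
proof -
  have "0 < L" using assms(1) exp_gt_zero less_le_trans by blast
  then show "neg2_log L = ereal (- 2 * ln L)" by (simp add: neg2_log_def)
  have "ln L \<le> - l / 2" using \<open>0 < L\<close> assms(2) by (metis exp_le_cancel_iff exp_ln)
  then show "l \<le> - 2 * ln L" by simp
  have "- u / 2 \<le> ln L" using \<open>0 < L\<close> assms(1) by (metis exp_le_cancel_iff exp_ln)
  then show "- 2 * ln L \<le> u" by simp
qed

lemma abs_add_le: "\<bar>a\<bar> \<le> c \<Longrightarrow> \<bar>b\<bar> \<le> d \<Longrightarrow> \<bar>a + b\<bar> \<le> c + d" for a b c d :: real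
  by linarith

lemma abs_diff_le: "\<bar>a\<bar> \<le> c \<Longrightarrow> \<bar>b\<bar> \<le> d \<Longrightarrow> \<bar>a - b\<bar> \<le> c + d" for a b c d :: real
  by linarith

lemma abs_mult_le: "\<bar>a\<bar> \<le> c \<Longrightarrow> \<bar>b\<bar> \<le> d \<Longrightarrow> \<bar>a * b\<bar> \<le> c * d" for a b c d :: real
  unfolding abs_mult by (rule mult_mono) auto

text \<open>The deterministic content of the good event: normalized sums of size at most K,
  empirical second-moment matrix near the identity, no entry comparable to sqrt N. K may be large,
  \<eta> is small compared with 1/K; K \<le> \<eta> sqrt N makes the plain sample means at most
  \<eta>.\<close>

definition el_regular :: "real \<Rightarrow> real \<Rightarrow> nat \<Rightarrow> (nat \<Rightarrow> real) \<Rightarrow> (nat \<Rightarrow> real) \<Rightarrow> bool" where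
  "el_regular K \<eta> N A B \<longleftrightarrow> 0 < N \<and> K \<le> \<eta> * sqrt N \<and>
     \<bar>(\<Sum>i=1..N. A i) / sqrt N\<bar> \<le> K \<and> \<bar>(\<Sum>i=1..N. B i) / sqrt N\<bar> \<le> K \<and>
     \<bar>(\<Sum>i=1..N. (A i)\<^sup>2) / N - 1\<bar> \<le> \<eta> \<and> \<bar>(\<Sum>i=1..N. (B i)\<^sup>2) / N - 1\<bar> \<le> \<eta> \<and>
     \<bar>(\<Sum>i=1..N. A i * B i) / N\<bar> \<le> \<eta> \<and>
     (\<forall>i\<in>{1..N}. \<bar>A i\<bar> \<le> \<eta> * sqrt N) \<and> (\<forall>i\<in>{1..N}. \<bar>B i\<bar> \<le> \<eta> * sqrt N)"

definition norm_sq :: "nat \<Rightarrow> (nat \<Rightarrow> real) \<Rightarrow> (nat \<Rightarrow> real) \<Rightarrow> real" where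
  "norm_sq N A B = ((\<Sum>i=1..N. A i) / sqrt N)\<^sup>2 + ((\<Sum>i=1..N. B i) / sqrt N)\<^sup>2"

lemma two_abs_mult_le_squares: "2 * \<bar>a * b\<bar> \<le> a\<^sup>2 + b\<^sup>2" for a b :: real
  using sum_squares_bound[of "\<bar>a\<bar>" "\<bar>b\<bar>"] by (simp add: abs_mult)

text \<open>Both factors are twice what the quadratic bound on the logarithm leaves: with \<kappa> =
  2K\<eta> on the dual side, where 1 + 2\<eta> bounds the second-moment matrix, and with \<kappa> =
  8K\<eta> on the primal side, where (1 + 4\<eta>)/(1 - 4\<eta>) bounds the inverse of the
  covariance matrix. The hypothesis 8K\<eta> \<le> 1/2 is the admissibility of the larger \<kappa>.
  Both factors tend to 1 with \<eta>.\<close>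

lemma el_ratio_sandwich:
  fixes A B :: "nat \<Rightarrow> real"
  assumes eta: "0 < \<eta>" "\<eta> \<le> 1/16" "8 * K * \<eta> \<le> 1/2" and K: "0 < K" and reg: "el_regular K \<eta> N A B"
  defines "L \<equiv> el_ratio N (\<lambda>i. (A i, B i))"
  shows "neg2_log L = ereal (- 2 * ln L)"
    and "norm_sq N A B * (2 - (1 + 4 * K * \<eta>) * (1 + 2 * \<eta>)) \<le> - 2 * ln L"
    and "- 2 * ln L \<le> (1 + 16 * K * \<eta>) * ((1 + 4 * \<eta>) / (1 - 4 * \<eta>)) * norm_sq N A B"
proof -
  define x y where x: "x = (\<Sum>i=1..N. A i) / sqrt N" and y: "y = (\<Sum>i=1..N. B i) / sqrt N"
  have N: "0 < N" and xK: "\<bar>x\<bar> \<le> K" and yK: "\<bar>y\<bar> \<le> K" and KN: "K \<le> \<eta> * sqrt N"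
    and AA: "\<bar>(\<Sum>i=1..N. (A i)\<^sup>2) / N - 1\<bar> \<le> \<eta>"
    and BB: "\<bar>(\<Sum>i=1..N. (B i)\<^sup>2) / N - 1\<bar> \<le> \<eta>"
    and AB: "\<bar>(\<Sum>i=1..N. A i * B i) / N\<bar> \<le> \<eta>"
    using reg unfolding el_regular_def x y by blast+
  have mx: "\<bar>A i\<bar> \<le> \<eta> * sqrt N" "\<bar>B i\<bar> \<le> \<eta> * sqrt N" if "i \<in> {1..N}" for i
    using reg that unfolding el_regular_def by blast+
  note eta = eta K KN
  define sN where "sN = sqrt (real N)"
  have sN: "0 < sN" "sN * sN = real N" using N by (auto simp: sN_def)
  have sN2: "sN\<^sup>2 = real N" using sN by (simp add: power2_eq_square)
  define SA SB SAA SBB SAB where "SA = (\<Sum>i=1..N. A i)" and "SB = (\<Sum>i=1..N. B i)"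
    and "SAA = (\<Sum>i=1..N. (A i)\<^sup>2)" and "SBB = (\<Sum>i=1..N. (B i)\<^sup>2)" and "SAB = (\<Sum>i=1..N. A i * B i)"
  have SA: "SA = x * sN" using x sN by (simp add: SA_def sN_def)
  have SB: "SB = y * sN" using y sN by (simp add: SB_def sN_def)
  note xy2 = two_abs_mult_le_squares[of x y]
  let ?l = "(x\<^sup>2 + y\<^sup>2) * (2 - (1 + 4 * K * \<eta>) * (1 + 2 * \<eta>))"
  let ?u = "(1 + 16 * K * \<eta>) * ((1 + 4 * \<eta>) / (1 - 4 * \<eta>)) * (x\<^sup>2 + y\<^sup>2)"
  have up: "z \<le> exp (- ?l / 2)" if z: "z \<in> el_values N (\<lambda>i. (A i, B i))" for z
  proof -
    \<comment> \<open>The multiplier is the vector of sample means (x/\<open>sN\<close>,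
      y/\<open>sN\<close>). Entries are at most \<eta> \<open>sN\<close>, so \<open>sN\<close>
      cancels and each term contributes at most K\<eta>.\<close>
    define u where "u i = x / sN * A i + y / sN * B i" for i
    have ub: "\<bar>u i\<bar> \<le> 2 * K * \<eta>" if i: "i \<in> {1..N}" for i
    proof -
      have "\<bar>x / sN * A i\<bar> \<le> K / sN * (\<eta> * sN)" "\<bar>y / sN * B i\<bar> \<le> K / sN * (\<eta> * sN)"
        unfolding abs_mult using mx[OF i] xK yK sN(1) eta
        by (intro mult_mono; simp add: sN_def[symmetric] abs_divide divide_right_mono)+
      then have "\<bar>u i\<bar> \<le> K / sN * (\<eta> * sN) + K / sN * (\<eta> * sN)" unfolding u_def by (rule abs_add_le)
      also have "\<dots> = 2 * K * \<eta>" using sN by simp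
      finally show ?thesis .
    qed
    have "z \<le> exp (- (\<Sum>i=1..N. ln (1 + u i)))"
      unfolding u_def
    proof (rule el_values_le_dual[OF z])
      fix i assume "i \<in> {1..N}"
      then have "\<bar>u i\<bar> \<le> 2 * K * \<eta>" by (rule ub)
      then show "0 < 1 + (x / sN * A i + y / sN * B i)" using eta unfolding u_def by linarith
    qed
    also have "\<dots> \<le> exp (- ?l / 2)"
    proof -
      have "(\<Sum>i=1..N. u i - (1/2 + 2 * K * \<eta>) * (u i)\<^sup>2) \<le> (\<Sum>i=1..N. ln (1 + u i))"
        using ub eta by (intro sum_mono ln_one_plus_ge_quadratic) auto
      moreover have "(\<Sum>i=1..N. u i) = x\<^sup>2 + y\<^sup>2"
      proof -
        have "(\<Sum>i=1..N. u i) = x / sN * SA + y / sN * SB"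
          by (simp add: u_def SA_def SB_def sum.distrib sum_distrib_left)
        then show ?thesis using sN by (simp add: SA SB power2_eq_square)
      qed
      moreover have "(\<Sum>i=1..N. (u i)\<^sup>2) \<le> (x\<^sup>2 + y\<^sup>2) * (1 + 2 * \<eta>)"
      proof -
        have "(\<Sum>i=1..N. (u i)\<^sup>2) = (x / sN)\<^sup>2 * SAA + (y / sN)\<^sup>2 * SBB + 2 * (x / sN) * (y / sN) * SAB"
          unfolding u_def SAA_def SBB_def SAB_def sum_distrib_left sum.distrib[symmetric]
          by (intro sum.cong refl) (simp add: power2_eq_square algebra_simps)
        also have "\<dots> = x\<^sup>2 * (SAA / N) + y\<^sup>2 * (SBB / N) + 2 * (x * y) * (SAB / N)"
          using sN by (simp add: power_divide power2_eq_square)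
        also have "\<dots> \<le> x\<^sup>2 * (1 + \<eta>) + y\<^sup>2 * (1 + \<eta>) + (x\<^sup>2 + y\<^sup>2) * \<eta>"
        proof -
          have "2 * (x * y) * (SAB / N) \<le> (2 * \<bar>x * y\<bar>) * \<bar>SAB / N\<bar>"
            by (metis abs_ge_self abs_mult abs_numeral)
          also have "\<dots> \<le> (x\<^sup>2 + y\<^sup>2) * \<eta>"
            using AB by (intro mult_mono xy2) (auto simp: SAB_def)
          finally show ?thesis using AA BB
            by (intro add_mono mult_left_mono) (auto simp: SAA_def SBB_def)
        qed
        finally show ?thesis by (simp add: algebra_simps)
      qed
      then have "(1/2 + 2 * K * \<eta>) * (\<Sum>i=1..N. (u i)\<^sup>2) \<le> (1/2 + 2 * K * \<eta>) * ((x\<^sup>2 + y\<^sup>2) * (1 + 2 * \<eta>))"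
        using eta by (intro mult_left_mono) auto
      ultimately have "(x\<^sup>2 + y\<^sup>2) - (1/2 + 2 * K * \<eta>) * ((x\<^sup>2 + y\<^sup>2) * (1 + 2 * \<eta>)) \<le> (\<Sum>i=1..N. ln (1 + u i))"
        by (simp add: sum_subtractf sum_distrib_left[symmetric])
      moreover have "(x\<^sup>2 + y\<^sup>2) - (1/2 + 2 * K * \<eta>) * ((x\<^sup>2 + y\<^sup>2) * (1 + 2 * \<eta>)) = ?l / 2"
        by (simp add: algebra_simps)
      ultimately show ?thesis by simp
    qed
    finally show ?thesis .
  qed
  text \<open>The weights \<open>(1 - h \<bullet> (R\<^sub>i - mean)) / N\<close>, with \<open>h\<close> solving \<open>C h = mean\<close> for the empirical covariance
    matrix \<open>C\<close> with entries \<open>a\<close>, \<open>b\<close>, \<open>d\<close>, satisfy the constraints exactly, so the Lagrange multiplier of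
    the optimal weights is not needed.\<close>
  have low: "\<exists>z \<in> el_values N (\<lambda>i. (A i, B i)). exp (- ?u / 2) \<le> z"
  proof -
    define X Y where "X = x / sN" and "Y = y / sN"
    define a b d where "a = SAA / N - X\<^sup>2" and "b = SAB / N - X * Y" and "d = SBB / N - Y\<^sup>2"
    define D where "D = a * d - b\<^sup>2"
    \<comment> \<open>Cramer's rule for the symmetric two-by-two system, with determinant
      \<open>D\<close>.\<close>
    define h k where "h = (d * X - b * Y) / D" and "k = (a * Y - b * X) / D"
    have Ks: "K / sN \<le> \<eta>" using eta sN by (simp add: field_simps sN_def)
    have X1: "\<bar>X\<bar> \<le> K / sN" and Y1: "\<bar>Y\<bar> \<le> K / sN"
      using xK yK sN(1) by (auto simp: X_def Y_def abs_divide intro: divide_right_mono)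
    have sN1: "1 \<le> sN" using N by (simp add: sN_def)
    have X2: "\<bar>X\<bar> \<le> \<eta>" and Y2: "\<bar>Y\<bar> \<le> \<eta>" using X1 Y1 Ks by auto
    have "\<eta> * \<eta> \<le> \<eta> * 1" using eta by (intro mult_left_mono) auto
    then have ee: "\<eta> * \<eta> \<le> \<eta>" by simp
    have XX: "X\<^sup>2 \<le> \<eta>" "Y\<^sup>2 \<le> \<eta>" "\<bar>X * Y\<bar> \<le> \<eta>"
      using abs_mult_le[OF X2 X2] abs_mult_le[OF Y2 Y2] abs_mult_le[OF X2 Y2] ee
      unfolding power2_eq_square by linarith+
    have ab: "\<bar>a - 1\<bar> \<le> 2 * \<eta>" "\<bar>d - 1\<bar> \<le> 2 * \<eta>" "\<bar>b\<bar> \<le> 2 * \<eta>"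
    proof -
      show "\<bar>a - 1\<bar> \<le> 2 * \<eta>" using AA XX zero_le_power2[of X] unfolding a_def SAA_def by linarith
      show "\<bar>d - 1\<bar> \<le> 2 * \<eta>" using BB XX zero_le_power2[of Y] unfolding d_def SBB_def by linarith
      show "\<bar>b\<bar> \<le> 2 * \<eta>" using AB XX unfolding b_def SAB_def by linarith
    qed
    \<comment> \<open>The bound is (1 - 2\<eta>)^2 - (2\<eta>)^2, exactly 1 - 4\<eta>.\<close>
    have D: "1 - 4 * \<eta> \<le> D"
    proof -
      have "(1 - 2 * \<eta>) * (1 - 2 * \<eta>) \<le> a * d" using ab eta by (intro mult_mono) auto
      moreover have "b\<^sup>2 \<le> (2 * \<eta>)\<^sup>2" using ab(3) by (metis abs_ge_zero power2_abs power_mono)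
      ultimately show ?thesis by (simp add: D_def power2_eq_square algebra_simps)
    qed
    then have Dp: "0 < D" "3/4 \<le> D" using eta by auto
    have hk: "\<bar>h\<bar> \<le> 2 * K / sN" "\<bar>k\<bar> \<le> 2 * K / sN"
    proof -
      have Kp: "0 \<le> K / sN" using eta sN by simp
      have "\<bar>d * X\<bar> \<le> (1 + 2 * \<eta>) * (K / sN)" "\<bar>b * Y\<bar> \<le> (2 * \<eta>) * (K / sN)"
        "\<bar>a * Y\<bar> \<le> (1 + 2 * \<eta>) * (K / sN)" "\<bar>b * X\<bar> \<le> (2 * \<eta>) * (K / sN)"
        using ab X1 Y1 by (intro abs_mult_le; linarith)+
      then have "\<bar>d * X - b * Y\<bar> \<le> (1 + 4 * \<eta>) * (K / sN)" "\<bar>a * Y - b * X\<bar> \<le> (1 + 4 * \<eta>) * (K / sN)"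
        using abs_diff_le[of "d * X" "(1 + 2 * \<eta>) * (K / sN)" "b * Y" "(2 * \<eta>) * (K / sN)"]
          abs_diff_le[of "a * Y" "(1 + 2 * \<eta>) * (K / sN)" "b * X" "(2 * \<eta>) * (K / sN)"]
        unfolding distrib_right[symmetric] by (simp_all add: add.commute)
      \<comment> \<open>With \<eta> \<le> 1/16 the left factor is at most 5/4, while
        2\<open>D\<close> is at least 3/2; this is where the 2 in the bound on \<open>h\<close> and
        \<open>k\<close> comes from.\<close>
      moreover have "(1 + 4 * \<eta>) * (K / sN) \<le> (2 * K / sN) * D"
      proof -
        have "(1 + 4 * \<eta>) * (K / sN) \<le> (2 * D) * (K / sN)"
          using Dp eta Kp by (intro mult_right_mono) auto
        then show ?thesis by (simp add: mult_ac)
      qed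
      ultimately have "\<bar>d * X - b * Y\<bar> \<le> (2 * K / sN) * D" "\<bar>a * Y - b * X\<bar> \<le> (2 * K / sN) * D"
        by linarith+
      then show "\<bar>h\<bar> \<le> 2 * K / sN" "\<bar>k\<bar> \<le> 2 * K / sN"
        using Dp by (auto simp: h_def k_def abs_divide pos_divide_le_eq)
    qed
    have sys: "a * h + b * k = X" "b * h + d * k = Y"
    proof -
      have "a * h + b * k = (a * (d * X - b * Y) + b * (a * Y - b * X)) / D"
        by (simp add: h_def k_def add_divide_distrib)
      also have "a * (d * X - b * Y) + b * (a * Y - b * X) = D * X"
        by (simp add: D_def power2_eq_square algebra_simps)
      finally show "a * h + b * k = X" using Dp by simp
      have "b * h + d * k = (b * (d * X - b * Y) + d * (a * Y - b * X)) / D"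
        by (simp add: h_def k_def add_divide_distrib)
      also have "b * (d * X - b * Y) + d * (a * Y - b * X) = D * Y"
        by (simp add: D_def power2_eq_square algebra_simps)
      finally show "b * h + d * k = Y" using Dp by simp
    qed
    define u where "u i = h * (A i - X) + k * (B i - Y)" for i
    have ub: "\<bar>u i\<bar> \<le> 8 * K * \<eta>" if i: "i \<in> {1..N}" for i
    proof -
      have e1: "\<eta> \<le> \<eta> * sN" using sN1 eta by simp
      have "\<bar>A i - X\<bar> \<le> 2 * \<eta> * sN" "\<bar>B i - Y\<bar> \<le> 2 * \<eta> * sN"
        using mx[OF i] X2 Y2 e1 by (auto simp: sN_def[symmetric])
      then have "\<bar>h * (A i - X)\<bar> \<le> (2 * K / sN) * (2 * \<eta> * sN)" "\<bar>k * (B i - Y)\<bar> \<le> (2 * K / sN) * (2 * \<eta> * sN)"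
        using hk by (blast intro: abs_mult_le)+
      then have "\<bar>u i\<bar> \<le> (2 * K / sN) * (2 * \<eta> * sN) + (2 * K / sN) * (2 * \<eta> * sN)"
        unfolding u_def by (rule abs_add_le)
      also have "\<dots> = 8 * K * \<eta>" using sN by simp
      finally show ?thesis .
    qed
    have NX: "SA = N * X" "SB = N * Y" using sN(1) unfolding SA SB X_def Y_def sN(2)[symmetric] by auto
    have SS: "SAA = N * (a + X\<^sup>2)" "SBB = N * (d + Y\<^sup>2)" "SAB = N * (b + X * Y)"
      using N by (auto simp: a_def b_def d_def)
    \<comment> \<open>The next three sums are the three constraints: the correction \<open>u\<close>
      has total 0, so the weights still sum to 1, and its moments against \<open>A\<close> and
      \<open>B\<close> equal the sample sums, so they cancel them.\<close>
    have u1: "(\<Sum>i=1..N. u i) = 0"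
    proof -
      have "(\<Sum>i=1..N. u i) = h * (SA - N * X) + k * (SB - N * Y)"
        by (simp add: u_def SA_def SB_def sum.distrib sum_distrib_left sum_subtractf algebra_simps)
      then show ?thesis by (simp add: NX)
    qed
    have uA: "(\<Sum>i=1..N. u i * A i) = N * X"
    proof -
      have "(\<Sum>i=1..N. u i * A i) = h * (SAA - X * SA) + k * (SAB - Y * SA)"
        by (simp add: u_def SA_def SAA_def SAB_def sum.distrib sum_distrib_left sum_subtractf algebra_simps power2_eq_square)
      also have "\<dots> = N * (a * h + b * k)" by (simp add: NX SS algebra_simps power2_eq_square)
      finally show ?thesis by (simp add: sys)
    qed
    have uB: "(\<Sum>i=1..N. u i * B i) = N * Y"
    proof -
      have "(\<Sum>i=1..N. u i * B i) = h * (SAB - X * SB) + k * (SBB - Y * SB)"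
        by (simp add: u_def SB_def SBB_def SAB_def sum.distrib sum_distrib_left sum_subtractf algebra_simps power2_eq_square)
      also have "\<dots> = N * (b * h + d * k)" by (simp add: NX SS algebra_simps power2_eq_square)
      finally show ?thesis by (simp add: sys)
    qed
    \<comment> \<open>\<open>u\<close> is affine in \<open>A\<close> and \<open>B\<close> with total
      0, so its sum of squares reduces to N(hX + kY), the quadratic form of the inverse covariance
      matrix at (x, y). Written with the adjugate, its numerator is at most (1 + 4\<eta>)(x^2 +
      y^2).\<close>
    have u2: "(\<Sum>i=1..N. (u i)\<^sup>2) \<le> (1 + 4 * \<eta>) / (1 - 4 * \<eta>) * (x\<^sup>2 + y\<^sup>2)"
    proof -
      have "(\<Sum>i=1..N. (u i)\<^sup>2) = (\<Sum>i=1..N. h * (u i * A i) + k * (u i * B i) - (h * X + k * Y) * u i)"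
        by (intro sum.cong refl) (simp add: u_def power2_eq_square algebra_simps)
      also have "\<dots> = h * (\<Sum>i=1..N. u i * A i) + k * (\<Sum>i=1..N. u i * B i) - (h * X + k * Y) * (\<Sum>i=1..N. u i)"
        by (simp only: sum.distrib sum_subtractf sum_distrib_left)
      also have "\<dots> = N * (h * X + k * Y)" by (simp only: u1 uA uB) (simp add: algebra_simps)
      also have "\<dots> = (N * (d * X\<^sup>2 + a * Y\<^sup>2 - 2 * b * (X * Y))) / D"
        unfolding h_def k_def times_divide_eq_left add_divide_distrib[symmetric] times_divide_eq_right
        by (intro arg_cong2[of _ _ _ _ "(/)"] refl) (simp add: power2_eq_square algebra_simps)
      also have "N * (d * X\<^sup>2 + a * Y\<^sup>2 - 2 * b * (X * Y)) = d * x\<^sup>2 + a * y\<^sup>2 - 2 * b * (x * y)"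
      proof -
        have "x = X * sN" "y = Y * sN" using sN by (auto simp: X_def Y_def)
        then show ?thesis by (simp add: sN(2)[symmetric] power2_eq_square algebra_simps)
      qed
      also have "(d * x\<^sup>2 + a * y\<^sup>2 - 2 * b * (x * y)) / D \<le> ((1 + 4 * \<eta>) * (x\<^sup>2 + y\<^sup>2)) / D"
      proof (rule divide_right_mono)
        have "- 2 * b * (x * y) \<le> \<bar>b\<bar> * (2 * \<bar>x * y\<bar>)"
          using abs_ge_minus_self[of "b * (x * y)"] by (simp add: abs_mult mult_ac)
        also have "\<dots> \<le> (2 * \<eta>) * (x\<^sup>2 + y\<^sup>2)" using ab eta xy2 by (intro mult_mono) auto
        finally have 1: "- 2 * b * (x * y) \<le> (2 * \<eta>) * (x\<^sup>2 + y\<^sup>2)" .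
        have "d * x\<^sup>2 \<le> (1 + 2 * \<eta>) * x\<^sup>2" "a * y\<^sup>2 \<le> (1 + 2 * \<eta>) * y\<^sup>2"
          using ab by (auto intro!: mult_right_mono)
        with 1 show "d * x\<^sup>2 + a * y\<^sup>2 - 2 * b * (x * y) \<le> (1 + 4 * \<eta>) * (x\<^sup>2 + y\<^sup>2)"
          by (simp add: algebra_simps)
      qed (use Dp in simp)
      also have "\<dots> \<le> ((1 + 4 * \<eta>) * (x\<^sup>2 + y\<^sup>2)) / (1 - 4 * \<eta>)"
        using D eta by (intro divide_left_mono mult_nonneg_nonneg mult_pos_pos) auto
      finally show ?thesis by simp
    qed
    define w where "w i = (1 - u i) / N" for i
    have mem: "(\<Prod>i=1..N. real N * w i) \<in> el_values N (\<lambda>i. (A i, B i))"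
    proof (rule el_values_pairI)
      have "(\<Sum>i=1..N. w i) = (N - (\<Sum>i=1..N. u i)) / N"
        by (simp add: w_def sum_divide_distrib[symmetric] sum_subtractf)
      then show "(\<Sum>i=1..N. w i) = 1" using N unfolding u1 by simp
      have "(\<Sum>i=1..N. w i * A i) = (SA - (\<Sum>i=1..N. u i * A i)) / N"
        unfolding SA_def sum_subtractf[symmetric] sum_divide_distrib
        by (intro sum.cong refl) (simp add: w_def left_diff_distrib)
      then show "(\<Sum>i=1..N. w i * A i) = 0" using N unfolding uA NX by simp
      have "(\<Sum>i=1..N. w i * B i) = (SB - (\<Sum>i=1..N. u i * B i)) / N"
        unfolding SB_def sum_subtractf[symmetric] sum_divide_distrib
        by (intro sum.cong refl) (simp add: w_def left_diff_distrib)
      then show "(\<Sum>i=1..N. w i * B i) = 0" using N unfolding uB NX by simp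
      show "0 \<le> w i" if "i \<in> {1..N}" for i
        using ub[OF that] eta by (simp add: w_def abs_le_iff)
    qed
    have up1: "1 + - u i > 0" if "i \<in> {1..N}" for i using ub[OF that] eta by linarith
    have "(\<Prod>i=1..N. real N * w i) = (\<Prod>i=1..N. exp (ln (1 + - u i)))"
      using up1 N by (intro prod.cong refl) (auto simp: w_def)
    also have "\<dots> = exp (\<Sum>i=1..N. ln (1 + - u i))" by (simp add: exp_sum)
    finally have e: "(\<Prod>i=1..N. real N * w i) = exp (\<Sum>i=1..N. ln (1 + - u i))" .
    have "(\<Sum>i=1..N. - u i - (1/2 + 8 * K * \<eta>) * (- u i)\<^sup>2) \<le> (\<Sum>i=1..N. ln (1 + - u i))"
      using ub eta by (intro sum_mono ln_one_plus_ge_quadratic) auto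
    moreover have "(\<Sum>i=1..N. - u i - (1/2 + 8 * K * \<eta>) * (- u i)\<^sup>2) = - (1/2 + 8 * K * \<eta>) * (\<Sum>i=1..N. (u i)\<^sup>2)"
      using u1 unfolding sum_subtractf sum_negf power2_minus sum_distrib_left[symmetric] by (simp add: algebra_simps)
    moreover have "(1/2 + 8 * K * \<eta>) * (\<Sum>i=1..N. (u i)\<^sup>2) \<le> (1/2 + 8 * K * \<eta>) * ((1 + 4 * \<eta>) / (1 - 4 * \<eta>) * (x\<^sup>2 + y\<^sup>2))"
      using u2 eta by (intro mult_left_mono) auto
    moreover have "(1/2 + 8 * K * \<eta>) * ((1 + 4 * \<eta>) / (1 - 4 * \<eta>) * (x\<^sup>2 + y\<^sup>2)) = ?u / 2"
    proof -
      have "(1/2 + 8 * K * \<eta>) * F = (1 + 16 * K * \<eta>) * F / 2" for F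
        by (simp add: algebra_simps)
      then show ?thesis by (simp only: mult.assoc)
    qed
    ultimately have "- ?u / 2 \<le> (\<Sum>i=1..N. ln (1 + - u i))" by linarith
    then show ?thesis by (intro bexI[OF _ mem]) (simp only: e exp_le_cancel_iff)
  qed
  have ne: "el_values N (\<lambda>i. (A i, B i)) \<noteq> {}" using low by auto
  have L: "L = Sup (el_values N (\<lambda>i. (A i, B i)))" using ne by (simp add: L_def el_ratio_eq_Sup)
  have "L \<le> exp (- ?l / 2)" unfolding L using ne up by (intro cSup_least) auto
  moreover have "exp (- ?u / 2) \<le> L"
  proof -
    have "bdd_above (el_values N (\<lambda>i. (A i, B i)))" using up by (auto intro!: bdd_aboveI)
    then show ?thesis unfolding L using low by (meson cSup_upper2)
  qed
  ultimately show "neg2_log L = ereal (- 2 * ln L)"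
    "norm_sq N A B * (2 - (1 + 4 * K * \<eta>) * (1 + 2 * \<eta>)) \<le> - 2 * ln L"
    "- 2 * ln L \<le> (1 + 16 * K * \<eta>) * ((1 + 4 * \<eta>) / (1 - 4 * \<eta>)) * norm_sq N A B"
    unfolding norm_sq_def x[symmetric] y[symmetric] by (blast intro: neg2_log_bounds)+
qed

text \<open>A nonzero factor on a constraint leaves the feasible weights unchanged. This allows each
  statistic to be divided by its own standard deviation.\<close>

lemma el_ratio_scale:
  assumes a: "a \<noteq> 0" and b: "b \<noteq> 0"
  shows "el_ratio N (\<lambda>i. (a * A i, b * B i)) = el_ratio N (\<lambda>i. (A i, B i))"
proof -
  have "el_values N (\<lambda>i. (a * A i, b * B i)) = el_values N (\<lambda>i. (A i, B i))"
  proof -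
    have s: "(\<Sum>i=1..N. w i * (a * A i)) = a * (\<Sum>i=1..N. w i * A i)"
      "(\<Sum>i=1..N. w i * (b * B i)) = b * (\<Sum>i=1..N. w i * B i)" for w :: "nat \<Rightarrow> real"
      by (simp_all add: sum_distrib_left mult_ac)
    show ?thesis
      unfolding el_values_def using a b s by (simp add: zero_prod_def sum_prod)
  qed
  then show ?thesis by (simp add: el_ratio_eq_Sup)
qed

lemma el_ratio_cong:
  assumes "\<And>i. i \<in> {1..N} \<Longrightarrow> R i = R' i"
  shows "el_ratio N R = el_ratio N R'"
proof -
  have "(\<Sum>i=1..N. w i *\<^sub>R R i) = (\<Sum>i=1..N. w i *\<^sub>R R' i)" for w :: "nat \<Rightarrow> real"
    using assms by (intro sum.cong) auto
  then have "el_values N R = el_values N R'" unfolding el_values_def by (simp only:)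
  then show ?thesis by (simp only: el_ratio_eq_Sup)
qed

section \<open>Measurability of the likelihood ratio\<close>

lemma el_values_le_one:
  assumes "z \<in> el_values N (\<lambda>i. (A i, B i))"
  shows "z \<le> 1"
  using el_values_le_dual[OF assms, of 0 0] by simp

lemma el_values_nonneg:
  assumes "z \<in> el_values N R"
  shows "0 \<le> z"
  using assms by (auto simp: el_values_def intro!: prod_nonneg)

lemma el_ratio_nonneg: "0 \<le> el_ratio N (\<lambda>i. (A i, B i))"
proof (cases "el_values N (\<lambda>i. (A i, B i)) = {}")
  case False
  then obtain z where z: "z \<in> el_values N (\<lambda>i. (A i, B i))" by auto
  have "bdd_above (el_values N (\<lambda>i. (A i, B i)))" by (rule bdd_aboveI) (rule el_values_le_one)
  then have "z \<le> Sup (el_values N (\<lambda>i. (A i, B i)))" by (rule cSup_upper[OF z])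
  then show ?thesis using el_values_nonneg[OF z] False by (simp add: el_ratio_eq_Sup)
qed (simp add: el_ratio_eq_Sup)

text \<open>The constraints relaxed by \<open>\<theta>\<close> have rational solutions, and by compactness the supremum is at
  least \<open>a > 0\<close> iff they are solvable for every \<open>\<theta> > 0\<close>. This turns the supremum into countably many
  measurable conditions on the data.\<close>

definition el_near :: "nat \<Rightarrow> (nat \<Rightarrow> real) \<Rightarrow> (nat \<Rightarrow> real) \<Rightarrow> real \<Rightarrow> real \<Rightarrow> (nat \<Rightarrow> real) \<Rightarrow> bool" where
  "el_near N A B a \<theta> w \<longleftrightarrow>
     \<bar>(\<Sum>i=1..N. w i) - 1\<bar> \<le> \<theta> \<and> \<bar>\<Sum>i=1..N. w i * A i\<bar> \<le> \<theta> \<and> \<bar>\<Sum>i=1..N. w i * B i\<bar> \<le> \<theta> \<and>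
     (\<forall>i\<in>{1..N}. - \<theta> \<le> w i \<and> w i \<le> 1 + \<theta>) \<and> a - \<theta> \<le> (\<Prod>i=1..N. real N * w i)"

lemma el_near_mono:
  assumes near: "el_near N A B a \<theta>' w" and le: "\<theta>' \<le> \<theta>"
  shows "el_near N A B a \<theta> w"
proof -
  have n: "\<bar>(\<Sum>i=1..N. w i) - 1\<bar> \<le> \<theta>'" "\<bar>\<Sum>i=1..N. w i * A i\<bar> \<le> \<theta>'" "\<bar>\<Sum>i=1..N. w i * B i\<bar> \<le> \<theta>'"
    "a - \<theta>' \<le> (\<Prod>i=1..N. real N * w i)"
    using near unfolding el_near_def by blast+
  have b: "- \<theta>' \<le> w i" "w i \<le> 1 + \<theta>'" if "i \<in> {1..N}" for i
    using near that unfolding el_near_def by blast+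
  have "a - \<theta> \<le> a - \<theta>'" using le by simp
  moreover have "- \<theta> \<le> w i \<and> w i \<le> 1 + \<theta>" if "i \<in> {1..N}" for i
    using b[OF that] le by simp
  ultimately show ?thesis
    unfolding el_near_def
    using order_trans[OF n(1) le] order_trans[OF n(2) le] order_trans[OF n(3) le] order_trans[OF _ n(4)]
    by blast
qed

text \<open>All relaxed inequalities hold strictly at \<open>w\<close>, so they survive for close
  rational weights. Approximating from above keeps the weights nonnegative, and restricting them to
  {1..N} puts them into a countable set of functions.\<close>

lemma el_near_rational:
  assumes w: "(\<Sum>i=1..N. w i) = 1" "(\<Sum>i=1..N. w i * A i) = 0" "(\<Sum>i=1..N. w i * B i) = 0"
      "\<And>i. i \<in> {1..N} \<Longrightarrow> 0 \<le> w i" "a - \<theta> < (\<Prod>i=1..N. real N * w i)" and t: "0 < \<theta>"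
  shows "\<exists>q \<in> PiE {1..N} (\<lambda>_. \<rat>). el_near N A B a \<theta> q"
proof -
  have "\<exists>q. \<forall>m i. q m i \<in> \<rat> \<and> w i < q m i \<and> q m i < w i + 1 / real (Suc m)"
  proof (intro choice allI)
    fix m i
    have "w i < w i + 1 / real (Suc m)" by simp
    from Rats_dense_in_real[OF this]
    show "\<exists>r. r \<in> \<rat> \<and> w i < r \<and> r < w i + 1 / real (Suc m)" by blast
  qed
  then obtain q where q: "\<And>m i. q m i \<in> \<rat>" "\<And>m i. w i < q m i" "\<And>m i. q m i < w i + 1 / real (Suc m)"
    by blast
  have lim: "(\<lambda>m. q m i) \<longlonglongrightarrow> w i" for i
  proof (rule tendsto_sandwich[of "\<lambda>_. w i" _ _ "\<lambda>m. w i + 1 / real (Suc m)"])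
    have "(\<lambda>m. w i + 1 / real (Suc m)) \<longlonglongrightarrow> w i + 0"
      using LIMSEQ_inverse_real_of_nat by (intro tendsto_add tendsto_const) (simp add: inverse_eq_divide)
    then show "(\<lambda>m. w i + 1 / real (Suc m)) \<longlonglongrightarrow> w i" by simp
  qed (use q(2,3) in \<open>auto intro!: always_eventually less_imp_le\<close>)
  have w1: "w i \<le> 1" if i: "i \<in> {1..N}" for i
  proof -
    have "w i \<le> (\<Sum>i=1..N. w i)" using w(4) i by (intro member_le_sum) auto
    then show ?thesis using w(1) by simp
  qed
  have "(\<lambda>m. \<bar>(\<Sum>i=1..N. q m i) - 1\<bar>) \<longlonglongrightarrow> \<bar>(\<Sum>i=1..N. w i) - 1\<bar>"
    by (intro tendsto_intros lim)
  then have e1: "eventually (\<lambda>m. \<bar>(\<Sum>i=1..N. q m i) - 1\<bar> < \<theta>) sequentially"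
    using w t by (intro order_tendstoD(2)) auto
  have "(\<lambda>m. \<bar>\<Sum>i=1..N. q m i * A i\<bar>) \<longlonglongrightarrow> \<bar>\<Sum>i=1..N. w i * A i\<bar>"
    by (intro tendsto_intros lim)
  then have e2: "eventually (\<lambda>m. \<bar>\<Sum>i=1..N. q m i * A i\<bar> < \<theta>) sequentially"
    using w t by (intro order_tendstoD(2)) auto
  have "(\<lambda>m. \<bar>\<Sum>i=1..N. q m i * B i\<bar>) \<longlonglongrightarrow> \<bar>\<Sum>i=1..N. w i * B i\<bar>"
    by (intro tendsto_intros lim)
  then have e3: "eventually (\<lambda>m. \<bar>\<Sum>i=1..N. q m i * B i\<bar> < \<theta>) sequentially"
    using w t by (intro order_tendstoD(2)) auto
  have "(\<lambda>m. \<Prod>i=1..N. real N * q m i) \<longlonglongrightarrow> (\<Prod>i=1..N. real N * w i)"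
    by (intro tendsto_intros lim)
  then have e4: "eventually (\<lambda>m. a - \<theta> < (\<Prod>i=1..N. real N * q m i)) sequentially"
    using w(5) by (intro order_tendstoD(1))
  have e5: "eventually (\<lambda>m. \<forall>i\<in>{1..N}. q m i < 1 + \<theta>) sequentially"
  proof (rule eventually_ball_finite)
    show "\<forall>i\<in>{1..N}. \<forall>\<^sub>F m in sequentially. q m i < 1 + \<theta>"
    proof
      fix i assume "i \<in> {1..N}"
      then have "w i < 1 + \<theta>" using w1[of i] t by simp
      then show "\<forall>\<^sub>F m in sequentially. q m i < 1 + \<theta>" using lim[of i] by (intro order_tendstoD(2))
    qed
  qed simp
  have "\<forall>\<^sub>F m in sequentially. \<bar>(\<Sum>i=1..N. q m i) - 1\<bar> < \<theta> \<and> \<bar>\<Sum>i=1..N. q m i * A i\<bar> < \<theta> \<and>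
    \<bar>\<Sum>i=1..N. q m i * B i\<bar> < \<theta> \<and> a - \<theta> < (\<Prod>i=1..N. real N * q m i) \<and> (\<forall>i\<in>{1..N}. q m i < 1 + \<theta>)"
    using e1 e2 e3 e4 e5 by eventually_elim blast
  from eventually_happens'[OF sequentially_bot this]
  obtain m where m: "\<bar>(\<Sum>i=1..N. q m i) - 1\<bar> < \<theta>" "\<bar>\<Sum>i=1..N. q m i * A i\<bar> < \<theta>"
    "\<bar>\<Sum>i=1..N. q m i * B i\<bar> < \<theta>" "a - \<theta> < (\<Prod>i=1..N. real N * q m i)" "\<forall>i\<in>{1..N}. q m i < 1 + \<theta>"
    by blast
  have c: "(\<Sum>i=1..N. restrict (q m) {1..N} i) = (\<Sum>i=1..N. q m i)"
     "(\<Sum>i=1..N. restrict (q m) {1..N} i * A i) = (\<Sum>i=1..N. q m i * A i)"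
     "(\<Sum>i=1..N. restrict (q m) {1..N} i * B i) = (\<Sum>i=1..N. q m i * B i)"
     "(\<Prod>i=1..N. real N * restrict (q m) {1..N} i) = (\<Prod>i=1..N. real N * q m i)"
    by (auto intro!: sum.cong prod.cong)
  have "- \<theta> \<le> q m i" if "i \<in> {1..N}" for i using q(2)[of i m] w(4)[OF that] t by linarith
  then have "el_near N A B a \<theta> (restrict (q m) {1..N})"
    using m unfolding el_near_def c by (auto intro: less_imp_le)
  moreover have "restrict (q m) {1..N} \<in> PiE {1..N} (\<lambda>_. \<rat>)" using q by auto
  ultimately show ?thesis by blast
qed

lemma compact_function_box:
  fixes S :: "nat \<Rightarrow> real set"
  assumes "\<And>i. compact (S i)"
  shows "compact (PiE UNIV S)"
proof -
  have "compactin (product_topology (\<lambda>_. euclidean) UNIV) (PiE UNIV S)"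
    using assms by (simp add: compactin_PiE)
  then show ?thesis by (simp add: euclidean_product_topology)
qed

text \<open>Finite intersection property: the relaxed solution sets are closed, decrease with the
  relaxation and all meet one compact box. A common point satisfies every relaxation and hence the
  exact constraints.\<close>

lemma el_near_limit:
  assumes near: "\<And>k. \<exists>w. el_near N A B a (1 / real (Suc k)) w"
  shows "\<exists>w. (\<Sum>i=1..N. w i) = 1 \<and> (\<Sum>i=1..N. w i * A i) = 0 \<and> (\<Sum>i=1..N. w i * B i) = 0 \<and>
     (\<forall>i\<in>{1..N}. 0 \<le> w i) \<and> a \<le> (\<Prod>i=1..N. real N * w i)"
proof -
  \<comment> \<open>The relaxation never exceeds 1, so the bounds -\<theta> and 1 + \<theta> on a
    weight fit into [-1, 2]. Coordinates outside {1..N} are pinned to 0 to make the box compact in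
    the space of all sequences.\<close>
  define K where "K = PiE UNIV (\<lambda>i. if i \<in> {1..N} then {-1..2::real} else {0})"
  define C where "C k = {w. el_near N A B a (1 / real (Suc k)) w}" for k
  have mono: "el_near N A B a (1 / real (Suc k)) w" if "el_near N A B a (1 / real (Suc l)) w" "k \<le> l" for k l w
  proof -
    have "1 / real (Suc l) \<le> 1 / real (Suc k)" using that by (intro divide_left_mono) auto
    then show ?thesis by (rule el_near_mono[OF that(1)])
  qed
  have cK: "compact K" unfolding K_def by (intro compact_function_box) auto
  have cC: "closed (C k)" for k
  proof -
    have co: "continuous_on UNIV (\<lambda>w::nat \<Rightarrow> real. w i)" for i
      by (rule continuous_on_product_coordinates)
    have "closed (\<Inter>i\<in>{1..N}. {w. - (1 / real (Suc k)) \<le> w i \<and> w i \<le> 1 + 1 / real (Suc k)})"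
      by (intro closed_INT ballI closed_Collect_conj closed_Collect_le co continuous_on_const)
    then have "closed {w. \<forall>i\<in>{1..N}. - (1 / real (Suc k)) \<le> w i \<and> w i \<le> 1 + 1 / real (Suc k)}"
      by (simp only: INTER_eq mem_Collect_eq)
    then show ?thesis
      unfolding C_def el_near_def
      by (intro closed_Collect_conj closed_Collect_le co continuous_on_const continuous_on_rabs
          continuous_on_diff continuous_on_sum continuous_on_mult continuous_on_prod)
  qed
  have fip: "K \<inter> (\<Inter>k\<in>I'. C k) \<noteq> {}" if "finite I'" for I'
  proof -
    obtain l where l: "\<forall>k\<in>I'. k \<le> l" using \<open>finite I'\<close> finite_nat_set_iff_bounded_le by blast
    obtain w where w: "el_near N A B a (1 / real (Suc l)) w" using near by blast
    define w' where "w' i = (if i \<in> {1..N} then w i else 0)" for i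
    have w': "el_near N A B a (1 / real (Suc l)) w'"
    proof -
      have c: "(\<Sum>i=1..N. w' i) = (\<Sum>i=1..N. w i)"
        "(\<Sum>i=1..N. w' i * A i) = (\<Sum>i=1..N. w i * A i)"
        "(\<Sum>i=1..N. w' i * B i) = (\<Sum>i=1..N. w i * B i)"
        "(\<Prod>i=1..N. real N * w' i) = (\<Prod>i=1..N. real N * w i)"
        by (auto simp: w'_def intro!: sum.cong prod.cong)
      show ?thesis using w unfolding el_near_def c by (auto simp: w'_def)
    qed
    have "1 / real (Suc l) \<le> 1" by simp
    have "w' i \<in> {-1..2}" if i: "i \<in> {1..N}" for i
    proof -
      have "- (1 / real (Suc l)) \<le> w' i" "w' i \<le> 1 + 1 / real (Suc l)"
        using w' i unfolding el_near_def by blast+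
      then show ?thesis using \<open>1 / real (Suc l) \<le> 1\<close> unfolding atLeastAtMost_iff by linarith
    qed
    moreover have "\<And>i. i \<notin> {1..N} \<Longrightarrow> w' i = 0" by (auto simp: w'_def)
    ultimately have "w' \<in> K" by (auto simp: K_def)
    moreover have "w' \<in> C k" if "k \<in> I'" for k
      using mono[OF w'] l that by (auto simp: C_def)
    ultimately show ?thesis by blast
  qed
  have "K \<inter> (\<Inter>k\<in>UNIV. C k) \<noteq> {}"
    by (rule compact_imp_fip_image[OF cK cC fip])
  then obtain w where w: "\<And>k. el_near N A B a (1 / real (Suc k)) w" by (auto simp: C_def)
  have le: "s \<le> t" if "\<And>k. s \<le> t + 1 / real (Suc k)" for s t :: real
  proof (rule field_le_epsilon)
    fix e :: real assume "0 < e"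
    then obtain k where "inverse (real (Suc k)) < e" using reals_Archimedean by blast
    then show "s \<le> t + e" using that[of k] by (simp add: inverse_eq_divide)
  qed
  have "\<bar>(\<Sum>i=1..N. w i) - 1\<bar> \<le> 0" "\<bar>\<Sum>i=1..N. w i * A i\<bar> \<le> 0" "\<bar>\<Sum>i=1..N. w i * B i\<bar> \<le> 0"
    by (rule le, use w in \<open>simp add: el_near_def\<close>)+
  moreover have "a \<le> (\<Prod>i=1..N. real N * w i)"
    by (rule le) (use w in \<open>simp add: el_near_def diff_le_eq\<close>)
  moreover have "0 \<le> w i" if "i \<in> {1..N}" for i
  proof (rule le)
    fix k
    have "- (1 / real (Suc k)) \<le> w i" using w[of k] that unfolding el_near_def by blast
    then show "0 \<le> w i + 1 / real (Suc k)" by linarith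
  qed
  ultimately show ?thesis by (intro exI[of _ w]) auto
qed

text \<open>Positivity of \<open>a\<close> separates the default value 0 of the empty constraint set
  from a genuine supremum. In the converse direction the limiting weights are feasible with product
  at least \<open>a\<close>.\<close>

lemma el_ratio_ge_iff:
  assumes a: "0 < a"
  shows "a \<le> el_ratio N (\<lambda>i. (A i, B i)) \<longleftrightarrow>
    (\<forall>k. \<exists>q \<in> PiE {1..N} (\<lambda>_. \<rat>). el_near N A B a (1 / real (Suc k)) q)"
proof
  let ?V = "el_values N (\<lambda>i. (A i, B i))"
  assume L: "a \<le> el_ratio N (\<lambda>i. (A i, B i))"
  then have ne: "?V \<noteq> {}" using a by (auto simp: el_ratio_eq_Sup)
  show "\<forall>k. \<exists>q \<in> PiE {1..N} (\<lambda>_. \<rat>). el_near N A B a (1 / real (Suc k)) q"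
  proof
    fix k
    have "a - 1 / real (Suc k) < Sup ?V" using L ne by (simp add: el_ratio_eq_Sup less_le_trans[of _ a])
    then obtain z where z: "z \<in> ?V" "a - 1 / real (Suc k) < z" using ne less_cSupE by blast
    obtain w where w: "z = (\<Prod>i=1..N. real N * w i)" "(\<Sum>i=1..N. w i) = 1"
      "(\<Sum>i=1..N. w i * A i) = 0" "(\<Sum>i=1..N. w i * B i) = 0" "\<And>i. i \<in> {1..N} \<Longrightarrow> 0 \<le> w i"
      by (rule el_values_pairE[OF z(1)]) blast
    show "\<exists>q \<in> PiE {1..N} (\<lambda>_. \<rat>). el_near N A B a (1 / real (Suc k)) q"
      using w z(2) by (intro el_near_rational[of w]) auto
  qed
next
  let ?V = "el_values N (\<lambda>i. (A i, B i))"
  assume "\<forall>k. \<exists>q \<in> PiE {1..N} (\<lambda>_. \<rat>). el_near N A B a (1 / real (Suc k)) q"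
  then obtain w where w: "(\<Sum>i=1..N. w i) = 1" "(\<Sum>i=1..N. w i * A i) = 0" "(\<Sum>i=1..N. w i * B i) = 0"
     "\<forall>i\<in>{1..N}. 0 \<le> w i" "a \<le> (\<Prod>i=1..N. real N * w i)"
    using el_near_limit[of N A B a] by blast
  have m: "(\<Prod>i=1..N. real N * w i) \<in> ?V" using w by (intro el_values_pairI) auto
  have "bdd_above ?V" by (rule bdd_aboveI) (rule el_values_le_one)
  then have "(\<Prod>i=1..N. real N * w i) \<le> Sup ?V" by (rule cSup_upper[OF m])
  then show "a \<le> el_ratio N (\<lambda>i. (A i, B i))" using w(5) m by (auto simp: el_ratio_eq_Sup)
qed

lemma borel_measurable_el_ratio:
  assumes A: "\<And>i. i \<in> {1..N} \<Longrightarrow> A i \<in> borel_measurable M"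
    and B: "\<And>i. i \<in> {1..N} \<Longrightarrow> B i \<in> borel_measurable M"
  shows "(\<lambda>\<omega>. el_ratio N (\<lambda>i. (A i \<omega>, B i \<omega>))) \<in> borel_measurable M"
  unfolding borel_measurable_iff_ge
proof
  fix a :: real
  show "{\<omega> \<in> space M. a \<le> el_ratio N (\<lambda>i. (A i \<omega>, B i \<omega>))} \<in> sets M"
  proof (cases "0 < a")
    \<comment> \<open>For a nonpositive level the set is the whole space, because the ratio is
      nonnegative also in the empty case.\<close>
    case False
    then have "{\<omega> \<in> space M. a \<le> el_ratio N (\<lambda>i. (A i \<omega>, B i \<omega>))} = space M"
      using el_ratio_nonneg[of N] by (auto intro: order_trans[of _ 0])
    then show ?thesis by simp
  next
    case True
    have c: "countable (PiE {1..N} (\<lambda>_. \<rat> :: real set))"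
      by (intro countable_PiE) (auto simp: countable_rat)
    have [measurable]: "(\<lambda>\<omega>. \<Sum>i=1..N. q i * A i \<omega>) \<in> borel_measurable M"
      "(\<lambda>\<omega>. \<Sum>i=1..N. q i * B i \<omega>) \<in> borel_measurable M" for q :: "nat \<Rightarrow> real"
      using A B by (auto intro!: borel_measurable_sum borel_measurable_times)
    have "{\<omega> \<in> space M. a \<le> el_ratio N (\<lambda>i. (A i \<omega>, B i \<omega>))} =
       {\<omega> \<in> space M. \<forall>k. \<exists>q \<in> PiE {1..N} (\<lambda>_. \<rat>). el_near N (\<lambda>i. A i \<omega>) (\<lambda>i. B i \<omega>) a (1 / real (Suc k)) q}"
      using el_ratio_ge_iff[OF True] by auto
    also have "\<dots> \<in> sets M"
      unfolding el_near_def
      by (intro sets.sets_Collect_countable_All sets.sets_Collect_countable_Ex' c sets.sets_Collect_conj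
          sets.sets_Collect_const; measurable)
    finally show ?thesis .
  qed
qed

lemma borel_measurable_neg2_log [measurable]: "neg2_log \<in> borel_measurable borel"
  unfolding neg2_log_def by measurable

text \<open>On a regular sample the squared norm is at most 2K^2, so the multiplicative errors of
  the sandwich become additive once both factors are within \<epsilon>/(2K^2) of 1. They are
  continuous in \<eta> with value 1 at 0.\<close>

lemma el_ratio_expansion:
  fixes \<epsilon> K :: real
  assumes e: "0 < \<epsilon>" and K: "0 < K"
  shows "\<exists>\<eta>>0. \<forall>N A B. el_regular K \<eta> N A B \<longrightarrow>
    (\<exists>r. neg2_log (el_ratio N (\<lambda>i. (A i, B i))) = ereal r \<and> \<bar>r - norm_sq N A B\<bar> \<le> \<epsilon>)"
proof -
  let ?l = "\<lambda>\<eta>::real. 2 - (1 + 4 * K * \<eta>) * (1 + 2 * \<eta>)"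
  let ?u = "\<lambda>\<eta>::real. (1 + 16 * K * \<eta>) * ((1 + 4 * \<eta>) / (1 - 4 * \<eta>))"
  define \<gamma> where "\<gamma> = \<epsilon> / (2 * K\<^sup>2)"
  have \<gamma>: "0 < \<gamma>" using e K by (simp add: \<gamma>_def)
  have "(?l \<longlongrightarrow> 2 - (1 + 4 * K * 0) * (1 + 2 * 0)) (at_right 0)" by (intro tendsto_intros)
  then have 1: "eventually (\<lambda>\<eta>. 1 - \<gamma> < ?l \<eta>) (at_right 0)"
    using \<gamma> by (intro order_tendstoD(1)) auto
  have "(?u \<longlongrightarrow> (1 + 16 * K * 0) * ((1 + 4 * 0) / (1 - 4 * 0))) (at_right 0)"
    by (intro tendsto_intros) auto
  then have 2: "eventually (\<lambda>\<eta>. ?u \<eta> < 1 + \<gamma>) (at_right 0)"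
    using \<gamma> by (intro order_tendstoD(2)) auto
  have "((\<lambda>\<eta>::real. 8 * K * \<eta>) \<longlongrightarrow> 8 * K * 0) (at_right 0)" by (intro tendsto_intros)
  then have 3: "eventually (\<lambda>\<eta>. 8 * K * \<eta> < 1/2) (at_right 0)" by (intro order_tendstoD(2)) auto
  have 4: "eventually (\<lambda>\<eta>. \<eta> < 1/16) (at_right (0::real))"
    by (intro order_tendstoD(2)) (auto intro: tendsto_ident_at)
  have 5: "eventually (\<lambda>\<eta>. 0 < \<eta>) (at_right (0::real))" by (simp add: eventually_at_right_less)
  have "\<forall>\<^sub>F \<eta> in at_right 0. 1 - \<gamma> < ?l \<eta> \<and> ?u \<eta> < 1 + \<gamma> \<and> 8 * K * \<eta> < 1/2 \<and> \<eta> < 1/16 \<and> 0 < \<eta>"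
    using 1 2 3 4 5 by eventually_elim blast
  from eventually_happens'[OF trivial_limit_at_right_real this]
  obtain \<eta> where h: "1 - \<gamma> < ?l \<eta>" "?u \<eta> < 1 + \<gamma>" "8 * K * \<eta> < 1/2" "\<eta> < 1/16" "0 < \<eta>"
    by blast
  show ?thesis
  proof (rule exI[of _ \<eta>], intro conjI allI impI)
    fix N :: nat and A B :: "nat \<Rightarrow> real"
    define L q where "L = el_ratio N (\<lambda>i. (A i, B i))" and "q = norm_sq N A B"
    assume reg: "el_regular K \<eta> N A B"
    note s = el_ratio_sandwich[OF h(5) less_imp_le[OF h(4)] less_imp_le[OF h(3)] K reg, folded L_def q_def]
    have "((\<Sum>i=1..N. A i) / sqrt N)\<^sup>2 \<le> K\<^sup>2" "((\<Sum>i=1..N. B i) / sqrt N)\<^sup>2 \<le> K\<^sup>2"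
      using reg K unfolding el_regular_def by (simp_all add: abs_le_square_iff[symmetric])
    then have q: "0 \<le> q" "q \<le> 2 * K\<^sup>2" unfolding q_def norm_sq_def by simp_all
    then have "\<gamma> * q \<le> \<gamma> * (2 * K\<^sup>2)" using \<gamma> by (intro mult_left_mono) auto
    also have "\<dots> = \<epsilon>" using K by (simp add: \<gamma>_def)
    finally have g: "\<gamma> * q \<le> \<epsilon>" .
    have "q * (1 - \<gamma>) \<le> q * ?l \<eta>" using h q by (intro mult_left_mono) auto
    also have "\<dots> \<le> - 2 * ln L" by (rule s(2))
    finally have lo: "q - \<epsilon> \<le> - 2 * ln L" using g by (simp add: algebra_simps)
    have "- 2 * ln L \<le> ?u \<eta> * q" by (rule s(3))
    also have "\<dots> \<le> (1 + \<gamma>) * q" using h q by (intro mult_right_mono) auto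
    finally have up: "- 2 * ln L \<le> q + \<epsilon>" using g by (simp add: algebra_simps)
    show "\<exists>r. neg2_log (el_ratio N (\<lambda>i. (A i, B i))) = ereal r \<and> \<bar>r - norm_sq N A B\<bar> \<le> \<epsilon>"
      using s(1) lo up unfolding L_def[symmetric] q_def[symmetric] by (intro exI[of _ "- 2 * ln L"]) auto
  qed (use h in simp)
qed

section \<open>Bounds for one row of an i.i.d. array\<close>

lemma (in prob_space) indep_vars_pair:
  assumes "indep_vars M' X I" "i \<in> I" "j \<in> I" "i \<noteq> j"
  shows "indep_var (M' i) (X i) (M' j) (X j)"
proof -
  have 1: "indep_var (PiM {i} M') (\<lambda>w. restrict (\<lambda>k. X k w) {i}) (PiM {j} M') (\<lambda>w. restrict (\<lambda>k. X k w) {j})"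
    using assms by (intro indep_var_restrict[OF assms(1)]) auto
  have "indep_var (M' i) ((\<lambda>f. f i) \<circ> (\<lambda>w. restrict (\<lambda>k. X k w) {i}))
      (M' j) ((\<lambda>f. f j) \<circ> (\<lambda>w. restrict (\<lambda>k. X k w) {j}))"
    by (rule indep_var_compose[OF 1]) measurable
  then show ?thesis by (simp add: comp_def)
qed

text \<open>Nonnegativity of the variance of |Y|.\<close>

lemma (in prob_space) expectation_abs_le_sqrt:
  fixes Y :: "'a \<Rightarrow> real"
  assumes [measurable]: "random_variable borel Y" and int: "integrable M (\<lambda>w. (Y w)\<^sup>2)"
  shows "expectation (\<lambda>w. \<bar>Y w\<bar>) \<le> sqrt (expectation (\<lambda>w. (Y w)\<^sup>2))"
proof -
  have i: "integrable M Y" by (rule square_integrable_imp_integrable[OF _ int]) simp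
  have "0 \<le> variance (\<lambda>w. \<bar>Y w\<bar>)" by (rule variance_positive)
  also have "\<dots> = expectation (\<lambda>w. (Y w)\<^sup>2) - (expectation (\<lambda>w. \<bar>Y w\<bar>))\<^sup>2"
    using i int by (subst variance_eq) auto
  finally show ?thesis by (intro real_le_rsqrt) simp
qed

locale iid_row = prob_space M for M :: "'a measure" +
  fixes N :: nat and Z :: "nat \<Rightarrow> 'a \<Rightarrow> real"
  assumes N: "0 < N"
    and indep: "indep_vars (\<lambda>_. borel) Z {1..N}"
    and ident: "i \<in> {1..N} \<Longrightarrow> distr M borel (Z i) = distr M borel (Z 1)"
begin

lemma Z_measurable: "i \<in> {1..N} \<Longrightarrow> Z i \<in> borel_measurable M"
  using indep by (simp add: indep_vars_def)

lemma Z1_measurable [measurable]: "Z 1 \<in> borel_measurable M"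
  using Z_measurable[of 1] N by simp

lemma Z1_measurable' [measurable]: "Z (Suc 0) \<in> borel_measurable M"
  using Z1_measurable by simp

lemma integrable_ident:
  fixes g :: "real \<Rightarrow> real"
  assumes g: "g \<in> borel_measurable borel" and i: "i \<in> {1..N}"
  shows "integrable M (\<lambda>w. g (Z i w)) \<longleftrightarrow> integrable M (\<lambda>w. g (Z 1 w))"
  using integrable_distr_eq[OF Z_measurable[OF i] g] integrable_distr_eq[OF Z1_measurable g] ident[OF i]
  by simp

lemma expectation_ident:
  fixes g :: "real \<Rightarrow> real"
  assumes g: "g \<in> borel_measurable borel" and i: "i \<in> {1..N}"
  shows "expectation (\<lambda>w. g (Z i w)) = expectation (\<lambda>w. g (Z 1 w))"
  using integral_distr[OF Z_measurable[OF i] g] integral_distr[OF Z1_measurable g] ident[OF i]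
  by simp

lemma iid_row_compose:
  assumes [measurable]: "g \<in> borel_measurable borel"
  shows "iid_row M N (\<lambda>i w. g (Z i w))"
proof
  show "0 < N" by (rule N)
  show "indep_vars (\<lambda>_. borel) (\<lambda>i w. g (Z i w)) {1..N}"
    using indep by (rule indep_vars_compose2) simp
  fix i assume i: "i \<in> {1..N}"
  have "distr M borel (\<lambda>w. g (Z i w)) = distr (distr M borel (Z i)) borel g"
    using Z_measurable[OF i] by (simp add: distr_distr comp_def)
  also have "\<dots> = distr M borel (\<lambda>w. g (Z 1 w))"
    unfolding ident[OF i] using Z1_measurable by (simp add: distr_distr comp_def)
  finally show "distr M borel (\<lambda>w. g (Z i w)) = distr M borel (\<lambda>w. g (Z 1 w))" .
qed

text \<open>Expanding the square, independence and centering remove every off-diagonal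
  product.\<close>

lemma expectation_sum_square:
  assumes int: "integrable M (\<lambda>w. (Z 1 w)\<^sup>2)" and mean: "expectation (Z 1) = 0"
  shows "integrable M (\<lambda>w. (\<Sum>i=1..N. Z i w)\<^sup>2)"
    and "expectation (\<lambda>w. (\<Sum>i=1..N. Z i w)\<^sup>2) = N * expectation (\<lambda>w. (Z 1 w)\<^sup>2)"
proof -
  have i2: "integrable M (\<lambda>w. (Z i w)\<^sup>2)" "expectation (\<lambda>w. (Z i w)\<^sup>2) = expectation (\<lambda>w. (Z 1 w)\<^sup>2)"
    if "i \<in> {1..N}" for i
    using integrable_ident[of "\<lambda>x. x\<^sup>2", OF _ that] expectation_ident[of "\<lambda>x. x\<^sup>2", OF _ that] int by auto
  have i1: "integrable M (Z i)" if "i \<in> {1..N}" for i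
    by (rule square_integrable_imp_integrable[OF Z_measurable[OF that] i2(1)[OF that]])
  have m0: "expectation (Z i) = 0" if "i \<in> {1..N}" for i
    using expectation_ident[of "\<lambda>x. x", OF _ that] mean by simp
  have prod: "integrable M (\<lambda>w. Z i w * Z j w) \<and>
      expectation (\<lambda>w. Z i w * Z j w) = (if i = j then expectation (\<lambda>w. (Z 1 w)\<^sup>2) else 0)"
    if i: "i \<in> {1..N}" and j: "j \<in> {1..N}" for i j
  proof (cases "i = j")
    case True
    then show ?thesis using i2[OF i] by (simp add: power2_eq_square)
  next
    case False
    then have "indep_var borel (Z i) borel (Z j)"
      using indep_vars_pair[OF indep i j] by simp
    from indep_var_integrable[OF this i1[OF i] i1[OF j]] indep_var_lebesgue_integral[OF this i1[OF i] i1[OF j]]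
    show ?thesis using False m0[OF i] by simp
  qed
  have eq: "(\<Sum>i=1..N. Z i w)\<^sup>2 = (\<Sum>i=1..N. \<Sum>j=1..N. Z i w * Z j w)" for w
    by (simp add: power2_eq_square sum_product)
  show "integrable M (\<lambda>w. (\<Sum>i=1..N. Z i w)\<^sup>2)"
    unfolding eq by (intro Bochner_Integration.integrable_sum prod[THEN conjunct1])
  have "expectation (\<lambda>w. (\<Sum>i=1..N. Z i w)\<^sup>2) = (\<Sum>i=1..N. \<Sum>j=1..N. expectation (\<lambda>w. Z i w * Z j w))"
    unfolding eq
    by (subst Bochner_Integration.integral_sum, intro Bochner_Integration.integrable_sum prod[THEN conjunct1], assumption+,
        intro sum.cong refl Bochner_Integration.integral_sum prod[THEN conjunct1])
  also have "\<dots> = (\<Sum>i=1..N. \<Sum>j=1..N. if i = j then expectation (\<lambda>w. (Z 1 w)\<^sup>2) else 0)"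
    by (intro sum.cong refl prod[THEN conjunct2])
  also have "\<dots> = N * expectation (\<lambda>w. (Z 1 w)\<^sup>2)"
    by simp
  finally show "expectation (\<lambda>w. (\<Sum>i=1..N. Z i w)\<^sup>2) = N * expectation (\<lambda>w. (Z 1 w)\<^sup>2)" .
qed

text \<open>Union bound with Markov's inequality for the power 2 + \<delta>. Since (sqrt
  N)^(2+\<delta>) = N N^(\<delta>/2), the N summands use up one factor N and leave the Lyapunov
  ratio.\<close>

lemma prob_max_le:
  assumes d: "0 < \<delta>" and int: "integrable M (\<lambda>w. \<bar>Z 1 w\<bar> powr (2 + \<delta>))" and e: "0 < \<eta>"
  shows "prob {w \<in> space M. \<exists>i\<in>{1..N}. \<eta> * sqrt N < \<bar>Z i w\<bar>}
    \<le> expectation (\<lambda>w. \<bar>Z 1 w\<bar> powr (2 + \<delta>)) / N powr (\<delta> / 2) / \<eta> powr (2 + \<delta>)"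
proof -
  let ?m = "expectation (\<lambda>w. \<bar>Z 1 w\<bar> powr (2 + \<delta>))"
  have c: "(\<eta> * sqrt N) powr (2 + \<delta>) = N * (N powr (\<delta> / 2) * \<eta> powr (2 + \<delta>))"
  proof -
    have "sqrt N powr (2 + \<delta>) = N powr (1 + \<delta> / 2)"
      by (simp add: powr_half_sqrt[symmetric] powr_powr add_divide_distrib)
    also have "\<dots> = N * N powr (\<delta> / 2)" using N by (simp add: powr_add)
    finally show ?thesis using e by (simp add: powr_mult mult_ac)
  qed
  have cp: "0 < (\<eta> * sqrt N) powr (2 + \<delta>)" using e N by simp
  have "prob {w \<in> space M. \<exists>i\<in>{1..N}. \<eta> * sqrt N < \<bar>Z i w\<bar>}
      = prob (\<Union>i\<in>{1..N}. {w \<in> space M. \<eta> * sqrt N < \<bar>Z i w\<bar>})"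
    by (intro arg_cong[where f=prob]) auto
  also have "\<dots> \<le> (\<Sum>i=1..N. prob {w \<in> space M. \<eta> * sqrt N < \<bar>Z i w\<bar>})"
  proof (rule finite_measure_subadditive_finite)
    show "(\<lambda>i. {w \<in> space M. \<eta> * sqrt N < \<bar>Z i w\<bar>}) ` {1..N} \<subseteq> events"
    proof safe
      fix i assume "i \<in> {1..N}"
      note Z_measurable[OF this, measurable]
      show "{w \<in> space M. \<eta> * sqrt N < \<bar>Z i w\<bar>} \<in> events" by measurable
    qed
  qed simp
  also have "\<dots> \<le> (\<Sum>i=1..N. ?m / (\<eta> * sqrt N) powr (2 + \<delta>))"
  proof (rule sum_mono)
    fix i assume i: "i \<in> {1..N}"
    note Z_measurable[OF i, measurable]
    have g: "(\<lambda>x::real. \<bar>x\<bar> powr (2 + \<delta>)) \<in> borel_measurable borel" by measurable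
    have "prob {w \<in> space M. \<eta> * sqrt N < \<bar>Z i w\<bar>}
        \<le> prob {w \<in> space M. (\<eta> * sqrt N) powr (2 + \<delta>) \<le> \<bar>Z i w\<bar> powr (2 + \<delta>)}"
      using e d by (intro finite_measure_mono) (auto intro!: powr_mono2)
    also have "\<dots> \<le> expectation (\<lambda>w. \<bar>Z i w\<bar> powr (2 + \<delta>)) / (\<eta> * sqrt N) powr (2 + \<delta>)"
      using integrable_ident[OF g i] int cp by (intro integral_Markov_inequality_measure[where A="{}"]) auto
    also have "\<dots> = ?m / (\<eta> * sqrt N) powr (2 + \<delta>)"
      using expectation_ident[OF g i] by simp
    finally show "prob {w \<in> space M. \<eta> * sqrt N < \<bar>Z i w\<bar>} \<le> ?m / (\<eta> * sqrt N) powr (2 + \<delta>)" .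
  qed
  also have "\<dots> = ?m / N powr (\<delta> / 2) / \<eta> powr (2 + \<delta>)"
    unfolding c using N by simp
  finally show ?thesis .
qed

text \<open>Truncation at level \<open>\<epsilon> N\<close>.\<close>

lemma weak_law_bound:
  assumes r: "0 < r" and e: "0 < \<epsilon>" and int1: "integrable M (Z 1)"
    and int: "integrable M (\<lambda>w. \<bar>Z 1 w\<bar> powr (1 + r))"
  shows "integrable M (\<lambda>w. \<bar>(\<Sum>i=1..N. Z i w) / N - expectation (Z 1)\<bar>)"
   and "expectation (\<lambda>w. \<bar>(\<Sum>i=1..N. Z i w) / N - expectation (Z 1)\<bar>)
    \<le> 2 * (expectation (\<lambda>w. \<bar>Z 1 w\<bar> powr (1 + r)) / N powr r / \<epsilon> powr r) + sqrt (\<epsilon> * expectation (\<lambda>w. \<bar>Z 1 w\<bar>))"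
proof -
  define T where "T x = (if \<bar>x\<bar> \<le> \<epsilon> * N then x else 0)" for x :: real
  have T[measurable]: "T \<in> borel_measurable borel" unfolding T_def by measurable
  have Tb: "\<bar>T x\<bar> \<le> \<epsilon> * N" "\<bar>T x\<bar> \<le> \<bar>x\<bar>" for x using e by (auto simp: T_def)
  define m where "m = expectation (\<lambda>w. \<bar>Z 1 w\<bar> powr (1 + r)) / N powr r / \<epsilon> powr r"
  \<comment> \<open>Nonzero only for |x| > \<epsilon>N, where the factor (|x|/(\<epsilon>N))^r is at
    least 1.\<close>
  have Te: "\<bar>x - T x\<bar> \<le> \<bar>x\<bar> powr (1 + r) / N powr r / \<epsilon> powr r" for x
  proof (cases "\<bar>x\<bar> \<le> \<epsilon> * N")
    case False
    then have x: "\<epsilon> * N < \<bar>x\<bar>" by simp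
    have eN: "0 < \<epsilon> * N" using e N by simp
    have "\<bar>x\<bar> * (\<epsilon> * N) powr r \<le> \<bar>x\<bar> * \<bar>x\<bar> powr r"
      using x eN r by (intro mult_left_mono powr_mono2) auto
    also have "\<dots> = \<bar>x\<bar> powr (1 + r)" using x eN by (simp add: powr_add)
    finally have "\<bar>x\<bar> \<le> \<bar>x\<bar> powr (1 + r) / (\<epsilon> * N) powr r" by (subst pos_le_divide_eq) (use e N in auto)
    then show ?thesis using False e by (simp add: T_def powr_mult mult.commute)
  qed (simp add: T_def)
  define W where "W i w = T (Z i w) - expectation (\<lambda>w. T (Z 1 w))" for i w
  interpret W: iid_row M N W
    unfolding W_def by (rule iid_row_compose[of "\<lambda>x. T x - expectation (\<lambda>w. T (Z 1 w))"]) measurable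
  have intTb: "integrable M (\<lambda>w. T (Z 1 w))"
    by (rule integrable_const_bound[of _ "\<epsilon> * N"]) (auto intro: Tb)
  have intT2: "integrable M (\<lambda>w. (T (Z 1 w))\<^sup>2)"
  proof (rule integrable_const_bound[of _ "(\<epsilon> * N)\<^sup>2"])
    have "norm ((T x)\<^sup>2) \<le> (\<epsilon> * N)\<^sup>2" for x
      using power_mono[OF Tb(1)[of x] abs_ge_zero, of 2] by simp
    then show "AE w in M. norm ((T (Z 1 w))\<^sup>2) \<le> (\<epsilon> * N)\<^sup>2" by blast
  qed simp
  have W1: "expectation (W 1) = 0"
    unfolding W_def using intTb by (simp add: prob_space)
  have intW: "integrable M (\<lambda>w. (W 1 w)\<^sup>2)"
    unfolding W_def power2_diff using intTb intT2 by simp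
  \<comment> \<open>One factor of the truncated square is bounded by \<epsilon>N and the other by
    |Z|, so only a first moment is spent. After averaging N centered copies the variance is at most
    \<epsilon> E|Z|.\<close>
  have W2: "expectation (\<lambda>w. (W 1 w)\<^sup>2) \<le> \<epsilon> * N * expectation (\<lambda>w. \<bar>Z 1 w\<bar>)"
  proof -
    have "expectation (\<lambda>w. (W 1 w)\<^sup>2) = expectation (\<lambda>w. (T (Z 1 w))\<^sup>2) - (expectation (\<lambda>w. T (Z 1 w)))\<^sup>2"
      unfolding W_def using intTb intT2 by (intro variance_eq) auto
    also have "\<dots> \<le> expectation (\<lambda>w. (T (Z 1 w))\<^sup>2)" by simp
    also have "\<dots> \<le> expectation (\<lambda>w. \<epsilon> * N * \<bar>Z 1 w\<bar>)"
    proof (rule integral_mono[OF intT2])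
      show "integrable M (\<lambda>w. \<epsilon> * N * \<bar>Z 1 w\<bar>)" using int1 by simp
      show "(T (Z 1 w))\<^sup>2 \<le> \<epsilon> * N * \<bar>Z 1 w\<bar>" for w
        using mult_mono[OF Tb, of "Z 1 w" "Z 1 w"] e by (simp add: power2_eq_square abs_mult_self_eq)
    qed
    also have "\<dots> = \<epsilon> * N * expectation (\<lambda>w. \<bar>Z 1 w\<bar>)" by simp
    finally show ?thesis .
  qed
  have mW: "(\<lambda>w. \<Sum>i=1..N. W i w) \<in> borel_measurable M"
    by (rule borel_measurable_sum) (rule W.Z_measurable)
  have S: "expectation (\<lambda>w. \<bar>\<Sum>i=1..N. W i w\<bar>) / N \<le> sqrt (\<epsilon> * expectation (\<lambda>w. \<bar>Z 1 w\<bar>))"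
  proof -
    have "expectation (\<lambda>w. \<bar>\<Sum>i=1..N. W i w\<bar>) \<le> sqrt (expectation (\<lambda>w. (\<Sum>i=1..N. W i w)\<^sup>2))"
      by (rule expectation_abs_le_sqrt[OF mW W.expectation_sum_square(1)[OF intW W1]])
    also have "\<dots> = sqrt (N * expectation (\<lambda>w. (W 1 w)\<^sup>2))"
      by (simp only: W.expectation_sum_square(2)[OF intW W1])
    also have "\<dots> \<le> sqrt (N * (\<epsilon> * N * expectation (\<lambda>w. \<bar>Z 1 w\<bar>)))"
      using W2 by (intro real_sqrt_le_mono mult_left_mono) auto
    also have "\<dots> = sqrt ((real N)\<^sup>2 * (\<epsilon> * expectation (\<lambda>w. \<bar>Z 1 w\<bar>)))"
      by (simp add: power2_eq_square mult_ac)
    also have "\<dots> = N * sqrt (\<epsilon> * expectation (\<lambda>w. \<bar>Z 1 w\<bar>))"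
      by (simp add: real_sqrt_mult)
    finally show ?thesis using N by (simp add: divide_le_eq mult.commute)
  qed
  define V where "V i w = \<bar>Z i w - T (Z i w)\<bar>" for i w
  have intV1: "integrable M (V 1)" unfolding V_def using int1 intTb by simp
  have mV: "(\<lambda>x. \<bar>x - T x\<bar>) \<in> borel_measurable borel" by measurable
  have intV: "integrable M (V i)" and EV: "expectation (V i) = expectation (V 1)" if "i \<in> {1..N}" for i
    using integrable_ident[OF mV that] expectation_ident[OF mV that] intV1 by (simp_all add: V_def[abs_def])
  have V1: "expectation (V 1) \<le> m"
  proof -
    have "expectation (V 1) \<le> expectation (\<lambda>w. \<bar>Z 1 w\<bar> powr (1 + r) / N powr r / \<epsilon> powr r)"
    proof (rule integral_mono[OF intV1])
      show "integrable M (\<lambda>w. \<bar>Z 1 w\<bar> powr (1 + r) / N powr r / \<epsilon> powr r)" using int by simp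
    qed (simp only: V_def Te)
    then show ?thesis by (simp add: m_def)
  qed
  have "integrable M (Z i)" if "i \<in> {1..N}" for i
    using integrable_ident[of "\<lambda>x. x", OF _ that] int1 by simp
  then show I: "integrable M (\<lambda>w. \<bar>(\<Sum>i=1..N. Z i w) / N - expectation (Z 1)\<bar>)"
    by (intro integrable_abs Bochner_Integration.integrable_diff integrable_divide Bochner_Integration.integrable_sum) auto
  have IW: "integrable M (\<lambda>w. \<bar>\<Sum>i=1..N. W i w\<bar>)"
    by (intro integrable_abs square_integrable_imp_integrable[OF mW W.expectation_sum_square(1)[OF intW W1]])
  have IV: "integrable M (\<lambda>w. \<Sum>i=1..N. V i w)" by (intro Bochner_Integration.integrable_sum intV)
  have b: "\<bar>expectation (\<lambda>w. T (Z 1 w)) - expectation (Z 1)\<bar> \<le> expectation (V 1)"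
  proof -
    have "expectation (\<lambda>w. T (Z 1 w)) - expectation (Z 1) = expectation (\<lambda>w. T (Z 1 w) - Z 1 w)"
      using intTb int1 by simp
    also have "\<bar>\<dots>\<bar> \<le> expectation (\<lambda>w. \<bar>T (Z 1 w) - Z 1 w\<bar>)" by (rule integral_abs_bound)
    finally show ?thesis by (simp add: V_def[abs_def] abs_minus_commute)
  qed
  \<comment> \<open>The tail enters twice, in the truncated sum and in the shift of its mean; hence
    the factor 2 in the final bound.\<close>
  have pw: "\<bar>(\<Sum>i=1..N. Z i w) / N - expectation (Z 1)\<bar>
    \<le> (\<Sum>i=1..N. V i w) / N + \<bar>\<Sum>i=1..N. W i w\<bar> / N + expectation (V 1)" for w
  proof -
    let ?t = "expectation (\<lambda>w. T (Z 1 w))"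
    have "(\<Sum>i=1..N. Z i w) = (\<Sum>i=1..N. Z i w - T (Z i w)) + (\<Sum>i=1..N. W i w) + N * ?t"
      by (simp add: W_def sum_subtractf)
    then have "(\<Sum>i=1..N. Z i w) / N = (\<Sum>i=1..N. Z i w - T (Z i w)) / N + (\<Sum>i=1..N. W i w) / N + ?t"
      using N by (simp add: add_divide_distrib)
    moreover have "\<bar>(\<Sum>i=1..N. Z i w - T (Z i w)) / N\<bar> \<le> (\<Sum>i=1..N. V i w) / N"
      unfolding V_def by (simp add: abs_divide divide_right_mono)
    moreover have "\<bar>(\<Sum>i=1..N. W i w) / N\<bar> = \<bar>\<Sum>i=1..N. W i w\<bar> / N" by (simp add: abs_divide)
    ultimately show ?thesis using b by linarith
  qed
  have "expectation (\<lambda>w. \<bar>(\<Sum>i=1..N. Z i w) / N - expectation (Z 1)\<bar>)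
    \<le> expectation (\<lambda>w. (\<Sum>i=1..N. V i w) / N + \<bar>\<Sum>i=1..N. W i w\<bar> / N + expectation (V 1))"
    using IV IW by (intro integral_mono I pw) auto
  also have "\<dots> = expectation (\<lambda>w. \<Sum>i=1..N. V i w) / N + expectation (\<lambda>w. \<bar>\<Sum>i=1..N. W i w\<bar>) / N + expectation (V 1)"
    using IV IW by (simp add: prob_space)
  also have "expectation (\<lambda>w. \<Sum>i=1..N. V i w) = N * expectation (V 1)"
  proof -
    have "expectation (\<lambda>w. \<Sum>i=1..N. V i w) = (\<Sum>i=1..N. expectation (V i))"
      by (rule Bochner_Integration.integral_sum) (rule intV)
    also have "\<dots> = (\<Sum>i=1..N. expectation (V 1))" by (rule sum.cong[OF refl]) (rule EV)
    finally show ?thesis by simp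
  qed
  also have "N * expectation (V 1) / N = expectation (V 1)" using N by simp
  finally show "expectation (\<lambda>w. \<bar>(\<Sum>i=1..N. Z i w) / N - expectation (Z 1)\<bar>)
    \<le> 2 * (expectation (\<lambda>w. \<bar>Z 1 w\<bar> powr (1 + r)) / N powr r / \<epsilon> powr r) + sqrt (\<epsilon> * expectation (\<lambda>w. \<bar>Z 1 w\<bar>))"
    using V1 S unfolding m_def by linarith
qed

text \<open>Both N-th powers have bases in the closed unit disc, so they differ by at most N times
  the difference of the bases, and the Taylor remainder of the characteristic function at 1/sqrt N
  is of order 1/N. The condition s/4 \<le> N says that 1 - s/(2N) is at least -1.\<close>

lemma char_sum_approx:
  assumes d: "0 < \<delta>" and e: "0 < \<epsilon>"
    and int: "integrable M (\<lambda>w. (Z 1 w)\<^sup>2)" and mean: "expectation (Z 1) = 0"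
    and int2: "integrable M (\<lambda>w. \<bar>Z 1 w\<bar> powr (2 + \<delta>))"
    and s: "expectation (\<lambda>w. (Z 1 w)\<^sup>2) = s" and Ns: "s / 4 \<le> N"
  shows "cmod (char (distr M borel (\<lambda>w. (\<Sum>i=1..N. Z i w) / sqrt N)) 1 - complex_of_real ((1 + (- s / 2) / N) ^ N))
    \<le> \<epsilon> * s / 6 + expectation (\<lambda>w. \<bar>Z 1 w\<bar> powr (2 + \<delta>)) / N powr (\<delta> / 2) / \<epsilon> powr \<delta>"
proof -
  let ?m = "expectation (\<lambda>w. \<bar>Z 1 w\<bar> powr (2 + \<delta>))"
  let ?t = "1 / sqrt N"
  define \<mu> where "\<mu> = distr M borel (Z 1)"
  interpret \<mu>: real_distribution \<mu> unfolding \<mu>_def by (rule real_distribution_distr) simp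
  have s0: "0 \<le> s" unfolding s[symmetric] by simp
  have "char (distr M borel (\<lambda>w. (\<Sum>i=1..N. Z i w) / sqrt N)) 1 = char (distr M borel (\<lambda>w. \<Sum>i=1..N. Z i w)) ?t"
    using Z_measurable by (simp add: char_def integral_distr borel_measurable_sum)
  also have "\<dots> = (\<Prod>i=1..N. char (distr M borel (Z i)) ?t)" by (rule char_distr_sum[OF indep])
  also have "\<dots> = (\<Prod>i=1..N. char \<mu> ?t)" by (intro prod.cong refl) (simp only: ident \<mu>_def)
  also have "\<dots> = char \<mu> ?t ^ N" by simp
  finally have c: "char (distr M borel (\<lambda>w. (\<Sum>i=1..N. Z i w) / sqrt N)) 1 = char \<mu> ?t ^ N" .
  have intZ: "integrable M (Z 1)" by (rule square_integrable_imp_integrable[OF Z1_measurable int])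
  have "cmod (char \<mu> ?t - (1 - ?t\<^sup>2 * s / 2)) \<le>
    (?t\<^sup>2 / 6) * expectation (\<lambda>x. min (6 * (Z 1 x)\<^sup>2) (\<bar>?t\<bar> * \<bar>Z 1 x\<bar>^3))"
    using int mean intZ s by (intro char_approx3') (auto simp: \<mu>_def)
  also have "\<dots> \<le> (?t\<^sup>2 / 6) * expectation (\<lambda>x. \<epsilon> * (Z 1 x)\<^sup>2 + 6 * (\<bar>Z 1 x\<bar> powr (2 + \<delta>) / N powr (\<delta> / 2) / \<epsilon> powr \<delta>))"
  proof (intro mult_left_mono integral_mono)
    show "integrable M (\<lambda>x. min (6 * (Z 1 x)\<^sup>2) (\<bar>?t\<bar> * \<bar>Z 1 x\<bar>^3))"
      by (rule Bochner_Integration.integrable_bound[of _ "\<lambda>x. 6 * (Z 1 x)\<^sup>2"]) (use int in auto)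
    show "integrable M (\<lambda>x. \<epsilon> * (Z 1 x)\<^sup>2 + 6 * (\<bar>Z 1 x\<bar> powr (2 + \<delta>) / N powr (\<delta> / 2) / \<epsilon> powr \<delta>))"
      using int int2 by simp
    fix x
    define z where "z = \<bar>Z 1 x\<bar>"
    \<comment> \<open>Split at \<epsilon> sqrt N: below it the cubic term is at most \<epsilon>z^2,
      above it z^2 is dominated by the power 2 + \<delta>.\<close>
    have "min (6 * z\<^sup>2) (?t * z^3) \<le> \<epsilon> * z\<^sup>2 + 6 * (z powr (2 + \<delta>) / N powr (\<delta> / 2) / \<epsilon> powr \<delta>)"
    proof (cases "z \<le> \<epsilon> * sqrt N")
      case True
      have "?t * z ^ 3 = (z / sqrt N) * z\<^sup>2" by (simp add: power3_eq_cube power2_eq_square)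
      also have "\<dots> \<le> \<epsilon> * z\<^sup>2"
        using True N by (intro mult_right_mono) (auto simp: divide_le_eq)
      finally show ?thesis by (smt (verit) divide_nonneg_nonneg min.cobounded2 powr_ge_zero)
    next
      case False
      then have z: "0 < \<epsilon> * sqrt N" "\<epsilon> * sqrt N < z" using e N by auto
      have "sqrt N powr \<delta> = N powr (\<delta> / 2)" by (simp add: powr_half_sqrt[symmetric] powr_powr)
      then have "z\<^sup>2 * (N powr (\<delta> / 2) * \<epsilon> powr \<delta>) = z\<^sup>2 * (\<epsilon> * sqrt N) powr \<delta>"
        using e by (simp add: powr_mult)
      also have "\<dots> \<le> z\<^sup>2 * z powr \<delta>" using z d by (intro mult_left_mono powr_mono2) auto
      also have "\<dots> = z powr (2 + \<delta>)" using z by (simp add: powr_add)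
      finally have "z\<^sup>2 \<le> z powr (2 + \<delta>) / (N powr (\<delta> / 2) * \<epsilon> powr \<delta>)"
        using e N by (simp add: pos_le_divide_eq)
      then have "6 * z\<^sup>2 \<le> 6 * (z powr (2 + \<delta>) / N powr (\<delta> / 2) / \<epsilon> powr \<delta>)" by simp
      moreover have "0 \<le> \<epsilon> * z\<^sup>2" using e by simp
      ultimately show ?thesis by linarith
    qed
    then show "min (6 * (Z 1 x)\<^sup>2) (\<bar>?t\<bar> * \<bar>Z 1 x\<bar>^3)
        \<le> \<epsilon> * (Z 1 x)\<^sup>2 + 6 * (\<bar>Z 1 x\<bar> powr (2 + \<delta>) / N powr (\<delta> / 2) / \<epsilon> powr \<delta>)"
      by (simp add: z_def)
  qed simp
  also have "\<dots> = (\<epsilon> * s / 6 + ?m / N powr (\<delta> / 2) / \<epsilon> powr \<delta>) / N"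
    using int int2 N s by (simp add: power_divide field_simps)
  finally have b: "cmod (char \<mu> ?t - (1 - ?t\<^sup>2 * s / 2)) \<le> (\<epsilon> * s / 6 + ?m / N powr (\<delta> / 2) / \<epsilon> powr \<delta>) / N" .
  have t2: "complex_of_real (1 + (- s / 2) / N) = 1 - ?t\<^sup>2 * s / 2"
    using N by (simp add: power_divide flip: of_real_power)
  have "cmod (char \<mu> ?t ^ N - complex_of_real (1 + (- s / 2) / N) ^ N)
     \<le> N * cmod (char \<mu> ?t - complex_of_real (1 + (- s / 2) / N))"
  proof (rule norm_power_diff)
    show "cmod (char \<mu> ?t) \<le> 1" by (rule \<mu>.cmod_char_le_1)
    have "\<bar>1 + (- s / 2) / N\<bar> \<le> 1" using Ns N s0 by (auto intro!: abs_leI simp: divide_le_eq)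
    then show "cmod (complex_of_real (1 + (- s / 2) / N)) \<le> 1" by (simp only: norm_of_real)
  qed
  also have "\<dots> \<le> N * ((\<epsilon> * s / 6 + ?m / N powr (\<delta> / 2) / \<epsilon> powr \<delta>) / N)"
    using b unfolding t2 by (intro mult_left_mono) auto
  also have "\<dots> = \<epsilon> * s / 6 + ?m / N powr (\<delta> / 2) / \<epsilon> powr \<delta>" using N by simp
  finally show ?thesis unfolding c of_real_power .
qed

end

section \<open>Convergence to the chi-square law\<close>

abbreviation gauss2 :: "(real \<times> real) measure" where
  "gauss2 \<equiv> std_normal_distribution \<Otimes>\<^sub>M std_normal_distribution"

lemma prob_space_gauss2: "prob_space gauss2"
proof -
  interpret S: real_distribution std_normal_distribution by (rule real_dist_normal_dist)
  show ?thesis by (intro prob_space_pair S.prob_space_axioms)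
qed

text \<open>The Gaussian \<open>exp (-s\<^sup>2/2)\<close> is its own characteristic function, which linearises the
  quadratic form in the exponent.\<close>

lemma exp_square_eq_gauss2:
  "complex_of_real (exp (- (c\<^sup>2 * (u\<^sup>2 + v\<^sup>2)) / 2)) = (CLINT g|gauss2. iexp (c * (fst g * u + snd g * v)))"
proof -
  interpret S: real_distribution std_normal_distribution by (rule real_dist_normal_dist)
  interpret P: pair_prob_space std_normal_distribution std_normal_distribution ..
  have ch: "(CLINT x|std_normal_distribution. iexp (t * x)) = complex_of_real (exp (- t\<^sup>2 / 2))" for t :: real
    using char_std_normal_distribution by (simp add: char_def fun_eq_iff)
  have int: "integrable gauss2 (\<lambda>g. iexp (c * (fst g * u + snd g * v)))"
    by (rule P.integrable_const_bound[of _ 1]) (auto simp: norm_exp_i_times)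
  have "(CLINT g|gauss2. iexp (c * (fst g * u + snd g * v)))
     = (CLINT x|std_normal_distribution. CLINT y|std_normal_distribution. iexp (c * (x * u + y * v)))"
    using P.integral_fst'[OF int] by simp
  also have "\<dots> = (CLINT x|std_normal_distribution. iexp ((c * u) * x) * (CLINT y|std_normal_distribution. iexp ((c * v) * y)))"
  proof (rule Bochner_Integration.integral_cong[OF refl])
    fix x
    have "(CLINT y|std_normal_distribution. iexp (c * (x * u + y * v)))
        = (CLINT y|std_normal_distribution. iexp ((c * u) * x) * iexp ((c * v) * y))"
      by (rule Bochner_Integration.integral_cong) (simp_all add: exp_add[symmetric] algebra_simps)
    then show "(CLINT y|std_normal_distribution. iexp (c * (x * u + y * v)))
        = iexp ((c * u) * x) * (CLINT y|std_normal_distribution. iexp ((c * v) * y))"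
      by simp
  qed
  also have "\<dots> = complex_of_real (exp (- (c * u)\<^sup>2 / 2)) * complex_of_real (exp (- (c * v)\<^sup>2 / 2))"
    unfolding ch by (subst integral_mult_left_zero) (simp only: ch)
  also have "\<dots> = complex_of_real (exp (- (c\<^sup>2 * (u\<^sup>2 + v\<^sup>2)) / 2))"
    unfolding of_real_mult[symmetric] exp_add[symmetric]
    by (intro arg_cong[of _ _ "\<lambda>x. complex_of_real (exp x)"]) (simp add: power_mult_distrib algebra_simps add_divide_distrib)
  finally show ?thesis ..
qed

text \<open>Fubini between the sample and an independent Gaussian pair; the integrand has modulus 1.
  The measurability claim serves the dominated convergence that follows.\<close>

lemma (in prob_space) expectation_exp_square:
  fixes U V :: "'a \<Rightarrow> real"
  assumes [measurable]: "U \<in> borel_measurable M" "V \<in> borel_measurable M"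
  shows "complex_of_real (expectation (\<lambda>w. exp (- (c\<^sup>2 * ((U w)\<^sup>2 + (V w)\<^sup>2)) / 2)))
     = (CLINT g|gauss2. char (distr M borel (\<lambda>w. (c * fst g) * U w + (c * snd g) * V w)) 1)"
    and "(\<lambda>g. char (distr M borel (\<lambda>w. (c * fst g) * U w + (c * snd g) * V w)) 1) \<in> borel_measurable gauss2"
proof -
  interpret G: prob_space gauss2 by (rule prob_space_gauss2)
  interpret P: pair_prob_space M gauss2 ..
  define f where "f w g = iexp (c * (fst g * U w + snd g * V w))" for w and g :: "real \<times> real"
  have f[measurable]: "case_prod f \<in> borel_measurable (M \<Otimes>\<^sub>M gauss2)" unfolding f_def by measurable
  have int: "integrable (M \<Otimes>\<^sub>M gauss2) (case_prod f)"
    by (rule P.integrable_const_bound[of _ 1]) (auto simp: f_def norm_exp_i_times)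
  have ch: "char (distr M borel (\<lambda>w. (c * fst g) * U w + (c * snd g) * V w)) 1 = (CLINT w|M. f w g)" for g
    by (simp add: char_def integral_distr f_def algebra_simps)
  have "complex_of_real (expectation (\<lambda>w. exp (- (c\<^sup>2 * ((U w)\<^sup>2 + (V w)\<^sup>2)) / 2)))
      = (CLINT w|M. CLINT g|gauss2. f w g)"
    unfolding f_def exp_square_eq_gauss2[symmetric] by simp
  also have "\<dots> = (CLINT g|gauss2. CLINT w|M. f w g)"
    by (rule P.Fubini_integral[OF int, symmetric])
  finally show "complex_of_real (expectation (\<lambda>w. exp (- (c\<^sup>2 * ((U w)\<^sup>2 + (V w)\<^sup>2)) / 2)))
     = (CLINT g|gauss2. char (distr M borel (\<lambda>w. (c * fst g) * U w + (c * snd g) * V w)) 1)"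
    by (simp only: ch)
  have "(\<lambda>(g, w). f w g) \<in> borel_measurable (gauss2 \<Otimes>\<^sub>M M)"
    unfolding f_def by measurable
  then show "(\<lambda>g. char (distr M borel (\<lambda>w. (c * fst g) * U w + (c * snd g) * V w)) 1) \<in> borel_measurable gauss2"
    unfolding ch by (rule borel_measurable_lebesgue_integral)
qed

text \<open>After Fubini the outer integral is over one fixed Gaussian space although the sample
  spaces vary, so dominated convergence applies with the constant bound 1 on characteristic
  functions.\<close>

lemma tendsto_expectation_exp_square:
  fixes U V :: "nat \<Rightarrow> 'a \<Rightarrow> real" and U' V' :: "'b \<Rightarrow> real"
  assumes P: "\<And>n. prob_space (M n)" "prob_space M'"
    and meas: "\<And>n. U n \<in> borel_measurable (M n)" "\<And>n. V n \<in> borel_measurable (M n)"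
      "U' \<in> borel_measurable M'" "V' \<in> borel_measurable M'"
    and lim: "\<And>a b. (\<lambda>n. char (distr (M n) borel (\<lambda>w. a * U n w + b * V n w)) 1)
       \<longlonglongrightarrow> char (distr M' borel (\<lambda>w. a * U' w + b * V' w)) 1"
  shows "(\<lambda>n. \<integral>w. exp (- (c\<^sup>2 * ((U n w)\<^sup>2 + (V n w)\<^sup>2)) / 2) \<partial>M n)
    \<longlonglongrightarrow> (\<integral>w. exp (- (c\<^sup>2 * ((U' w)\<^sup>2 + (V' w)\<^sup>2)) / 2) \<partial>M')"
proof -
  interpret G: prob_space gauss2 by (rule prob_space_gauss2)
  have "(\<lambda>n. CLINT g|gauss2. char (distr (M n) borel (\<lambda>w. (c * fst g) * U n w + (c * snd g) * V n w)) 1)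
     \<longlonglongrightarrow> (CLINT g|gauss2. char (distr M' borel (\<lambda>w. (c * fst g) * U' w + (c * snd g) * V' w)) 1)"
  proof (rule integral_dominated_convergence[where w="\<lambda>_. 1"])
    show "AE g in gauss2. norm (char (distr (M n) borel (\<lambda>w. (c * fst g) * U n w + (c * snd g) * V n w)) 1) \<le> 1" for n
    proof (rule AE_I2)
      fix g :: "real \<times> real"
      interpret Mn: prob_space "M n" by (rule P)
      interpret D: real_distribution "distr (M n) borel (\<lambda>w. (c * fst g) * U n w + (c * snd g) * V n w)"
        using meas by (intro Mn.real_distribution_distr) simp
      show "norm (char (distr (M n) borel (\<lambda>w. (c * fst g) * U n w + (c * snd g) * V n w)) 1) \<le> 1"
        by (rule D.cmod_char_le_1)
    qed
  qed (use P meas lim in \<open>auto intro!: prob_space.expectation_exp_square(2)\<close>)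
  then have "(\<lambda>n. complex_of_real (\<integral>w. exp (- (c\<^sup>2 * ((U n w)\<^sup>2 + (V n w)\<^sup>2)) / 2) \<partial>M n))
    \<longlonglongrightarrow> complex_of_real (\<integral>w. exp (- (c\<^sup>2 * ((U' w)\<^sup>2 + (V' w)\<^sup>2)) / 2) \<partial>M')"
    using prob_space.expectation_exp_square(1)[OF P(1) meas(1,2)] prob_space.expectation_exp_square(1)[OF P(2) meas(3,4)]
    by simp
  then show ?thesis by (simp only: tendsto_of_real_iff)
qed

lemma continuous_on_cts_step: "a < b \<Longrightarrow> continuous_on UNIV (cts_step a b)"
  by (intro uniformly_continuous_imp_continuous cts_step_uniformly_continuous)

text \<open>The substitution u = exp (-t) carries the half-line into [0, 1], where polynomials are
  dense.\<close>

lemma cts_step_exp_approx: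
  assumes xy: "x < y" and e: "0 < e"
  shows "\<exists>a (d::nat). \<forall>t\<ge>0::real. \<bar>cts_step x y t - (\<Sum>i\<le>d. a i * exp (- (real i * t)))\<bar> \<le> e"
proof -
  \<comment> \<open>Cutting off at exp (-y) keeps the logarithm away from 0 and changes nothing on
    the image of the half-line, since the step function vanishes from y on. This makes
    \<open>h\<close> continuous up to u = 0.\<close>
  define h where "h u = cts_step x y (- ln (max u (exp (- y))))" for u
  have h: "cts_step x y t = h (exp (- t))" for t
  proof (cases "t \<le> y")
    case True
    then show ?thesis by (simp add: h_def max_def)
  next
    case False
    then show ?thesis using xy by (simp add: h_def max_def cts_step_def)
  qed
  have mx: "max u (exp (- y)) \<noteq> 0" for u by (smt (verit) exp_gt_zero max.cobounded2)
  have "continuous_on {0..1} (\<lambda>u. - ln (max u (exp (- y))))"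
    by (intro continuous_intros) (use mx in blast)
  then have hc: "continuous_on {0..1} h"
    unfolding h_def by (rule continuous_on_compose2[OF continuous_on_cts_step[OF xy]]) simp
  obtain g where g: "real_polynomial_function g" "\<And>u. u \<in> {0..1} \<Longrightarrow> \<bar>h u - g u\<bar> < e"
    using Stone_Weierstrass_real_polynomial_function[OF compact_Icc hc e] by blast
  obtain a d where ad: "g = (\<lambda>u. \<Sum>i\<le>d. a i * u ^ i)"
    using g(1) real_polynomial_function_iff_sum by blast
  have gexp: "g (exp (- t)) = (\<Sum>i\<le>d. a i * exp (- (real i * t)))" for t
    by (simp add: ad exp_of_nat_mult[symmetric])
  have "\<bar>cts_step x y t - (\<Sum>i\<le>d. a i * exp (- (real i * t)))\<bar> \<le> e" if "0 \<le> t" for t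
    using g(2)[of "exp (- t)"] that unfolding gexp h[symmetric] by simp
  then show ?thesis by blast
qed

lemma (in prob_space) expectation_cts_step_approx:
  fixes a :: "nat \<Rightarrow> real"
  assumes [measurable]: "S \<in> borel_measurable M" and S0: "\<And>w. 0 \<le> S w" and xy: "x < y"
    and approx: "\<forall>t\<ge>0. \<bar>cts_step x y t - (\<Sum>i\<le>d. a i * exp (- (real i * t)))\<bar> \<le> e"
  shows "\<bar>integral\<^sup>L (distr M borel S) (cts_step x y) - (\<Sum>i\<le>d. a i * expectation (\<lambda>w. exp (- (real i * S w))))\<bar> \<le> e"
proof -
  have [measurable]: "cts_step x y \<in> borel_measurable borel"
    using continuous_on_cts_step[OF xy] by (rule borel_measurable_continuous_onI)
  have i1: "integrable M (\<lambda>w. exp (- (real i * S w)))" for i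
    by (rule integrable_const_bound[of _ 1]) (use S0 in auto)
  have i2: "integrable M (\<lambda>w. cts_step x y (S w))"
    by (rule integrable_const_bound[of _ 1]) (use xy in \<open>auto simp: cts_step_def\<close>)
  have i3: "integrable M (\<lambda>w. \<Sum>i\<le>d. a i * exp (- (real i * S w)))"
    using i1 by (intro Bochner_Integration.integrable_sum integrable_mult_right)
  have "integral\<^sup>L (distr M borel S) (cts_step x y) = expectation (\<lambda>w. cts_step x y (S w))"
    by (rule integral_distr) measurable
  moreover have "(\<Sum>i\<le>d. a i * expectation (\<lambda>w. exp (- (real i * S w)))) = expectation (\<lambda>w. \<Sum>i\<le>d. a i * exp (- (real i * S w)))"
    using i1 by (subst Bochner_Integration.integral_sum) auto
  ultimately have "integral\<^sup>L (distr M borel S) (cts_step x y) - (\<Sum>i\<le>d. a i * expectation (\<lambda>w. exp (- (real i * S w))))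
      = expectation (\<lambda>w. cts_step x y (S w) - (\<Sum>i\<le>d. a i * exp (- (real i * S w))))"
    using i2 i3 by simp
  also have "\<bar>\<dots>\<bar> \<le> expectation (\<lambda>w. \<bar>cts_step x y (S w) - (\<Sum>i\<le>d. a i * exp (- (real i * S w)))\<bar>)" by (rule integral_abs_bound)
  also have "\<dots> \<le> expectation (\<lambda>w. e)"
    using i2 i3 approx S0 by (intro integral_mono integrable_abs Bochner_Integration.integrable_diff) auto
  also have "\<dots> = e" by (simp add: prob_space)
  finally show ?thesis .
qed

text \<open>A continuous function of \<open>exp (-T)\<close> is uniformly close to a polynomial in \<open>exp (-T)\<close>, so the
  Laplace transform is only needed at natural numbers.\<close>

lemma weak_conv_m_of_laplace:
  fixes T :: "nat \<Rightarrow> 'a \<Rightarrow> real" and T' :: "'b \<Rightarrow> real"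
  assumes P: "\<And>n. prob_space (M n)" "prob_space M'"
    and meas [measurable]: "\<And>n. T n \<in> borel_measurable (M n)" "T' \<in> borel_measurable M'"
    and nonneg: "\<And>n w. 0 \<le> T n w" "\<And>w. 0 \<le> T' w"
    and lim: "\<And>k::nat. (\<lambda>n. \<integral>w. exp (- (k * T n w)) \<partial>M n) \<longlonglongrightarrow> (\<integral>w. exp (- (k * T' w)) \<partial>M')"
  shows "weak_conv_m (\<lambda>n. distr (M n) borel (T n)) (distr M' borel T')"
proof (rule integral_cts_step_conv_imp_weak_conv)
  interpret P: prob_space "M n" for n by (rule P)
  interpret P': prob_space M' by (rule P)
  show "real_distribution (distr (M n) borel (T n))" for n by simp
  show "real_distribution (distr M' borel T')" by simp
  fix x y :: real assume xy: "x < y"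
  show "(\<lambda>n. integral\<^sup>L (distr (M n) borel (T n)) (cts_step x y)) \<longlonglongrightarrow> integral\<^sup>L (distr M' borel T') (cts_step x y)"
  proof (rule LIMSEQ_I)
    fix r :: real assume r: "0 < r"
    define e where "e = r / 3"
    have e: "0 < e" using r by (simp add: e_def)
    obtain a and d :: nat where ad: "\<forall>t\<ge>0. \<bar>cts_step x y t - (\<Sum>i\<le>d. a i * exp (- (real i * t)))\<bar> \<le> e"
      using cts_step_exp_approx[OF xy e] by blast
    define s where "s n = (\<Sum>i\<le>d. a i * (\<integral>w. exp (- (real i * T n w)) \<partial>M n))" for n
    define s' where "s' = (\<Sum>i\<le>d. a i * (\<integral>w. exp (- (real i * T' w)) \<partial>M'))"
    have "s \<longlonglongrightarrow> s'"
      unfolding s_def s'_def by (intro tendsto_sum tendsto_mult tendsto_const lim)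
    from LIMSEQ_D[OF this e] obtain n0 where n0: "\<And>n. n \<ge> n0 \<Longrightarrow> \<bar>s n - s'\<bar> < e"
      by (auto simp: real_norm_def)
    show "\<exists>n0. \<forall>n\<ge>n0. norm (integral\<^sup>L (distr (M n) borel (T n)) (cts_step x y) - integral\<^sup>L (distr M' borel T') (cts_step x y)) < r"
    proof (intro exI[of _ n0] allI impI)
      fix n assume "n0 \<le> n"
      from n0[OF this] P.expectation_cts_step_approx[OF meas(1) nonneg(1) xy ad, of n, folded s_def]
        P'.expectation_cts_step_approx[OF meas(2) nonneg(2) xy ad, folded s'_def]
      show "norm (integral\<^sup>L (distr (M n) borel (T n)) (cts_step x y) - integral\<^sup>L (distr M' borel T') (cts_step x y)) < r"
        unfolding real_norm_def e_def by linarith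
    qed
  qed
qed

section \<open>The chi-square law with two degrees of freedom\<close>

lemma prob_space_PiM_std_normal: "prob_space (\<Pi>\<^sub>M i\<in>{..<k::nat}. std_normal_distribution)"
proof -
  interpret S: real_distribution std_normal_distribution by (rule real_dist_normal_dist)
  show ?thesis by (intro prob_space_PiM) unfold_locales
qed

lemma char_PiM_std_normal:
  "char (distr (\<Pi>\<^sub>M i\<in>{..<2::nat}. std_normal_distribution) borel (\<lambda>z. a * z 0 + b * z (Suc 0))) 1
    = complex_of_real (exp (- (a\<^sup>2 + b\<^sup>2) / 2))"
proof -
  interpret S: real_distribution std_normal_distribution by (rule real_dist_normal_dist)
  interpret Q: product_sigma_finite "\<lambda>_::nat. std_normal_distribution" ..
  have ch: "(CLINT x|std_normal_distribution. iexp (t * x)) = complex_of_real (exp (- t\<^sup>2 / 2))" for t :: real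
    using char_std_normal_distribution by (simp add: char_def fun_eq_iff)
  define f where "f i x = iexp ((if i = 0 then a else b) * x)" for i :: nat and x :: real
  have two: "{..<2::nat} = {0, 1}" by auto
  have "char (distr (\<Pi>\<^sub>M i\<in>{..<2::nat}. std_normal_distribution) borel (\<lambda>z. a * z 0 + b * z (Suc 0))) 1
    = (CLINT z|(\<Pi>\<^sub>M i\<in>{..<2::nat}. std_normal_distribution). iexp (a * z 0 + b * z (Suc 0)))"
    unfolding char_def by (subst integral_distr) (auto simp: two)
  also have "\<dots> = (CLINT z|(\<Pi>\<^sub>M i\<in>{..<2::nat}. std_normal_distribution). (\<Prod>i\<in>{..<2}. f i (z i)))"
    by (rule Bochner_Integration.integral_cong) (simp_all add: two f_def exp_add[symmetric] algebra_simps)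
  also have "\<dots> = (\<Prod>i\<in>{..<2}. CLINT x|std_normal_distribution. f i x)"
    by (rule Q.product_integral_prod) (auto simp: f_def intro!: S.integrable_iexp)
  also have "\<dots> = complex_of_real (exp (- a\<^sup>2 / 2)) * complex_of_real (exp (- b\<^sup>2 / 2))"
  proof -
    have "f 0 = (\<lambda>x. iexp (a * x))" "f 1 = (\<lambda>x. iexp (b * x))" by (simp_all add: f_def[abs_def])
    then show ?thesis by (simp add: two ch del: of_real_mult)
  qed
  also have "\<dots> = complex_of_real (exp (- (a\<^sup>2 + b\<^sup>2) / 2))"
    unfolding of_real_mult[symmetric] exp_add[symmetric] by (simp add: add_divide_distrib[symmetric] algebra_simps)
  finally show ?thesis .
qed

lemma chi_square_2_eq:
  "chi_square 2 = distr (\<Pi>\<^sub>M i\<in>{..<2::nat}. std_normal_distribution) borel (\<lambda>z. (z 0)\<^sup>2 + (z (Suc 0))\<^sup>2)"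
  unfolding chi_square_def by (simp add: numeral_2_eq_2)

lemma weak_conv_chi_square_2:
  fixes U V :: "nat \<Rightarrow> 'a \<Rightarrow> real"
  assumes P: "\<And>n. prob_space (M n)"
    and meas [measurable]: "\<And>n. U n \<in> borel_measurable (M n)" "\<And>n. V n \<in> borel_measurable (M n)"
    and lim: "\<And>a b. (\<lambda>n. char (distr (M n) borel (\<lambda>w. a * U n w + b * V n w)) 1)
       \<longlonglongrightarrow> complex_of_real (exp (- (a\<^sup>2 + b\<^sup>2) / 2))"
  shows "weak_conv_m (\<lambda>n. distr (M n) borel (\<lambda>w. (U n w)\<^sup>2 + (V n w)\<^sup>2)) (chi_square 2)"
  unfolding chi_square_2_eq
proof (rule weak_conv_m_of_laplace)
  let ?Q = "\<Pi>\<^sub>M i\<in>{..<2::nat}. std_normal_distribution"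
  show "prob_space (M n)" for n by (rule P)
  show "prob_space ?Q" by (rule prob_space_PiM_std_normal)
  have z[measurable]: "(\<lambda>z. z 0) \<in> borel_measurable ?Q" "(\<lambda>z. z (Suc 0)) \<in> borel_measurable ?Q"
    by auto
  show "(\<lambda>z. (z 0)\<^sup>2 + (z (Suc 0))\<^sup>2) \<in> borel_measurable ?Q" by measurable
  fix k :: nat
  \<comment> \<open>The scale c = sqrt (2k) turns the Gaussian average with exponent c^2/2 into the
    Laplace transform at k.\<close>
  have s: "(sqrt (2 * k))\<^sup>2 * t / 2 = k * t" for t by simp
  show "(\<lambda>n. \<integral>w. exp (- (k * ((U n w)\<^sup>2 + (V n w)\<^sup>2))) \<partial>M n) \<longlonglongrightarrow> (\<integral>z. exp (- (k * ((z 0)\<^sup>2 + (z (Suc 0))\<^sup>2))) \<partial>?Q)"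
    using tendsto_expectation_exp_square[where c="sqrt (2 * k)" and M=M and M'="?Q" and U=U and V=V and U'="\<lambda>z. z 0" and V'="\<lambda>z. z (Suc 0)",
        OF P prob_space_PiM_std_normal meas z] lim
    unfolding char_PiM_std_normal minus_divide_left[symmetric] s by simp
qed auto

lemma measure_std_normal_finite: "finite A \<Longrightarrow> emeasure std_normal_distribution A = 0"
  using finite_imp_null_set_lborel absolutely_continuousI_density[of std_normal_density lborel]
  by (auto simp: absolutely_continuous_def)

text \<open>No atoms: once the first coordinate is fixed, at most two values of the second one give
  the sum x, and the normal law does not charge them. Thus weak convergence is convergence of the
  distribution functions at every point.\<close>

lemma isCont_cdf_chi_square_2: "isCont (cdf (chi_square 2)) x"
proof -
  let ?Q = "\<Pi>\<^sub>M i\<in>{..<2::nat}. std_normal_distribution"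
  interpret S: real_distribution std_normal_distribution by (rule real_dist_normal_dist)
  interpret Q: product_sigma_finite "\<lambda>_::nat. std_normal_distribution" ..
  interpret P: prob_space ?Q by (rule prob_space_PiM_std_normal)
  have z[measurable]: "(\<lambda>z. z 0) \<in> borel_measurable ?Q" "(\<lambda>z. z (Suc 0)) \<in> borel_measurable ?Q"
    by auto
  have two: "{..<2::nat} = insert 1 {0}" by auto
  interpret D: real_distribution "chi_square 2" unfolding chi_square_2_eq by (rule P.real_distribution_distr) measurable
  have "emeasure (chi_square 2) {x} = emeasure ?Q {z \<in> space ?Q. (z 0)\<^sup>2 + (z (Suc 0))\<^sup>2 = x}"
    unfolding chi_square_2_eq by (subst emeasure_distr) (auto intro!: arg_cong[of _ _ "emeasure ?Q"])
  also have "\<dots> = (\<integral>\<^sup>+z. indicator {z. (z 0)\<^sup>2 + (z (Suc 0))\<^sup>2 = x} z \<partial>?Q)"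
  proof -
    have "{z \<in> space ?Q. (z 0)\<^sup>2 + (z (Suc 0))\<^sup>2 = x} \<in> sets ?Q" by measurable
    then have "emeasure ?Q {z \<in> space ?Q. (z 0)\<^sup>2 + (z (Suc 0))\<^sup>2 = x}
        = (\<integral>\<^sup>+z. indicator {z \<in> space ?Q. (z 0)\<^sup>2 + (z (Suc 0))\<^sup>2 = x} z \<partial>?Q)"
      by (rule nn_integral_indicator[symmetric])
    also have "\<dots> = (\<integral>\<^sup>+z. indicator {z. (z 0)\<^sup>2 + (z (Suc 0))\<^sup>2 = x} z \<partial>?Q)"
      by (intro nn_integral_cong) (auto simp: indicator_def)
    finally show ?thesis .
  qed
  also have "\<dots> = (\<integral>\<^sup>+z. (\<integral>\<^sup>+y. indicator {z. (z 0)\<^sup>2 + (z (Suc 0))\<^sup>2 = x} (z(1 := y)) \<partial>std_normal_distribution) \<partial>(\<Pi>\<^sub>M i\<in>{0::nat}. std_normal_distribution))"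
    unfolding two
  proof (rule Q.product_nn_integral_insert)
    show "indicator {z. (z 0)\<^sup>2 + (z (Suc 0))\<^sup>2 = x} \<in> borel_measurable (\<Pi>\<^sub>M i\<in>insert (1::nat) {0}. std_normal_distribution)"
      using z unfolding two by measurable
  qed auto
  also have "\<dots> = (\<integral>\<^sup>+z. 0 \<partial>(\<Pi>\<^sub>M i\<in>{0::nat}. std_normal_distribution))"
  proof (rule nn_integral_cong)
    fix z :: "nat \<Rightarrow> real"
    have "{y. (z 0)\<^sup>2 + y\<^sup>2 = x} \<subseteq> {sqrt (x - (z 0)\<^sup>2), - sqrt (x - (z 0)\<^sup>2)}"
      by (auto simp: real_sqrt_abs)
    then have "finite {y. (z 0)\<^sup>2 + y\<^sup>2 = x}" by (rule finite_subset) simp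
    then have "emeasure std_normal_distribution {y. (z 0)\<^sup>2 + y\<^sup>2 = x} = 0"
      by (rule measure_std_normal_finite)
    moreover have "(\<integral>\<^sup>+y. indicator {z. (z 0)\<^sup>2 + (z (Suc 0))\<^sup>2 = x} (z(1 := y)) \<partial>std_normal_distribution)
       = (\<integral>\<^sup>+y. indicator {y. (z 0)\<^sup>2 + y\<^sup>2 = x} y \<partial>std_normal_distribution)"
      by (intro nn_integral_cong) (auto simp: indicator_def)
    ultimately show "(\<integral>\<^sup>+y. indicator {z. (z 0)\<^sup>2 + (z (Suc 0))\<^sup>2 = x} (z(1 := y)) \<partial>std_normal_distribution) = 0"
      by simp
  qed
  finally have "measure (chi_square 2) {x} = 0" by (simp add: measure_def)
  then show ?thesis by (simp add: D.isCont_cdf)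
qed

section \<open>Standardized triangular arrays\<close>

text \<open>A mean square \<theta>^2 of the differences has to produce an error linear in \<theta>
  although \<open>A\<close> and \<open>B\<close> are only bounded in mean square. Young's inequality
  with weight \<theta> balances the two: 2|ad| \<le> \<theta>a^2 + d^2/\<theta>. The total is
  3\<theta> + \<theta>^2, at most 4\<theta>.\<close>

lemma sum_mult_perturb:
  fixes A B A' B' :: "nat \<Rightarrow> real"
  assumes t: "0 < \<theta>" "\<theta> \<le> 1"
    and A: "(\<Sum>i=1..N. (A i)\<^sup>2) / N \<le> 2" and B: "(\<Sum>i=1..N. (B i)\<^sup>2) / N \<le> 2"
    and dA: "(\<Sum>i=1..N. (A' i - A i)\<^sup>2) / N \<le> \<theta>\<^sup>2" and dB: "(\<Sum>i=1..N. (B' i - B i)\<^sup>2) / N \<le> \<theta>\<^sup>2"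
  shows "\<bar>(\<Sum>i=1..N. A' i * B' i) / N - (\<Sum>i=1..N. A i * B i) / N\<bar> \<le> 4 * \<theta>"
proof -
  have young: "\<bar>a * d\<bar> \<le> (\<theta> * a\<^sup>2 + d\<^sup>2 / \<theta>) / 2" for a d :: real
  proof -
    have "0 \<le> (\<theta> * \<bar>a\<bar> - \<bar>d\<bar>)\<^sup>2 / \<theta>" using t by simp
    also have "\<dots> = \<theta> * a\<^sup>2 - 2 * \<bar>a * d\<bar> + d\<^sup>2 / \<theta>"
      using t by (simp add: power2_eq_square abs_mult field_simps)
    finally show ?thesis by simp
  qed
  have young1: "\<bar>a * d\<bar> \<le> (a\<^sup>2 + d\<^sup>2) / 2" for a d :: real
    using two_abs_mult_le_squares[of a d] by simp
  have pw: "\<bar>A' i * B' i - A i * B i\<bar> \<le> (\<theta> * (A i)\<^sup>2 + (B' i - B i)\<^sup>2 / \<theta>) / 2 +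
     (\<theta> * (B i)\<^sup>2 + (A' i - A i)\<^sup>2 / \<theta>) / 2 + ((A' i - A i)\<^sup>2 + (B' i - B i)\<^sup>2) / 2" for i
  proof -
    have "A' i * B' i - A i * B i = A i * (B' i - B i) + B i * (A' i - A i) + (A' i - A i) * (B' i - B i)"
      by (simp add: algebra_simps)
    then show ?thesis
      using young[of "A i" "B' i - B i"] young[of "B i" "A' i - A i"] young1[of "A' i - A i" "B' i - B i"]
      by linarith
  qed
  define a b dA' dB' where "a = (\<Sum>i=1..N. (A i)\<^sup>2) / N" and "b = (\<Sum>i=1..N. (B i)\<^sup>2) / N"
    and "dA' = (\<Sum>i=1..N. (A' i - A i)\<^sup>2) / N" and "dB' = (\<Sum>i=1..N. (B' i - B i)\<^sup>2) / N"
  have "\<bar>(\<Sum>i=1..N. A' i * B' i) / N - (\<Sum>i=1..N. A i * B i) / N\<bar> = \<bar>\<Sum>i=1..N. A' i * B' i - A i * B i\<bar> / N"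
    by (simp add: sum_subtractf diff_divide_distrib[symmetric] abs_divide)
  also have "\<dots> \<le> (\<Sum>i=1..N. \<bar>A' i * B' i - A i * B i\<bar>) / N"
    by (intro divide_right_mono sum_abs) simp
  also have "\<dots> \<le> (\<Sum>i=1..N. (\<theta> * (A i)\<^sup>2 + (B' i - B i)\<^sup>2 / \<theta>) / 2 +
     (\<theta> * (B i)\<^sup>2 + (A' i - A i)\<^sup>2 / \<theta>) / 2 + ((A' i - A i)\<^sup>2 + (B' i - B i)\<^sup>2) / 2) / N"
    by (intro divide_right_mono sum_mono pw) simp
  also have "\<dots> = (\<theta> * a + dB' / \<theta>) / 2 + (\<theta> * b + dA' / \<theta>) / 2 + (dA' + dB') / 2"
    by (simp add: a_def b_def dA'_def dB'_def sum.distrib sum_distrib_left[symmetric]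
        sum_divide_distrib[symmetric] add_divide_distrib mult_ac)
  also have "\<dots> \<le> (\<theta> * 2 + \<theta>\<^sup>2 / \<theta>) / 2 + (\<theta> * 2 + \<theta>\<^sup>2 / \<theta>) / 2 + (\<theta>\<^sup>2 + \<theta>\<^sup>2) / 2"
    using assms by (intro add_mono divide_right_mono mult_left_mono) (auto simp: a_def b_def dA'_def dB'_def)
  also have "\<dots> = 3 * \<theta> + \<theta> * \<theta>" using t by (simp add: power2_eq_square field_simps)
  also have "\<dots> \<le> 3 * \<theta> + \<theta> * 1" using t by (intro add_left_mono mult_left_mono) auto
  finally show ?thesis by simp
qed

text \<open>The random variable whose expectation the additional hypotheses on the estimated-mean
  statistics control. Its first part governs second moments and maxima, its second part the shift of
  the normalized sum.\<close>

definition sum_dev :: "nat \<Rightarrow> (nat \<Rightarrow> real) \<Rightarrow> (nat \<Rightarrow> real) \<Rightarrow> real" where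
  "sum_dev N f g = (\<Sum>i=1..N. (f i - g i)\<^sup>2) + (\<Sum>i=1..N. f i - g i)\<^sup>2"

lemma sum_dev_nonneg: "0 \<le> sum_dev N f g"
  unfolding sum_dev_def by (intro add_nonneg_nonneg sum_nonneg zero_le_power2)

lemma sum_dev_divide: "sum_dev N (\<lambda>i. f i / c) (\<lambda>i. g i / c) = sum_dev N f g / c\<^sup>2"
  by (simp add: sum_dev_def diff_divide_distrib[symmetric] sum_divide_distrib[symmetric] power_divide add_divide_distrib)

text \<open>A small deviation keeps the primed sample regular, with K + 1 and \<eta> in place of K
  and \<theta>. Its expansion is then moved back to the unprimed normalized sums.\<close>

lemma el_ratio_perturbed_expansion:
  fixes \<epsilon> K :: real
  assumes e: "0 < \<epsilon>" and K: "0 < K"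
  shows "\<exists>\<theta>>0. \<forall>N A B A' B'. el_regular K \<theta> N A B \<longrightarrow> K + 1 \<le> \<theta> * sqrt N \<longrightarrow>
    sum_dev N A' A \<le> \<theta>\<^sup>2 * N \<longrightarrow> sum_dev N B' B \<le> \<theta>\<^sup>2 * N \<longrightarrow>
    (\<exists>r. neg2_log (el_ratio N (\<lambda>i. (A' i, B' i))) = ereal r \<and> \<bar>r - norm_sq N A B\<bar> \<le> \<epsilon>)"
proof -
  have "0 < \<epsilon> / 2" "0 < K + 1" using e K by auto
  from el_ratio_expansion[OF this] obtain \<eta> where \<eta>: "0 < \<eta>" and exp: "\<And>N A B. el_regular (K + 1) \<eta> N A B \<Longrightarrow>
    \<exists>r. neg2_log (el_ratio N (\<lambda>i. (A i, B i))) = ereal r \<and> \<bar>r - norm_sq N A B\<bar> \<le> \<epsilon> / 2"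
    by blast
  \<comment> \<open>\<eta>/5 absorbs \<theta> from regularity plus 4\<theta> from perturbing second
    moments. The last bound limits the change of each squared sum, at most \<theta>(2K + 1), to
    \<epsilon>/4; the remaining \<epsilon>/2 is the error of the expansion.\<close>
  define \<theta> where "\<theta> = min (min 1 (\<eta> / 5)) (\<epsilon> / (4 * (2 * K + 1)))"
  have \<theta>: "0 < \<theta>" "\<theta> \<le> 1" "5 * \<theta> \<le> \<eta>" using e K \<eta> by (auto simp: \<theta>_def)
  have \<theta>e: "\<theta> * (2 * K + 1) \<le> \<epsilon> / 4"
  proof -
    have "\<theta> \<le> \<epsilon> / (4 * (2 * K + 1))" by (simp add: \<theta>_def)
    then show ?thesis using K by (simp add: field_simps)
  qed
  show ?thesis
  proof (rule exI[of _ \<theta>], intro conjI allI impI)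
    show "0 < \<theta>" by (rule \<theta>)
    fix N :: nat and A B A' B' :: "nat \<Rightarrow> real"
    assume reg: "el_regular K \<theta> N A B" and KN: "K + 1 \<le> \<theta> * sqrt N"
      and dev: "sum_dev N A' A \<le> \<theta>\<^sup>2 * N" "sum_dev N B' B \<le> \<theta>\<^sup>2 * N"
    have N: "0 < N"
      and x: "\<bar>(\<Sum>i=1..N. A i) / sqrt N\<bar> \<le> K" and y: "\<bar>(\<Sum>i=1..N. B i) / sqrt N\<bar> \<le> K"
      and AA: "\<bar>(\<Sum>i=1..N. (A i)\<^sup>2) / N - 1\<bar> \<le> \<theta>" and BB: "\<bar>(\<Sum>i=1..N. (B i)\<^sup>2) / N - 1\<bar> \<le> \<theta>"
      and AB: "\<bar>(\<Sum>i=1..N. A i * B i) / N\<bar> \<le> \<theta>"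
      and mA: "\<forall>i\<in>{1..N}. \<bar>A i\<bar> \<le> \<theta> * sqrt N" and mB: "\<forall>i\<in>{1..N}. \<bar>B i\<bar> \<le> \<theta> * sqrt N"
      using reg unfolding el_regular_def by blast+
    have dev_parts: "(\<Sum>i=1..N. (f i - g i)\<^sup>2) \<le> c" "(\<Sum>i=1..N. f i - g i)\<^sup>2 \<le> c"
      if "sum_dev N f g \<le> c" for f g :: "nat \<Rightarrow> real" and c
    proof -
      have "0 \<le> (\<Sum>i=1..N. (f i - g i)\<^sup>2)" "0 \<le> (\<Sum>i=1..N. f i - g i)\<^sup>2" by (intro sum_nonneg zero_le_power2)+
      then show "(\<Sum>i=1..N. (f i - g i)\<^sup>2) \<le> c" "(\<Sum>i=1..N. f i - g i)\<^sup>2 \<le> c"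
        using that unfolding sum_dev_def by linarith+
    qed
    note dA = dev_parts[OF dev(1)] and dB = dev_parts[OF dev(2)]
    have sN: "0 < sqrt N" using N by simp
    have sq: "\<theta>\<^sup>2 * N = (\<theta> * sqrt N)\<^sup>2" by (simp add: power_mult_distrib)
    have tN: "0 \<le> \<theta> * sqrt N" using \<theta> by simp
    have mean: "\<bar>(\<Sum>i=1..N. C' i) / sqrt N - (\<Sum>i=1..N. C i) / sqrt N\<bar> \<le> \<theta>"
      if "(\<Sum>i=1..N. C' i - C i)\<^sup>2 \<le> \<theta>\<^sup>2 * N" for C C' :: "nat \<Rightarrow> real"
    proof -
      have "\<bar>\<Sum>i=1..N. C' i - C i\<bar> \<le> \<theta> * sqrt N"
        using that unfolding sq abs_le_square_iff[symmetric] abs_of_nonneg[OF tN] .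
      then show ?thesis using sN
        by (simp add: sum_subtractf diff_divide_distrib[symmetric] abs_divide pos_divide_le_eq)
    qed
    have maxi: "\<bar>C' i\<bar> \<le> \<eta> * sqrt N" if "\<forall>i\<in>{1..N}. \<bar>C i\<bar> \<le> \<theta> * sqrt N"
      "(\<Sum>i=1..N. (C' i - C i)\<^sup>2) \<le> \<theta>\<^sup>2 * N" "i \<in> {1..N}" for C C' :: "nat \<Rightarrow> real" and i
    proof -
      have "(C' i - C i)\<^sup>2 \<le> (\<Sum>i=1..N. (C' i - C i)\<^sup>2)" using that(3) by (intro member_le_sum) auto
      then have "(C' i - C i)\<^sup>2 \<le> (\<theta> * sqrt N)\<^sup>2" using that(2) sq by simp
      then have "\<bar>C' i - C i\<bar> \<le> \<theta> * sqrt N"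
        unfolding abs_le_square_iff[symmetric] abs_of_nonneg[OF tN] .
      moreover have "\<bar>C i\<bar> \<le> \<theta> * sqrt N" using that(1,3) by blast
      ultimately have "\<bar>C' i\<bar> \<le> (2 * \<theta>) * sqrt N" by linarith
      also have "\<dots> \<le> \<eta> * sqrt N" using \<theta> by (intro mult_right_mono) auto
      finally show ?thesis .
    qed
    have div: "S / N \<le> \<theta>\<^sup>2" if "S \<le> \<theta>\<^sup>2 * N" for S using that N by (simp add: divide_le_eq)
    have AA2: "(\<Sum>i=1..N. (A i)\<^sup>2) / N \<le> 2" and BB2: "(\<Sum>i=1..N. (B i)\<^sup>2) / N \<le> 2" using AA BB \<theta> by linarith+
    note pA = sum_mult_perturb[OF \<theta>(1,2) AA2 AA2 div[OF dA(1)] div[OF dA(1)], folded power2_eq_square]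
    note pB = sum_mult_perturb[OF \<theta>(1,2) BB2 BB2 div[OF dB(1)] div[OF dB(1)], folded power2_eq_square]
    note pAB = sum_mult_perturb[OF \<theta>(1,2) AA2 BB2 div[OF dA(1)] div[OF dB(1)]]
    define x0 x1 y0 y1 where "x0 = (\<Sum>i=1..N. A i) / sqrt N" and "x1 = (\<Sum>i=1..N. A' i) / sqrt N"
      and "y0 = (\<Sum>i=1..N. B i) / sqrt N" and "y1 = (\<Sum>i=1..N. B' i) / sqrt N"
    have dx: "\<bar>x1 - x0\<bar> \<le> \<theta>" and dy: "\<bar>y1 - y0\<bar> \<le> \<theta>"
      unfolding x0_def x1_def y0_def y1_def by (rule mean[OF dA(2)] mean[OF dB(2)])+
    have x0: "\<bar>x0\<bar> \<le> K" and y0: "\<bar>y0\<bar> \<le> K" using x y by (simp_all add: x0_def y0_def)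
    have reg': "el_regular (K + 1) \<eta> N A' B'"
      unfolding el_regular_def x1_def[symmetric] y1_def[symmetric]
    proof (intro conjI)
      have "\<theta> * sqrt N \<le> \<eta> * sqrt N" using \<theta> by (intro mult_right_mono) auto
      then show "K + 1 \<le> \<eta> * sqrt N" using KN by linarith
      show "\<bar>x1\<bar> \<le> K + 1" "\<bar>y1\<bar> \<le> K + 1" using dx x0 dy y0 \<theta> by linarith+
      show "\<bar>(\<Sum>i=1..N. (A' i)\<^sup>2) / N - 1\<bar> \<le> \<eta>" using pA AA \<theta> by linarith
      show "\<bar>(\<Sum>i=1..N. (B' i)\<^sup>2) / N - 1\<bar> \<le> \<eta>" using pB BB \<theta> by linarith
      show "\<bar>(\<Sum>i=1..N. A' i * B' i) / N\<bar> \<le> \<eta>" using pAB AB \<theta> by linarith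
    qed (use N maxi[OF mA dA(1)] maxi[OF mB dB(1)] in blast)+
    obtain r where r: "neg2_log (el_ratio N (\<lambda>i. (A' i, B' i))) = ereal r" "\<bar>r - (x1\<^sup>2 + y1\<^sup>2)\<bar> \<le> \<epsilon> / 2"
      using exp[OF reg'] unfolding norm_sq_def x1_def[symmetric] y1_def[symmetric] by blast
    have sqd: "\<bar>s\<^sup>2 - t\<^sup>2\<bar> \<le> \<epsilon> / 4" if "\<bar>s - t\<bar> \<le> \<theta>" "\<bar>t\<bar> \<le> K" for s t :: real
    proof -
      have "\<bar>s\<^sup>2 - t\<^sup>2\<bar> = \<bar>s - t\<bar> * \<bar>s + t\<bar>" by (simp add: power2_eq_square square_diff_square_factored abs_mult mult.commute)
      also have "\<dots> \<le> \<theta> * (2 * K + 1)" using that \<theta> by (intro mult_mono) auto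
      finally show ?thesis using \<theta>e by simp
    qed
    have "\<bar>r - (x0\<^sup>2 + y0\<^sup>2)\<bar> \<le> \<epsilon>" using r(2) sqd[OF dx x0] sqd[OF dy y0] by linarith
    then show "\<exists>r. neg2_log (el_ratio N (\<lambda>i. (A' i, B' i))) = ereal r \<and> \<bar>r - norm_sq N A B\<bar> \<le> \<epsilon>"
      using r(1) unfolding norm_sq_def x0_def y0_def by blast
  qed
qed

section \<open>Events of high probability and Slutsky's argument\<close>

text \<open>Measurable sets inside the event are asked for, so that P itself may be an existential
  statement of unknown measurability. The level \<gamma> stays a parameter because the bound on the
  normalized sums depends on it.\<close>

definition likely :: "(nat \<Rightarrow> 'a measure) \<Rightarrow> real \<Rightarrow> (nat \<Rightarrow> 'a \<Rightarrow> bool) \<Rightarrow> bool" where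
  "likely M \<gamma> P \<longleftrightarrow> (\<exists>A. (\<forall>n. A n \<in> sets (M n) \<and> (\<forall>w\<in>A n. P n w)) \<and> (\<forall>\<^sub>F n in sequentially. 1 - \<gamma> \<le> measure (M n) (A n)))"

definition whp :: "(nat \<Rightarrow> 'a measure) \<Rightarrow> (nat \<Rightarrow> 'a \<Rightarrow> bool) \<Rightarrow> bool" where
  "whp M P \<longleftrightarrow> (\<forall>\<gamma>>0. likely M \<gamma> P)"

lemma likely_mono:
  assumes "likely M \<gamma> P" "\<And>n w. P n w \<Longrightarrow> Q n w"
  shows "likely M \<gamma> Q"
  using assms unfolding likely_def by blast

lemma likely_eventually:
  assumes "likely M \<gamma> P" "\<forall>\<^sub>F n in sequentially. R n"
  shows "likely M \<gamma> (\<lambda>n w. P n w \<and> R n)"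
proof -
  obtain A where A: "\<And>n. A n \<in> sets (M n)" "\<And>n w. w \<in> A n \<Longrightarrow> P n w"
    "\<forall>\<^sub>F n in sequentially. 1 - \<gamma> \<le> measure (M n) (A n)"
    using assms(1) unfolding likely_def by blast
  show ?thesis
    unfolding likely_def
  \<comment> \<open>Rows where R fails get the empty set, which is allowed because the probability
    bound is only eventual.\<close>
  proof (intro exI[of _ "\<lambda>n. if R n then A n else {}"] conjI allI ballI)
    show "\<forall>\<^sub>F n in sequentially. 1 - \<gamma> \<le> measure (M n) (if R n then A n else {})"
      using A(3) assms(2) by eventually_elim simp
  qed (use A in \<open>auto split: if_splits\<close>)
qed

lemma likely_conj:
  assumes M: "\<And>n. prob_space (M n)" and "likely M \<gamma> P" "likely M \<gamma>' Q"
  shows "likely M (\<gamma> + \<gamma>') (\<lambda>n w. P n w \<and> Q n w)"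
proof -
  obtain A where A: "\<And>n. A n \<in> sets (M n)" "\<And>n w. w \<in> A n \<Longrightarrow> P n w"
    "\<forall>\<^sub>F n in sequentially. 1 - \<gamma> \<le> measure (M n) (A n)"
    using assms(2) unfolding likely_def by blast
  obtain B where B: "\<And>n. B n \<in> sets (M n)" "\<And>n w. w \<in> B n \<Longrightarrow> Q n w"
    "\<forall>\<^sub>F n in sequentially. 1 - \<gamma>' \<le> measure (M n) (B n)"
    using assms(3) unfolding likely_def by blast
  have m: "measure (M n) (A n) + measure (M n) (B n) - 1 \<le> measure (M n) (A n \<inter> B n)" for n
  proof -
    interpret prob_space "M n" by (rule M)
    have "prob (A n \<union> B n) = prob (A n) + prob (B n) - prob (A n \<inter> B n)"
      by (rule measure_Un3) (use A B in \<open>auto simp: fmeasurable_eq_sets\<close>)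
    moreover have "prob (A n \<union> B n) \<le> 1" by simp
    ultimately show ?thesis by linarith
  qed
  show ?thesis
    unfolding likely_def
  proof (intro exI[of _ "\<lambda>n. A n \<inter> B n"] conjI allI ballI)
    show "\<forall>\<^sub>F n in sequentially. 1 - (\<gamma> + \<gamma>') \<le> measure (M n) (A n \<inter> B n)"
      using A(3) B(3)
    proof eventually_elim
      case (elim n)
      then show ?case using m[of n] by linarith
    qed
  qed (use A B in auto)
qed

lemma whp_conj:
  assumes M: "\<And>n. prob_space (M n)" and "whp M P" "whp M Q"
  shows "whp M (\<lambda>n w. P n w \<and> Q n w)"
  unfolding whp_def
proof (intro allI impI)
  fix \<gamma> :: real assume "0 < \<gamma>"
  then show "likely M \<gamma> (\<lambda>n w. P n w \<and> Q n w)"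
    using likely_conj[OF M, where \<gamma>="\<gamma> / 2" and \<gamma>'="\<gamma> / 2" and P=P and Q=Q] assms(2,3) by (simp add: whp_def)
qed

lemma likely_compl:
  assumes M: "\<And>n. prob_space (M n)" and B: "\<And>n. {w \<in> space (M n). \<not> P n w} \<in> sets (M n)"
    and le: "\<forall>\<^sub>F n in sequentially. measure (M n) {w \<in> space (M n). \<not> P n w} \<le> \<gamma>"
  shows "likely M \<gamma> P"
  unfolding likely_def
proof (intro exI[of _ "\<lambda>n. space (M n) - {w \<in> space (M n). \<not> P n w}"] conjI allI)
  show "\<forall>\<^sub>F n in sequentially. 1 - \<gamma> \<le> measure (M n) (space (M n) - {w \<in> space (M n). \<not> P n w})"
    using le
  proof eventually_elim
    case (elim n)
    interpret prob_space "M n" by (rule M)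
    show ?case using elim prob_compl[OF B[of n]] by linarith
  qed
qed (use B in auto)

lemma whp_compl:
  assumes M: "\<And>n. prob_space (M n)" and B: "\<And>n. {w \<in> space (M n). \<not> P n w} \<in> sets (M n)"
    and le: "\<And>n. measure (M n) {w \<in> space (M n). \<not> P n w} \<le> b n" and b: "b \<longlonglongrightarrow> 0"
  shows "whp M P"
  unfolding whp_def
proof (intro allI impI likely_compl[OF M B])
  fix \<gamma> :: real assume "0 < \<gamma>"
  from order_tendstoD(2)[OF b this]
  show "\<forall>\<^sub>F n in sequentially. measure (M n) {w \<in> space (M n). \<not> P n w} \<le> \<gamma>"
    by eventually_elim (rule order_trans[OF le less_imp_le])
qed

lemma whp_of_expectation:
  fixes Y :: "nat \<Rightarrow> 'a \<Rightarrow> real"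
  assumes M: "\<And>n. prob_space (M n)" and int: "\<And>n. integrable (M n) (Y n)" and nn: "\<And>n w. 0 \<le> Y n w"
    and c: "\<And>n. 0 < c n" and lim: "(\<lambda>n. (\<integral>w. Y n w \<partial>M n) / c n) \<longlonglongrightarrow> 0"
  shows "whp M (\<lambda>n w. Y n w \<le> c n)"
proof (rule whp_compl[OF M])
  fix n
  note [measurable] = borel_measurable_integrable[OF int[of n]]
  interpret prob_space "M n" by (rule M)
  show "{w \<in> space (M n). \<not> Y n w \<le> c n} \<in> sets (M n)" by measurable
  have "prob {w \<in> space (M n). \<not> Y n w \<le> c n} \<le> prob {w \<in> space (M n). c n \<le> Y n w}"
    by (intro finite_measure_mono) auto
  also have "\<dots> \<le> (\<integral>w. Y n w \<partial>M n) / c n"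
    by (rule integral_Markov_inequality_measure[where A="{}"]) (use int nn c in auto)
  finally show "prob {w \<in> space (M n). \<not> Y n w \<le> c n} \<le> (\<integral>w. Y n w \<partial>M n) / c n" .
qed (rule lim)

text \<open>Up to the exceptional set, {W \<le> t} lies between {T \<le> t - \<epsilon>} and {T
  \<le> t + \<epsilon>}, and the limit distribution function is continuous at t. Infinite values of
  W occur only on the exceptional set.\<close>

lemma weak_conv_slutsky:
  fixes W :: "nat \<Rightarrow> 'a \<Rightarrow> ereal" and T :: "nat \<Rightarrow> 'a \<Rightarrow> real"
  assumes M: "\<And>n. prob_space (M n)"
    and W: "\<And>n. W n \<in> borel_measurable (M n)" and T: "\<And>n. T n \<in> borel_measurable (M n)"
    and close: "\<And>\<epsilon> \<gamma>. 0 < \<epsilon> \<Longrightarrow> 0 < \<gamma> \<Longrightarrow> likely M \<gamma> (\<lambda>n w. \<exists>r. W n w = ereal r \<and> \<bar>r - T n w\<bar> \<le> \<epsilon>)"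
    and conv: "weak_conv_m (\<lambda>n. distr (M n) borel (T n)) \<nu>" and cont: "\<And>t. isCont (cdf \<nu>) t"
  shows "weak_conv (\<lambda>n t. measure (M n) {w \<in> space (M n). W n w \<le> ereal t}) (cdf \<nu>)"
  unfolding weak_conv_def
proof (intro allI impI)
  fix t
  have cdfT: "cdf (distr (M n) borel (T n)) s = measure (M n) {w \<in> space (M n). T n w \<le> s}" for n s
    using T[of n] by (subst cdf_def2) (auto simp: measure_distr vimage_def Int_def conj_commute intro!: arg_cong[of _ _ "measure (M n)"])
  have lim: "(\<lambda>n. measure (M n) {w \<in> space (M n). T n w \<le> s}) \<longlonglongrightarrow> cdf \<nu> s" for s
    using conv cont unfolding weak_conv_m_def weak_conv_def cdfT by blast
  show "(\<lambda>n. measure (M n) {w \<in> space (M n). W n w \<le> ereal t}) \<longlonglongrightarrow> cdf \<nu> t"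
  proof (rule LIMSEQ_I)
    fix r :: real assume r: "0 < r"
    obtain d where d: "0 < d" "\<And>s. \<bar>s - t\<bar> < d \<Longrightarrow> \<bar>cdf \<nu> s - cdf \<nu> t\<bar> < r / 3"
    proof -
      have "0 < r / 3" using r by simp
      with cont[of t] show ?thesis
        unfolding continuous_at_eps_delta dist_real_def using that by blast
    qed
    define \<epsilon> where "\<epsilon> = d / 2"
    have \<epsilon>: "0 < \<epsilon>" "\<epsilon> < d" using d by (auto simp: \<epsilon>_def)
    obtain A where A: "\<And>n. A n \<in> sets (M n)" "\<And>n w. w \<in> A n \<Longrightarrow> \<exists>r. W n w = ereal r \<and> \<bar>r - T n w\<bar> \<le> \<epsilon>"
      "\<forall>\<^sub>F n in sequentially. 1 - r / 3 \<le> measure (M n) (A n)"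
      using close[OF \<epsilon>(1), of "r / 3"] r unfolding likely_def by auto
    have up: "\<forall>\<^sub>F n in sequentially. measure (M n) {w \<in> space (M n). T n w \<le> t + \<epsilon>} < cdf \<nu> (t + \<epsilon>) + r / 3"
      using r by (intro order_tendstoD(2)[OF lim]) simp
    have lo: "\<forall>\<^sub>F n in sequentially. cdf \<nu> (t - \<epsilon>) - r / 3 < measure (M n) {w \<in> space (M n). T n w \<le> t - \<epsilon>}"
      using r by (intro order_tendstoD(1)[OF lim]) simp
    have "\<forall>\<^sub>F n in sequentially. norm (measure (M n) {w \<in> space (M n). W n w \<le> ereal t} - cdf \<nu> t) < r"
      using up lo A(3)
    proof eventually_elim
      case (elim n)
      interpret prob_space "M n" by (rule M)
      note [measurable] = W[of n] T[of n] A(1)[of n]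
      let ?W = "{w \<in> space (M n). W n w \<le> ereal t}"
      have c: "prob (space (M n) - A n) \<le> r / 3" using elim prob_compl[OF A(1)[of n]] by simp
      have "prob ?W \<le> prob ({w \<in> space (M n). T n w \<le> t + \<epsilon>} \<union> (space (M n) - A n))"
      proof (rule finite_measure_mono)
        show "?W \<subseteq> {w \<in> space (M n). T n w \<le> t + \<epsilon>} \<union> (space (M n) - A n)"
        proof
          fix w assume w: "w \<in> ?W"
          show "w \<in> {w \<in> space (M n). T n w \<le> t + \<epsilon>} \<union> (space (M n) - A n)"
          proof (cases "w \<in> A n")
            case True
            then obtain r where "W n w = ereal r" "\<bar>r - T n w\<bar> \<le> \<epsilon>" using A(2) by blast
            then show ?thesis using w by auto
          qed (use w in auto)
        qed
      qed measurable
      also have "\<dots> \<le> prob {w \<in> space (M n). T n w \<le> t + \<epsilon>} + prob (space (M n) - A n)"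
        by (rule measure_Un_le) measurable
      finally have 1: "prob ?W < cdf \<nu> (t + \<epsilon>) + 2 * r / 3" using elim c by linarith
      have "prob {w \<in> space (M n). T n w \<le> t - \<epsilon>} \<le> prob (?W \<union> (space (M n) - A n))"
      proof (rule finite_measure_mono)
        show "{w \<in> space (M n). T n w \<le> t - \<epsilon>} \<subseteq> ?W \<union> (space (M n) - A n)"
        proof
          fix w assume w: "w \<in> {w \<in> space (M n). T n w \<le> t - \<epsilon>}"
          show "w \<in> ?W \<union> (space (M n) - A n)"
          proof (cases "w \<in> A n")
            case True
            then obtain r where "W n w = ereal r" "\<bar>r - T n w\<bar> \<le> \<epsilon>" using A(2) by blast
            then show ?thesis using w by auto
          qed (use w in auto)
        qed
      qed measurable
      also have "\<dots> \<le> prob ?W + prob (space (M n) - A n)"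
        by (rule measure_Un_le) measurable
      finally have 2: "cdf \<nu> (t - \<epsilon>) - 2 * r / 3 < prob ?W" using elim c by linarith
      have "\<bar>cdf \<nu> (t + \<epsilon>) - cdf \<nu> t\<bar> < r / 3" "\<bar>cdf \<nu> (t - \<epsilon>) - cdf \<nu> t\<bar> < r / 3"
        using d(2)[of "t + \<epsilon>"] d(2)[of "t - \<epsilon>"] \<epsilon> by auto
      then show ?case using 1 2 unfolding real_norm_def by linarith
    qed
    then show "\<exists>n0. \<forall>n\<ge>n0. norm (measure (M n) {w \<in> space (M n). W n w \<le> ereal t} - cdf \<nu> t) < r"
      by (simp add: eventually_sequentially)
  qed
qed

section \<open>Limit theorems for a standardized array\<close>

lemma abs_add_powr_le:
  fixes u v p :: real
  assumes "0 \<le> p"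
  shows "\<bar>u + v\<bar> powr p \<le> 2 powr p * (\<bar>u\<bar> powr p + \<bar>v\<bar> powr p)"
proof -
  have "\<bar>u + v\<bar> powr p \<le> (2 * max \<bar>u\<bar> \<bar>v\<bar>) powr p" using assms by (intro powr_mono2) auto
  also have "\<dots> = 2 powr p * max \<bar>u\<bar> \<bar>v\<bar> powr p" by (intro powr_mult)
  also have "\<dots> \<le> 2 powr p * (\<bar>u\<bar> powr p + \<bar>v\<bar> powr p)"
    by (intro mult_left_mono) (auto simp: max_def)
  finally show ?thesis .
qed

text \<open>First the truncation level makes the part uniform in n small, then n makes the rest
  small at that fixed level.\<close>

lemma LIMSEQ_zero_by_truncation:
  fixes f :: "nat \<Rightarrow> real" and h :: "real \<Rightarrow> real"
  assumes nn: "\<And>n. 0 \<le> f n" and h: "(h \<longlongrightarrow> 0) (at_right 0)"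
    and g: "\<And>\<epsilon>. 0 < \<epsilon> \<Longrightarrow> g \<epsilon> \<longlonglongrightarrow> 0"
    and le: "\<And>\<epsilon>. 0 < \<epsilon> \<Longrightarrow> \<forall>\<^sub>F n in sequentially. f n \<le> h \<epsilon> + g \<epsilon> n"
  shows "f \<longlonglongrightarrow> 0"
proof (rule order_tendstoI)
  fix r :: real assume r: "0 < r"
  have "\<forall>\<^sub>F \<epsilon> in at_right 0. h \<epsilon> < r / 2 \<and> 0 < \<epsilon>"
    using order_tendstoD(2)[OF h, of "r / 2"] r by (simp add: eventually_conj_iff eventually_at_right_less)
  from eventually_happens'[OF trivial_limit_at_right_real this]
  obtain \<epsilon> where e: "h \<epsilon> < r / 2" "0 < \<epsilon>" by blast
  have "\<forall>\<^sub>F n in sequentially. g \<epsilon> n < r / 2"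
    using r by (intro order_tendstoD(2)[OF g[OF e(2)]]) simp
  then show "\<forall>\<^sub>F n in sequentially. f n < r"
    using le[OF e(2)]
  proof eventually_elim
    case (elim n)
    then show ?case using e by linarith
  qed
qed (auto intro!: always_eventually less_le_trans[OF _ nn])

lemma integrable_mult_of_squares:
  fixes f g :: "'a \<Rightarrow> real"
  assumes [measurable]: "f \<in> borel_measurable M" "g \<in> borel_measurable M"
    and "integrable M (\<lambda>x. (f x)\<^sup>2)" "integrable M (\<lambda>x. (g x)\<^sup>2)"
  shows "integrable M (\<lambda>x. f x * g x)"
proof (rule Bochner_Integration.integrable_bound[OF Bochner_Integration.integrable_add[OF assms(3,4)]])
  have "\<bar>a * b\<bar> \<le> a\<^sup>2 + b\<^sup>2" for a b :: real
    using two_abs_mult_le_squares[of a b] abs_ge_zero[of "a * b"] by linarith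
  then show "AE x in M. norm (f x * g x) \<le> norm ((f x)\<^sup>2 + (g x)\<^sup>2)" by simp
qed measurable

text \<open>Assumption \<open>row\<close> expresses that the pairs are i.i.d. through all real
  functions of a pair, so that rows of real variables cover linear combinations, squares and
  products alike.\<close>

locale standardized_array =
  fixes M :: "nat \<Rightarrow> 'a measure" and N :: "nat \<Rightarrow> nat" and A B :: "nat \<Rightarrow> nat \<Rightarrow> 'a \<Rightarrow> real" and \<delta> :: real
  assumes prob: "prob_space (M n)"
    and N_at_top: "filterlim N at_top sequentially"
    and row: "g \<in> borel_measurable borel \<Longrightarrow> iid_row (M n) (N n) (\<lambda>i w. g (A n i w, B n i w))"
    and delta: "0 < \<delta>"
    and mean: "(\<integral>w. A n 1 w \<partial>M n) = 0" "(\<integral>w. B n 1 w \<partial>M n) = 0"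
    and int2: "integrable (M n) (\<lambda>w. (A n 1 w)\<^sup>2)" "integrable (M n) (\<lambda>w. (B n 1 w)\<^sup>2)"
    and var: "(\<integral>w. (A n 1 w)\<^sup>2 \<partial>M n) = 1" "(\<integral>w. (B n 1 w)\<^sup>2 \<partial>M n) = 1"
    and cov: "(\<integral>w. A n 1 w * B n 1 w \<partial>M n) = 0"
    and intd: "integrable (M n) (\<lambda>w. \<bar>A n 1 w\<bar> powr (2 + \<delta>))" "integrable (M n) (\<lambda>w. \<bar>B n 1 w\<bar> powr (2 + \<delta>))"
    and lyapunov: "(\<lambda>n. (\<integral>w. \<bar>A n 1 w\<bar> powr (2 + \<delta>) \<partial>M n) / N n powr (\<delta> / 2)) \<longlonglongrightarrow> 0"
      "(\<lambda>n. (\<integral>w. \<bar>B n 1 w\<bar> powr (2 + \<delta>) \<partial>M n) / N n powr (\<delta> / 2)) \<longlonglongrightarrow> 0"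
begin

lemma rowA: "iid_row (M n) (N n) (A n)" and rowB: "iid_row (M n) (N n) (B n)"
proof -
  have "fst \<in> borel_measurable (borel :: (real \<times> real) measure)" "snd \<in> borel_measurable (borel :: (real \<times> real) measure)"
    by (intro borel_measurable_continuous_onI continuous_intros)+
  then show "iid_row (M n) (N n) (A n)" "iid_row (M n) (N n) (B n)"
    using row[of fst n] row[of snd n] by simp_all
qed

lemma N_pos: "0 < N n"
  using rowA[of n] by (rule iid_row.N)

lemma measurable_AB: "i \<in> {1..N n} \<Longrightarrow> A n i \<in> borel_measurable (M n)" "i \<in> {1..N n} \<Longrightarrow> B n i \<in> borel_measurable (M n)"
  using rowA[of n] rowB[of n] by (auto dest: iid_row.Z_measurable)

lemma measurable_AB1 [measurable]: "A n 1 \<in> borel_measurable (M n)" "B n 1 \<in> borel_measurable (M n)"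
  "A n (Suc 0) \<in> borel_measurable (M n)" "B n (Suc 0) \<in> borel_measurable (M n)"
  using measurable_AB[of 1 n] N_pos[of n] by simp_all

lemma integrable_AB1: "integrable (M n) (A n 1)" "integrable (M n) (B n 1)" "integrable (M n) (\<lambda>w. A n 1 w * B n 1 w)"
proof -
  interpret prob_space "M n" by (rule prob)
  show "integrable (M n) (A n 1)" by (rule square_integrable_imp_integrable[OF _ int2(1)]) measurable
  show "integrable (M n) (B n 1)" by (rule square_integrable_imp_integrable[OF _ int2(2)]) measurable
  show "integrable (M n) (\<lambda>w. A n 1 w * B n 1 w)"
    by (rule integrable_mult_of_squares[OF _ _ int2]) measurable
qed

lemma N_sqrt_at_top: "filterlim (\<lambda>n. sqrt (N n)) at_top sequentially"
  by (rule filterlim_compose[OF sqrt_at_top filterlim_compose[OF filterlim_real_sequentially N_at_top]])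

lemma eventually_N_ge: "\<forall>\<^sub>F n in sequentially. c \<le> real (N n)" for c :: real
  using filterlim_compose[OF filterlim_real_sequentially N_at_top] by (simp add: filterlim_at_top)

text \<open>By unit variances and zero covariance a linear combination has variance s = a^2 + b^2,
  the same in every row, and it inherits Lyapunov's condition from its parts. The comparison
  sequence (1 - s/(2N))^N tends to exp (-s/2).\<close>

lemma char_limit:
  "(\<lambda>n. char (distr (M n) borel (\<lambda>w. a * ((\<Sum>i=1..N n. A n i w) / sqrt (N n)) + b * ((\<Sum>i=1..N n. B n i w) / sqrt (N n)))) 1)
    \<longlonglongrightarrow> complex_of_real (exp (- (a\<^sup>2 + b\<^sup>2) / 2))"
proof -
  define s where "s = a\<^sup>2 + b\<^sup>2"
  define Z where "Z n i w = a * A n i w + b * B n i w" for n i w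
  define p where "p = 2 + \<delta>"
  define ch where "ch n = char (distr (M n) borel (\<lambda>w. (\<Sum>i=1..N n. Z n i w) / sqrt (N n))) 1" for n
  define q where "q n = complex_of_real ((1 + (- s / 2) / N n) ^ N n)" for n
  define \<rho> where "\<rho> n = 2 powr p * (\<bar>a\<bar> powr p * ((\<integral>w. \<bar>A n 1 w\<bar> powr p \<partial>M n) / N n powr (\<delta> / 2))
     + \<bar>b\<bar> powr p * ((\<integral>w. \<bar>B n 1 w\<bar> powr p \<partial>M n) / N n powr (\<delta> / 2)))" for n
  have s0: "0 \<le> s" by (simp add: s_def)
  have p: "0 \<le> p" using delta by (simp add: p_def)
  have rlim: "\<rho> \<longlonglongrightarrow> 0"
  proof -
    have "\<rho> \<longlonglongrightarrow> 2 powr p * (\<bar>a\<bar> powr p * 0 + \<bar>b\<bar> powr p * 0)"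
      unfolding \<rho>_def p_def by (intro tendsto_intros lyapunov)
    then show ?thesis by simp
  qed
  have bound: "cmod (ch n - q n) \<le> \<epsilon> * s / 6 + \<rho> n / \<epsilon> powr \<delta>" if e: "0 < \<epsilon>" and n: "s / 4 \<le> N n" for \<epsilon> n
  proof -
    interpret Z: iid_row "M n" "N n" "Z n"
    proof -
      have "(\<lambda>z. a * fst z + b * snd z) \<in> borel_measurable (borel :: (real \<times> real) measure)"
        by (intro borel_measurable_continuous_onI continuous_intros)
      from row[OF this, of n] show "iid_row (M n) (N n) (Z n)" by (simp add: Z_def[abs_def])
    qed
    have pw: "\<bar>Z n 1 w\<bar> powr p \<le> 2 powr p * (\<bar>a\<bar> powr p * \<bar>A n 1 w\<bar> powr p + \<bar>b\<bar> powr p * \<bar>B n 1 w\<bar> powr p)" for w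
      using abs_add_powr_le[OF p, of "a * A n 1 w" "b * B n 1 w"] by (simp add: Z_def abs_mult powr_mult)
    have intR: "integrable (M n) (\<lambda>w. 2 powr p * (\<bar>a\<bar> powr p * \<bar>A n 1 w\<bar> powr p + \<bar>b\<bar> powr p * \<bar>B n 1 w\<bar> powr p))"
      using intd[of n] by (simp add: p_def)
    have intZp: "integrable (M n) (\<lambda>w. \<bar>Z n 1 w\<bar> powr p)"
    proof (rule Bochner_Integration.integrable_bound[OF intR])
      show "AE w in M n. norm (\<bar>Z n 1 w\<bar> powr p) \<le> norm (2 powr p * (\<bar>a\<bar> powr p * \<bar>A n 1 w\<bar> powr p + \<bar>b\<bar> powr p * \<bar>B n 1 w\<bar> powr p))"
        using pw by (auto intro: order_trans[OF _ abs_ge_self])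
    qed measurable
    have sqZ: "(Z n 1 w)\<^sup>2 = a\<^sup>2 * (A n 1 w)\<^sup>2 + b\<^sup>2 * (B n 1 w)\<^sup>2 + 2 * a * b * (A n 1 w * B n 1 w)" for w
      by (simp add: Z_def power2_eq_square algebra_simps)
    have intZ2: "integrable (M n) (\<lambda>w. (Z n 1 w)\<^sup>2)"
      unfolding sqZ using int2[of n] integrable_AB1[of n] by simp
    have "(\<integral>w. (Z n 1 w)\<^sup>2 \<partial>M n) = a\<^sup>2 * (\<integral>w. (A n 1 w)\<^sup>2 \<partial>M n) + b\<^sup>2 * (\<integral>w. (B n 1 w)\<^sup>2 \<partial>M n)
        + 2 * a * b * (\<integral>w. A n 1 w * B n 1 w \<partial>M n)"
      unfolding sqZ using int2[of n] integrable_AB1[of n] by simp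
    then have EZ2: "(\<integral>w. (Z n 1 w)\<^sup>2 \<partial>M n) = s" unfolding var cov s_def by simp
    have "(\<integral>w. Z n 1 w \<partial>M n) = a * (\<integral>w. A n 1 w \<partial>M n) + b * (\<integral>w. B n 1 w \<partial>M n)"
      unfolding Z_def using integrable_AB1[of n] by simp
    then have EZ: "(\<integral>w. Z n 1 w \<partial>M n) = 0" unfolding mean by simp
    have "cmod (ch n - q n) \<le> \<epsilon> * s / 6 + (\<integral>w. \<bar>Z n 1 w\<bar> powr p \<partial>M n) / N n powr (\<delta> / 2) / \<epsilon> powr \<delta>"
      unfolding ch_def q_def p_def by (rule Z.char_sum_approx[OF delta e intZ2 EZ intZp[unfolded p_def] EZ2 n])
    also have "\<dots> \<le> \<epsilon> * s / 6 + \<rho> n / \<epsilon> powr \<delta>"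
    proof (intro add_left_mono divide_right_mono)
      have "(\<integral>w. \<bar>Z n 1 w\<bar> powr p \<partial>M n) \<le> (\<integral>w. 2 powr p * (\<bar>a\<bar> powr p * \<bar>A n 1 w\<bar> powr p + \<bar>b\<bar> powr p * \<bar>B n 1 w\<bar> powr p) \<partial>M n)"
        by (rule integral_mono[OF intZp intR pw])
      also have "\<dots> = 2 powr p * (\<bar>a\<bar> powr p * (\<integral>w. \<bar>A n 1 w\<bar> powr p \<partial>M n) + \<bar>b\<bar> powr p * (\<integral>w. \<bar>B n 1 w\<bar> powr p \<partial>M n))"
        using intd[of n] by (simp add: p_def)
      finally have "(\<integral>w. \<bar>Z n 1 w\<bar> powr p \<partial>M n) / N n powr (\<delta> / 2)
         \<le> 2 powr p * (\<bar>a\<bar> powr p * (\<integral>w. \<bar>A n 1 w\<bar> powr p \<partial>M n) + \<bar>b\<bar> powr p * (\<integral>w. \<bar>B n 1 w\<bar> powr p \<partial>M n)) / N n powr (\<delta> / 2)"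
        by (rule divide_right_mono) simp
      then show "(\<integral>w. \<bar>Z n 1 w\<bar> powr p \<partial>M n) / N n powr (\<delta> / 2) \<le> \<rho> n"
        by (simp add: \<rho>_def add_divide_distrib distrib_left)
    qed simp
    finally show ?thesis .
  qed
  have "(\<lambda>n. cmod (ch n - q n)) \<longlonglongrightarrow> 0"
  proof (rule LIMSEQ_zero_by_truncation[where h="\<lambda>\<epsilon>. \<epsilon> * s / 6" and g="\<lambda>\<epsilon> n. \<rho> n / \<epsilon> powr \<delta>"])
    have "((\<lambda>\<epsilon>. \<epsilon> * s / 6) \<longlongrightarrow> 0 * s / 6) (at_right 0)" by (intro tendsto_intros) auto
    then show "((\<lambda>\<epsilon>. \<epsilon> * s / 6) \<longlongrightarrow> 0) (at_right 0)" by simp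
    fix \<epsilon> :: real assume e: "0 < \<epsilon>"
    show "(\<lambda>n. \<rho> n / \<epsilon> powr \<delta>) \<longlonglongrightarrow> 0" using e by (intro tendsto_divide_zero rlim)
    show "\<forall>\<^sub>F n in sequentially. cmod (ch n - q n) \<le> \<epsilon> * s / 6 + \<rho> n / \<epsilon> powr \<delta>"
      using eventually_N_ge[of "s / 4"] by eventually_elim (rule bound[OF e])
  qed simp
  then have d: "(\<lambda>n. ch n - q n) \<longlonglongrightarrow> 0" by (simp only: tendsto_norm_zero_iff)
  have "(\<lambda>k. complex_of_real ((1 + (- s / 2) / real k) ^ k)) \<longlonglongrightarrow> complex_of_real (exp (- s / 2))"
    by (intro tendsto_of_real tendsto_exp_limit_sequentially)
  then have "q \<longlonglongrightarrow> complex_of_real (exp (- s / 2))"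
    unfolding q_def by (rule filterlim_compose) (rule N_at_top)
  from tendsto_add[OF d this] have "ch \<longlonglongrightarrow> complex_of_real (exp (- s / 2))" by simp
  moreover have "a * ((\<Sum>i=1..N n. A n i w) / sqrt (N n)) + b * ((\<Sum>i=1..N n. B n i w) / sqrt (N n))
     = (\<Sum>i=1..N n. Z n i w) / sqrt (N n)" for n w
    by (simp add: Z_def sum.distrib sum_distrib_left add_divide_distrib)
  ultimately show ?thesis by (simp add: ch_def[abs_def] s_def)
qed

text \<open>A function of quadratic growth has a moment of order 1 + \<delta>/2 bounded by the 2 +
  \<delta> moments of the pair, and its first absolute moment is at most 1 + 1 = 2 in every row. So
  the L1 bound by truncation is uniform.\<close>

lemma weak_law:
  assumes g: "g \<in> borel_measurable borel"
    and ge: "\<And>a b. \<bar>g (a, b)\<bar> \<le> a\<^sup>2 + b\<^sup>2"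
    and gp: "\<And>a b. \<bar>g (a, b)\<bar> powr (1 + \<delta> / 2) \<le> \<bar>a\<bar> powr (2 + \<delta>) + \<bar>b\<bar> powr (2 + \<delta>)"
    and c: "\<And>n. (\<integral>w. g (A n 1 w, B n 1 w) \<partial>M n) = c" and \<eta>: "0 < \<eta>"
  shows "whp M (\<lambda>n w. \<bar>(\<Sum>i=1..N n. g (A n i w, B n i w)) / N n - c\<bar> \<le> \<eta>)"
proof (rule whp_of_expectation[OF prob])
  define r where "r = \<delta> / 2"
  have r: "0 < r" using delta by (simp add: r_def)
  define D where "D n i w = g (A n i w, B n i w)" for n i w
  define \<rho> where "\<rho> n = (\<integral>w. \<bar>A n 1 w\<bar> powr (2 + \<delta>) \<partial>M n) / N n powr r + (\<integral>w. \<bar>B n 1 w\<bar> powr (2 + \<delta>) \<partial>M n) / N n powr r" for n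
  have rlim: "\<rho> \<longlonglongrightarrow> 0"
    using tendsto_add[OF lyapunov] by (simp add: \<rho>_def[abs_def] r_def)
  have rowD: "iid_row (M n) (N n) (D n)" for n
    using row[OF g, of n] by (simp add: D_def[abs_def])
  have Dm[measurable]: "D n 1 \<in> borel_measurable (M n)" for n by (rule iid_row.Z1_measurable[OF rowD])
  have intD: "integrable (M n) (D n 1)" for n
    by (rule Bochner_Integration.integrable_bound[OF Bochner_Integration.integrable_add[OF int2] Dm])
      (use ge in \<open>auto simp: D_def intro: order_trans[OF _ abs_ge_self]\<close>)
  have ED: "(\<integral>w. \<bar>D n 1 w\<bar> \<partial>M n) \<le> 2" for n
  proof -
    have "(\<integral>w. \<bar>D n 1 w\<bar> \<partial>M n) \<le> (\<integral>w. (A n 1 w)\<^sup>2 + (B n 1 w)\<^sup>2 \<partial>M n)"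
      by (rule integral_mono[OF integrable_abs[OF intD] Bochner_Integration.integrable_add[OF int2]])
        (simp only: D_def ge)
    also have "\<dots> = 2" using int2[of n] var[of n] by simp
    finally show ?thesis .
  qed
  have intDr: "integrable (M n) (\<lambda>w. \<bar>D n 1 w\<bar> powr (1 + r))" for n
  proof (rule Bochner_Integration.integrable_bound[OF Bochner_Integration.integrable_add[OF intd]])
    show "AE w in M n. norm (\<bar>D n 1 w\<bar> powr (1 + r)) \<le> norm (\<bar>A n 1 w\<bar> powr (2 + \<delta>) + \<bar>B n 1 w\<bar> powr (2 + \<delta>))"
      using gp by (auto simp: D_def r_def intro: order_trans[OF _ abs_ge_self])
  qed measurable
  have EDr: "(\<integral>w. \<bar>D n 1 w\<bar> powr (1 + r) \<partial>M n) / N n powr r \<le> \<rho> n" for n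
  proof -
    have "(\<integral>w. \<bar>D n 1 w\<bar> powr (1 + r) \<partial>M n) \<le> (\<integral>w. \<bar>A n 1 w\<bar> powr (2 + \<delta>) + \<bar>B n 1 w\<bar> powr (2 + \<delta>) \<partial>M n)"
      using gp by (intro integral_mono intDr Bochner_Integration.integrable_add intd) (simp add: D_def r_def)
    also have "\<dots> = (\<integral>w. \<bar>A n 1 w\<bar> powr (2 + \<delta>) \<partial>M n) + (\<integral>w. \<bar>B n 1 w\<bar> powr (2 + \<delta>) \<partial>M n)"
      by (rule Bochner_Integration.integral_add[OF intd])
    finally have "(\<integral>w. \<bar>D n 1 w\<bar> powr (1 + r) \<partial>M n) / N n powr r \<le>
      ((\<integral>w. \<bar>A n 1 w\<bar> powr (2 + \<delta>) \<partial>M n) + (\<integral>w. \<bar>B n 1 w\<bar> powr (2 + \<delta>) \<partial>M n)) / N n powr r"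
      by (rule divide_right_mono) simp
    then show ?thesis by (simp add: \<rho>_def add_divide_distrib)
  qed
  have c': "(\<integral>w. D n 1 w \<partial>M n) = c" for n using c by (simp add: D_def)
  have law: "integrable (M n) (\<lambda>w. \<bar>(\<Sum>i=1..N n. D n i w) / N n - c\<bar>)"
    "(\<integral>w. \<bar>(\<Sum>i=1..N n. D n i w) / N n - c\<bar> \<partial>M n)
    \<le> 2 * ((\<integral>w. \<bar>D n 1 w\<bar> powr (1 + r) \<partial>M n) / N n powr r / \<epsilon> powr r) + sqrt (\<epsilon> * (\<integral>w. \<bar>D n 1 w\<bar> \<partial>M n))"
    if "0 < \<epsilon>" for \<epsilon> n
    using iid_row.weak_law_bound[OF rowD[of n] r that intD intDr] by (simp_all only: c')
  show "integrable (M n) (\<lambda>w. \<bar>(\<Sum>i=1..N n. g (A n i w, B n i w)) / N n - c\<bar>)" for n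
    using law(1)[of 1 n] by (simp add: D_def[abs_def])
  have "(\<lambda>n. \<integral>w. \<bar>(\<Sum>i=1..N n. D n i w) / N n - c\<bar> \<partial>M n) \<longlonglongrightarrow> 0"
  proof (rule LIMSEQ_zero_by_truncation[where h="\<lambda>\<epsilon>. sqrt (\<epsilon> * 2)" and g="\<lambda>\<epsilon> n. 2 * (\<rho> n / \<epsilon> powr r)"])
    have "((\<lambda>\<epsilon>. sqrt (\<epsilon> * 2)) \<longlongrightarrow> sqrt (0 * 2)) (at_right 0)" by (intro tendsto_intros)
    then show "((\<lambda>\<epsilon>. sqrt (\<epsilon> * 2)) \<longlongrightarrow> 0) (at_right 0)" by simp
    fix \<epsilon> :: real assume e: "0 < \<epsilon>"
    show "(\<lambda>n. 2 * (\<rho> n / \<epsilon> powr r)) \<longlonglongrightarrow> 0" by (intro tendsto_mult_right_zero tendsto_divide_zero rlim)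
    show "\<forall>\<^sub>F n in sequentially. (\<integral>w. \<bar>(\<Sum>i=1..N n. D n i w) / N n - c\<bar> \<partial>M n) \<le> sqrt (\<epsilon> * 2) + 2 * (\<rho> n / \<epsilon> powr r)"
    proof (rule always_eventually, rule allI)
      fix n
      have "(\<integral>w. \<bar>D n 1 w\<bar> powr (1 + r) \<partial>M n) / N n powr r / \<epsilon> powr r \<le> \<rho> n / \<epsilon> powr r"
        using EDr[of n] by (rule divide_right_mono) simp
      moreover have "sqrt (\<epsilon> * (\<integral>w. \<bar>D n 1 w\<bar> \<partial>M n)) \<le> sqrt (\<epsilon> * 2)"
        using ED[of n] e by (intro real_sqrt_le_mono mult_left_mono) auto
      ultimately show "(\<integral>w. \<bar>(\<Sum>i=1..N n. D n i w) / N n - c\<bar> \<partial>M n) \<le> sqrt (\<epsilon> * 2) + 2 * (\<rho> n / \<epsilon> powr r)"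
        using law(2)[OF e, of n] by linarith
    qed
  qed simp
  then show "(\<lambda>n. (\<integral>w. \<bar>(\<Sum>i=1..N n. g (A n i w, B n i w)) / N n - c\<bar> \<partial>M n) / \<eta>) \<longlonglongrightarrow> 0"
    unfolding D_def by (rule tendsto_divide_zero)
qed (use \<eta> in auto)

lemma square_powr: "(x\<^sup>2) powr (1 + \<delta> / 2) = \<bar>x\<bar> powr (2 + \<delta>)" for x :: real
proof -
  have "x\<^sup>2 = \<bar>x\<bar> powr 2" by simp
  then have "(x\<^sup>2) powr (1 + \<delta> / 2) = \<bar>x\<bar> powr (2 * (1 + \<delta> / 2))" by (simp only: powr_powr)
  also have "2 * (1 + \<delta> / 2) = 2 + \<delta>" by simp
  finally show ?thesis .
qed

lemma whp_second_moments:
  assumes \<eta>: "0 < \<eta>"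
  shows "whp M (\<lambda>n w. \<bar>(\<Sum>i=1..N n. (A n i w)\<^sup>2) / N n - 1\<bar> \<le> \<eta>)"
    and "whp M (\<lambda>n w. \<bar>(\<Sum>i=1..N n. (B n i w)\<^sup>2) / N n - 1\<bar> \<le> \<eta>)"
    and "whp M (\<lambda>n w. \<bar>(\<Sum>i=1..N n. A n i w * B n i w) / N n\<bar> \<le> \<eta>)"
proof -
  have m: "(\<lambda>z. (fst z)\<^sup>2) \<in> borel_measurable (borel :: (real \<times> real) measure)"
    "(\<lambda>z. (snd z)\<^sup>2) \<in> borel_measurable (borel :: (real \<times> real) measure)"
    "(\<lambda>z. fst z * snd z) \<in> borel_measurable (borel :: (real \<times> real) measure)"
    by (intro borel_measurable_continuous_onI continuous_intros)+
  have ab: "\<bar>a * b\<bar> \<le> max (a\<^sup>2) (b\<^sup>2)" for a b :: real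
    using two_abs_mult_le_squares[of a b] by linarith
  have ab1: "\<bar>a * b\<bar> \<le> a\<^sup>2 + b\<^sup>2" for a b :: real
    using ab[of a b] zero_le_power2[of a] zero_le_power2[of b] by linarith
  have abp: "\<bar>a * b\<bar> powr (1 + \<delta> / 2) \<le> \<bar>a\<bar> powr (2 + \<delta>) + \<bar>b\<bar> powr (2 + \<delta>)" for a b :: real
  proof -
    have "\<bar>a * b\<bar> powr (1 + \<delta> / 2) \<le> (max (a\<^sup>2) (b\<^sup>2)) powr (1 + \<delta> / 2)"
      using ab delta by (intro powr_mono2) auto
    also have "\<dots> \<le> (a\<^sup>2) powr (1 + \<delta> / 2) + (b\<^sup>2) powr (1 + \<delta> / 2)" by (simp add: max_def)
    finally show ?thesis by (simp only: square_powr)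
  qed
  show "whp M (\<lambda>n w. \<bar>(\<Sum>i=1..N n. (A n i w)\<^sup>2) / N n - 1\<bar> \<le> \<eta>)"
    using weak_law[OF m(1) _ _ _ \<eta>, of 1] var by (simp add: square_powr)
  show "whp M (\<lambda>n w. \<bar>(\<Sum>i=1..N n. (B n i w)\<^sup>2) / N n - 1\<bar> \<le> \<eta>)"
    using weak_law[OF m(2) _ _ _ \<eta>, of 1] var by (simp add: square_powr)
  show "whp M (\<lambda>n w. \<bar>(\<Sum>i=1..N n. A n i w * B n i w) / N n\<bar> \<le> \<eta>)"
    using weak_law[OF m(3) _ _ _ \<eta>, of 0] cov ab1 abp by simp
qed

lemma whp_max:
  assumes \<eta>: "0 < \<eta>"
  shows "whp M (\<lambda>n w. \<forall>i\<in>{1..N n}. \<bar>A n i w\<bar> \<le> \<eta> * sqrt (N n))"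
    and "whp M (\<lambda>n w. \<forall>i\<in>{1..N n}. \<bar>B n i w\<bar> \<le> \<eta> * sqrt (N n))"
proof -
  have *: "whp M (\<lambda>n w. \<forall>i\<in>{1..N n}. \<bar>C n i w\<bar> \<le> \<eta> * sqrt (N n))"
    if rowC: "\<And>n. iid_row (M n) (N n) (C n)" and int: "\<And>n. integrable (M n) (\<lambda>w. \<bar>C n 1 w\<bar> powr (2 + \<delta>))"
      and lim: "(\<lambda>n. (\<integral>w. \<bar>C n 1 w\<bar> powr (2 + \<delta>) \<partial>M n) / N n powr (\<delta> / 2)) \<longlonglongrightarrow> 0"
    for C :: "nat \<Rightarrow> nat \<Rightarrow> 'a \<Rightarrow> real"
  proof (rule whp_compl[OF prob])
    fix n
    have eq: "{w \<in> space (M n). \<not> (\<forall>i\<in>{1..N n}. \<bar>C n i w\<bar> \<le> \<eta> * sqrt (N n))}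
       = {w \<in> space (M n). \<exists>i\<in>{1..N n}. \<eta> * sqrt (N n) < \<bar>C n i w\<bar>}" by (auto simp: not_le)
    show "measure (M n) {w \<in> space (M n). \<not> (\<forall>i\<in>{1..N n}. \<bar>C n i w\<bar> \<le> \<eta> * sqrt (N n))}
       \<le> (\<integral>w. \<bar>C n 1 w\<bar> powr (2 + \<delta>) \<partial>M n) / N n powr (\<delta> / 2) / \<eta> powr (2 + \<delta>)"
      unfolding eq by (rule iid_row.prob_max_le[OF rowC delta int \<eta>])
    have "{w \<in> space (M n). \<eta> * sqrt (N n) < \<bar>C n i w\<bar>} \<in> sets (M n)" if "i \<in> {1..N n}" for i
    proof -
      note [measurable] = iid_row.Z_measurable[OF rowC that]
      show ?thesis by measurable
    qed
    then show "{w \<in> space (M n). \<not> (\<forall>i\<in>{1..N n}. \<bar>C n i w\<bar> \<le> \<eta> * sqrt (N n))} \<in> sets (M n)"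
      unfolding eq by (intro sets.sets_Collect_finite_Ex) auto
  qed (rule tendsto_divide_zero[OF lim])
  show "whp M (\<lambda>n w. \<forall>i\<in>{1..N n}. \<bar>A n i w\<bar> \<le> \<eta> * sqrt (N n))" by (rule *[OF rowA intd(1) lyapunov(1)])
  show "whp M (\<lambda>n w. \<forall>i\<in>{1..N n}. \<bar>B n i w\<bar> \<le> \<eta> * sqrt (N n))" by (rule *[OF rowB intd(2) lyapunov(2)])
qed

text \<open>Chebyshev's inequality with variance 1. For fixed K the probability does not tend to 1,
  hence \<open>likely\<close> and not \<open>whp\<close>.\<close>

lemma likely_mean_bounded:
  assumes K: "0 < K"
  shows "likely M (1 / K\<^sup>2) (\<lambda>n w. \<bar>(\<Sum>i=1..N n. A n i w) / sqrt (N n)\<bar> \<le> K)"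
    and "likely M (1 / K\<^sup>2) (\<lambda>n w. \<bar>(\<Sum>i=1..N n. B n i w) / sqrt (N n)\<bar> \<le> K)"
proof -
  have *: "likely M (1 / K\<^sup>2) (\<lambda>n w. \<bar>(\<Sum>i=1..N n. C n i w) / sqrt (N n)\<bar> \<le> K)"
    if rowC: "\<And>n. iid_row (M n) (N n) (C n)" and int: "\<And>n. integrable (M n) (\<lambda>w. (C n 1 w)\<^sup>2)"
      and m: "\<And>n. (\<integral>w. C n 1 w \<partial>M n) = 0" and v: "\<And>n. (\<integral>w. (C n 1 w)\<^sup>2 \<partial>M n) = 1"
    for C :: "nat \<Rightarrow> nat \<Rightarrow> 'a \<Rightarrow> real"
  proof (rule likely_compl[OF prob])
    fix n
    have [measurable]: "(\<lambda>w. \<Sum>i=1..N n. C n i w) \<in> borel_measurable (M n)"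
      by (rule borel_measurable_sum) (rule iid_row.Z_measurable[OF rowC])
    show "{w \<in> space (M n). \<not> \<bar>(\<Sum>i=1..N n. C n i w) / sqrt (N n)\<bar> \<le> K} \<in> sets (M n)" by measurable
  next
    show "\<forall>\<^sub>F n in sequentially. measure (M n) {w \<in> space (M n). \<not> \<bar>(\<Sum>i=1..N n. C n i w) / sqrt (N n)\<bar> \<le> K} \<le> 1 / K\<^sup>2"
    proof (rule always_eventually, rule allI)
      fix n
      interpret prob_space "M n" by (rule prob)
      have [measurable]: "(\<lambda>w. \<Sum>i=1..N n. C n i w) \<in> borel_measurable (M n)"
        by (rule borel_measurable_sum) (rule iid_row.Z_measurable[OF rowC])
      note sq = iid_row.expectation_sum_square[OF rowC[of n] int[of n] m[of n], unfolded v]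
      have Kn: "0 < K\<^sup>2 * N n" using K N_pos[of n] by simp
      have "prob {w \<in> space (M n). \<not> \<bar>(\<Sum>i=1..N n. C n i w) / sqrt (N n)\<bar> \<le> K}
        \<le> prob {w \<in> space (M n). K\<^sup>2 * N n \<le> (\<Sum>i=1..N n. C n i w)\<^sup>2}"
      proof (rule finite_measure_mono)
        show "{w \<in> space (M n). \<not> \<bar>(\<Sum>i=1..N n. C n i w) / sqrt (N n)\<bar> \<le> K}
           \<subseteq> {w \<in> space (M n). K\<^sup>2 * N n \<le> (\<Sum>i=1..N n. C n i w)\<^sup>2}"
        proof safe
          fix w
          define S where "S = (\<Sum>i=1..N n. C n i w)"
          assume "\<not> \<bar>(\<Sum>i=1..N n. C n i w) / sqrt (N n)\<bar> \<le> K"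
          then have "K * sqrt (N n) \<le> \<bar>S\<bar>"
            using N_pos[of n] by (simp add: S_def abs_divide divide_le_eq not_le)
          then have "(K * sqrt (N n))\<^sup>2 \<le> \<bar>S\<bar>\<^sup>2" using K by (intro power_mono) auto
          then show "K\<^sup>2 * N n \<le> (\<Sum>i=1..N n. C n i w)\<^sup>2"
            unfolding S_def[symmetric] by (simp add: power_mult_distrib)
        qed
      qed measurable
      also have "\<dots> \<le> expectation (\<lambda>w. (\<Sum>i=1..N n. C n i w)\<^sup>2) / (K\<^sup>2 * N n)"
        by (rule integral_Markov_inequality_measure[OF sq(1), where A="{}"]) (use Kn in auto)
      also have "\<dots> = 1 / K\<^sup>2" unfolding sq(2) using N_pos[of n] by simp
      finally show "prob {w \<in> space (M n). \<not> \<bar>(\<Sum>i=1..N n. C n i w) / sqrt (N n)\<bar> \<le> K} \<le> 1 / K\<^sup>2" .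
    qed
  qed
  show "likely M (1 / K\<^sup>2) (\<lambda>n w. \<bar>(\<Sum>i=1..N n. A n i w) / sqrt (N n)\<bar> \<le> K)"
    by (rule *[OF rowA int2(1) mean(1) var(1)])
  show "likely M (1 / K\<^sup>2) (\<lambda>n w. \<bar>(\<Sum>i=1..N n. B n i w) / sqrt (N n)\<bar> \<le> K)"
    by (rule *[OF rowB int2(2) mean(2) var(2)])
qed

text \<open>The ratio is formed from the primed array, the limit from the standardized one; taking
  them equal gives the unperturbed case.\<close>

theorem wilks:
  fixes A' B' :: "nat \<Rightarrow> nat \<Rightarrow> 'a \<Rightarrow> real"
  assumes meas: "\<And>n i. i \<in> {1..N n} \<Longrightarrow> A' n i \<in> borel_measurable (M n)"
      "\<And>n i. i \<in> {1..N n} \<Longrightarrow> B' n i \<in> borel_measurable (M n)"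
    and dA: "\<And>\<epsilon>::real. 0 < \<epsilon> \<Longrightarrow> whp M (\<lambda>n w. sum_dev (N n) (\<lambda>i. A' n i w) (\<lambda>i. A n i w) \<le> \<epsilon> * N n)"
    and dB: "\<And>\<epsilon>::real. 0 < \<epsilon> \<Longrightarrow> whp M (\<lambda>n w. sum_dev (N n) (\<lambda>i. B' n i w) (\<lambda>i. B n i w) \<le> \<epsilon> * N n)"
  shows "weak_conv (\<lambda>n t. measure (M n) {w \<in> space (M n). neg2_log (el_ratio (N n) (\<lambda>i. (A' n i w, B' n i w))) \<le> ereal t})
    (cdf (chi_square 2))"
proof (rule weak_conv_slutsky)
  let ?T = "\<lambda>n w. norm_sq (N n) (\<lambda>i. A n i w) (\<lambda>i. B n i w)"
  show "prob_space (M n)" for n by (rule prob)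
  show "isCont (cdf (chi_square 2)) t" for t by (rule isCont_cdf_chi_square_2)
  have xy [measurable]: "(\<lambda>w. (\<Sum>i=1..N n. A n i w) / sqrt (N n)) \<in> borel_measurable (M n)"
    "(\<lambda>w. (\<Sum>i=1..N n. B n i w) / sqrt (N n)) \<in> borel_measurable (M n)" for n
    by (intro borel_measurable_divide borel_measurable_sum measurable_AB borel_measurable_const; assumption)+
  show "?T n \<in> borel_measurable (M n)" for n unfolding norm_sq_def by measurable
  show "weak_conv_m (\<lambda>n. distr (M n) borel (?T n)) (chi_square 2)"
    unfolding norm_sq_def by (rule weak_conv_chi_square_2[OF prob xy char_limit])
  show "(\<lambda>w. neg2_log (el_ratio (N n) (\<lambda>i. (A' n i w, B' n i w)))) \<in> borel_measurable (M n)" for n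
    by (rule measurable_compose[OF borel_measurable_el_ratio[OF meas] borel_measurable_neg2_log])
  fix \<epsilon> \<gamma> :: real assume \<epsilon>: "0 < \<epsilon>" and \<gamma>: "0 < \<gamma>"
  \<comment> \<open>Each of the two bounds on the normalized sums costs \<gamma>/4, and all
    remaining events together cost \<gamma>/2.\<close>
  define K where "K = sqrt (4 / \<gamma>)"
  have K: "0 < K" "1 / K\<^sup>2 = \<gamma> / 4" using \<gamma> by (auto simp: K_def)
  from el_ratio_perturbed_expansion[OF \<epsilon> K(1)]
  obtain \<theta> where \<theta>: "0 < \<theta>" and exp: "\<And>N A B A' B'. el_regular K \<theta> N A B \<Longrightarrow> K + 1 \<le> \<theta> * sqrt N \<Longrightarrow>
    sum_dev N A' A \<le> \<theta>\<^sup>2 * N \<Longrightarrow> sum_dev N B' B \<le> \<theta>\<^sup>2 * N \<Longrightarrow>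
    \<exists>r. neg2_log (el_ratio N (\<lambda>i. (A' i, B' i))) = ereal r \<and> \<bar>r - norm_sq N A B\<bar> \<le> \<epsilon>"
    by blast
  have \<theta>2: "0 < \<theta>\<^sup>2" using \<theta> by simp
  note good = whp_conj[OF prob whp_second_moments(1)[OF \<theta>] whp_conj[OF prob whp_second_moments(2)[OF \<theta>]
    whp_conj[OF prob whp_second_moments(3)[OF \<theta>] whp_conj[OF prob whp_max(1)[OF \<theta>] whp_conj[OF prob whp_max(2)[OF \<theta>]
    whp_conj[OF prob dA[OF \<theta>2] dB[OF \<theta>2]]]]]]]
  have "0 < \<gamma> / 2" using \<gamma> by simp
  note likely = likely_conj[OF prob likely_conj[OF prob likely_mean_bounded[OF K(1)]] good[unfolded whp_def, rule_format, OF this]]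
  have "1 / K\<^sup>2 + 1 / K\<^sup>2 + \<gamma> / 2 = \<gamma>" unfolding K by simp
  note likely = likely[unfolded this]
  have "\<forall>\<^sub>F n in sequentially. (K + 1) / \<theta> \<le> sqrt (N n)"
    using N_sqrt_at_top by (simp add: filterlim_at_top)
  note likely = likely_eventually[OF likely this]
  show "likely M \<gamma> (\<lambda>n w. \<exists>r. neg2_log (el_ratio (N n) (\<lambda>i. (A' n i w, B' n i w))) = ereal r \<and> \<bar>r - ?T n w\<bar> \<le> \<epsilon>)"
  proof (rule likely_mono[OF likely], elim conjE, rule exp)
    fix n assume "(K + 1) / \<theta> \<le> sqrt (N n)"
    then show KN: "K + 1 \<le> \<theta> * sqrt (N n)" using \<theta> by (simp add: divide_le_eq mult.commute)
    then have "K \<le> \<theta> * sqrt (N n)" by simp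
    then show "el_regular K \<theta> (N n) (\<lambda>i. A n i w) (\<lambda>i. B n i w)"
      if "\<bar>(\<Sum>i=1..N n. A n i w) / sqrt (N n)\<bar> \<le> K" "\<bar>(\<Sum>i=1..N n. B n i w) / sqrt (N n)\<bar> \<le> K"
        "\<bar>(\<Sum>i=1..N n. (A n i w)\<^sup>2) / N n - 1\<bar> \<le> \<theta>" "\<bar>(\<Sum>i=1..N n. (B n i w)\<^sup>2) / N n - 1\<bar> \<le> \<theta>"
        "\<bar>(\<Sum>i=1..N n. A n i w * B n i w) / N n\<bar> \<le> \<theta>"
        "\<forall>i\<in>{1..N n}. \<bar>A n i w\<bar> \<le> \<theta> * sqrt (N n)" "\<forall>i\<in>{1..N n}. \<bar>B n i w\<bar> \<le> \<theta> * sqrt (N n)" for w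
      unfolding el_regular_def using that N_pos by blast
  qed
qed

end

section \<open>The trace and total-sum statistics\<close>

text \<open>Only first moments of the features are assumed: they are products of two coordinates
  with finite second moments. Square integrability is available for the combined statistics
  alone.\<close>

locale centered_features = prob_space P for P :: "'x measure" +
  fixes J :: "'j set" and F :: "'j \<Rightarrow> 'x \<Rightarrow> real"
  assumes finite_J: "finite J"
    and integrable_F: "j \<in> J \<Longrightarrow> integrable P (F j)"
    and mean_F: "j \<in> J \<Longrightarrow> (\<integral>x. F j x \<partial>P) = 0"
begin

abbreviation PP :: "('x \<times> 'x) measure" where "PP \<equiv> P \<Otimes>\<^sub>M P"

sublocale pair: pair_prob_space P P ..

definition G :: "'x \<times> 'x \<Rightarrow> real" where "G z = (\<Sum>j\<in>J. F j (fst z) * F j (snd z))"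
definition V :: "'x \<Rightarrow> real" where "V x = (\<Sum>j\<in>J. F j x)"
definition W :: "'x \<times> 'x \<Rightarrow> real" where "W z = V (fst z) + V (snd z)"

lemma measurable_F: "j \<in> J \<Longrightarrow> F j \<in> borel_measurable P"
  using integrable_F by (rule borel_measurable_integrable)

lemma measurable_G [measurable]: "G \<in> borel_measurable PP"
  unfolding G_def[abs_def]
  by (intro borel_measurable_sum borel_measurable_times measurable_compose[OF measurable_fst] measurable_compose[OF measurable_snd] measurable_F)

lemma integrable_V: "integrable P V"
  unfolding V_def[abs_def] by (intro Bochner_Integration.integrable_sum integrable_F)

lemma measurable_V [measurable]: "V \<in> borel_measurable P"
  using integrable_V by (rule borel_measurable_integrable)

lemma measurable_W [measurable]: "W \<in> borel_measurable PP"
  unfolding W_def[abs_def] by measurable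

lemma integral_V: "(\<integral>x. V x \<partial>P) = 0"
  unfolding V_def by (subst Bochner_Integration.integral_sum) (auto intro: integrable_F simp: mean_F)

text \<open>Complete degeneracy: \<open>G\<close> averages to 0 over either argument with the other
  fixed, because each summand has one centered factor left.\<close>

lemma integral_G_section: "(\<integral>y. G (x, y) \<partial>P) = 0" "(\<integral>y. G (y, x) \<partial>P) = 0"
  unfolding G_def by (subst Bochner_Integration.integral_sum; auto intro: integrable_F simp: mean_F)+

lemma integral_G:
  assumes "integrable PP (\<lambda>z. (G z)\<^sup>2)"
  shows "integrable PP G" "(\<integral>z. G z \<partial>PP) = 0"
proof -
  show i: "integrable PP G" by (rule pair.P.square_integrable_imp_integrable[OF _ assms]) measurable
  show "(\<integral>z. G z \<partial>PP) = 0"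
    unfolding pair.integral_fst'[OF i, symmetric] integral_G_section by simp
qed

text \<open>By Fubini almost every section of the square of \<open>W\<close> is integrable. One such
  section suffices: after removing the constant and the integrable cross term, only the square of
  \<open>V\<close> remains.\<close>

lemma square_integrable_V:
  assumes int: "integrable PP (\<lambda>z. (W z)\<^sup>2)"
  shows "integrable P (\<lambda>x. (V x)\<^sup>2)"
proof -
  have "AE x in P. integrable P (\<lambda>y. (V x + V y)\<^sup>2)"
    using pair.AE_integrable_fst'[OF int] by (simp add: W_def)
  then obtain x where x: "integrable P (\<lambda>y. (V x + V y)\<^sup>2)"
    using eventually_happens'[OF ae_filter_bot] by blast
  have "integrable P (\<lambda>y. (V x + V y)\<^sup>2 - 2 * V x * V y - (V x)\<^sup>2)"
    using x integrable_V by simp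
  then show ?thesis by (simp add: power2_sum)
qed

lemma integral_W:
  assumes int: "integrable PP (\<lambda>z. (W z)\<^sup>2)"
  shows "integrable PP W" "(\<integral>z. W z \<partial>PP) = 0"
proof -
  show i: "integrable PP W" by (rule pair.P.square_integrable_imp_integrable[OF _ int]) measurable
  have "(\<integral>y. W (x, y) \<partial>P) = V x" for x
    using integrable_V integral_V by (simp add: W_def prob_space)
  then show "(\<integral>z. W z \<partial>PP) = 0"
    unfolding pair.integral_fst'[OF i, symmetric] by (simp add: integral_V)
qed

text \<open>In each half of the product, integrate first over the argument that \<open>V\<close>
  does not contain; degeneracy of \<open>G\<close> gives 0.\<close>

lemma integral_GW:
  assumes G2: "integrable PP (\<lambda>z. (G z)\<^sup>2)" and W2: "integrable PP (\<lambda>z. (W z)\<^sup>2)"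
  shows "(\<integral>z. G z * W z \<partial>PP) = 0"
proof -
  note V2 = square_integrable_V[OF W2]
  have V2f: "integrable PP (\<lambda>z. (V (fst z))\<^sup>2)"
  proof -
    have "integrable (distr PP P fst) (\<lambda>x. (V x)\<^sup>2)"
      using V2 by (simp add: distr_pair_fst)
    then show ?thesis by (simp add: integrable_distr_eq)
  qed
  have V2s: "integrable PP (\<lambda>z. (V (snd z))\<^sup>2)"
    using pair.integrable_product_swap[OF V2f] by (simp add: case_prod_beta')
  have i1: "integrable PP (\<lambda>z. G z * V (fst z))"
    by (rule integrable_mult_of_squares[OF _ _ G2 V2f]) measurable
  have i2: "integrable PP (\<lambda>z. G z * V (snd z))"
    by (rule integrable_mult_of_squares[OF _ _ G2 V2s]) measurable
  have "(\<integral>z. G z * V (fst z) \<partial>PP) = (\<integral>x. (\<integral>y. G (x, y) * V x \<partial>P) \<partial>P)"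
    using pair.integral_fst'[OF i1] by simp
  then have e1: "(\<integral>z. G z * V (fst z) \<partial>PP) = 0" by (simp add: integral_G_section)
  have "(\<integral>z. G z * V (snd z) \<partial>PP) = (\<integral>y. (\<integral>x. G (x, y) * V y \<partial>P) \<partial>P)"
    using pair.integral_snd[of "\<lambda>x y. G (x, y) * V y"] i2 by (simp add: case_prod_beta')
  then have e2: "(\<integral>z. G z * V (snd z) \<partial>PP) = 0" by (simp add: integral_G_section)
  show ?thesis
    unfolding W_def distrib_left using i1 i2 e1 e2 by simp
qed

text \<open>After bounding the features, the second moment of \<open>G\<close> is the squared Frobenius norm of
  their Gram matrix; so \<open>G = 0\<close> forces all features to vanish.\<close>

lemma AE_F_zero:
  assumes G0: "AE z in PP. G z = 0" and j: "j \<in> J"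
  shows "AE x in P. F j x = 0"
proof -
  \<comment> \<open>Division by \<open>d\<close> bounds the features by 1, so that all the Gram
    entries and Fubini integrals exist. It multiplies \<open>G\<close> by a positive product, so
    \<open>G\<close> = 0 is preserved.\<close>
  define d where "d x = 1 + (\<Sum>j\<in>J. \<bar>F j x\<bar>)" for x
  define Z where "Z j x = F j x / d x" for j x
  have d: "1 \<le> d x" for x unfolding d_def by (simp add: sum_nonneg)
  have [measurable]: "d \<in> borel_measurable P"
    unfolding d_def[abs_def] by (intro borel_measurable_add borel_measurable_sum borel_measurable_abs measurable_F) auto
  have Zm: "Z i \<in> borel_measurable P" if "i \<in> J" for i
    unfolding Z_def[abs_def] by (intro borel_measurable_divide measurable_F that) measurable
  have Zb: "\<bar>Z i x\<bar> \<le> 1" if "i \<in> J" for i x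
  proof -
    have "\<bar>F i x\<bar> \<le> (\<Sum>j\<in>J. \<bar>F j x\<bar>)" using finite_J that by (intro member_le_sum) auto
    then have "\<bar>F i x\<bar> \<le> d x" by (simp add: d_def)
    then show ?thesis using d[of x] by (simp add: Z_def abs_divide divide_le_eq)
  qed
  have ZZb: "\<bar>Z i x * Z k x\<bar> \<le> 1" if "i \<in> J" "k \<in> J" for i k x
    using mult_mono[OF Zb[OF that(1)] Zb[OF that(2)]] by (simp add: abs_mult)
  have iP: "integrable P (\<lambda>x. Z i x * Z k x)" if "i \<in> J" "k \<in> J" for i k
    by (rule integrable_const_bound[of _ 1])
      (use ZZb[OF that] Zm[OF that(1)] Zm[OF that(2)] in auto)
  define m where "m i k = (\<integral>x. Z i x * Z k x \<partial>P)" for i k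
  have iPP: "integrable PP (\<lambda>z. (Z i (fst z) * Z k (fst z)) * (Z i (snd z) * Z k (snd z)))" (is ?I)
    and EPP: "(\<integral>z. (Z i (fst z) * Z k (fst z)) * (Z i (snd z) * Z k (snd z)) \<partial>PP) = (m i k)\<^sup>2" (is ?E)
    if i: "i \<in> J" and k: "k \<in> J" for i k
  proof -
    note [measurable] = Zm[OF i] Zm[OF k]
    have b: "\<bar>(Z i x * Z k x) * (Z i y * Z k y)\<bar> \<le> 1" for x y
      using mult_mono[OF ZZb[OF i k, of x] ZZb[OF i k, of y]] by (simp add: abs_mult)
    show I: ?I
      by (rule pair.P.integrable_const_bound[of _ 1]) (use b in auto)
    show ?E
      unfolding pair.integral_fst'[OF I, symmetric] by (simp add: m_def power2_eq_square)
  qed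
  have "0 = (\<integral>z. (\<Sum>i\<in>J. Z i (fst z) * Z i (snd z))\<^sup>2 \<partial>PP)"
  proof -
    have "(\<Sum>i\<in>J. Z i (fst z) * Z i (snd z)) = G z / (d (fst z) * d (snd z))" for z
      by (simp add: Z_def G_def sum_divide_distrib)
    then have "AE z in PP. (\<Sum>i\<in>J. Z i (fst z) * Z i (snd z))\<^sup>2 = 0" using G0 by (auto elim!: AE_mp)
    then have "(\<integral>z. (\<Sum>i\<in>J. Z i (fst z) * Z i (snd z))\<^sup>2 \<partial>PP) = 0" by (rule integral_eq_zero_AE)
    then show ?thesis by simp
  qed
  also have "\<dots> = (\<integral>z. (\<Sum>i\<in>J. \<Sum>k\<in>J. (Z i (fst z) * Z k (fst z)) * (Z i (snd z) * Z k (snd z))) \<partial>PP)"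
    by (intro Bochner_Integration.integral_cong refl) (simp add: power2_eq_square sum_product mult_ac)
  also have "\<dots> = (\<Sum>i\<in>J. \<integral>z. (\<Sum>k\<in>J. (Z i (fst z) * Z k (fst z)) * (Z i (snd z) * Z k (snd z))) \<partial>PP)"
    by (rule Bochner_Integration.integral_sum) (intro Bochner_Integration.integrable_sum iPP)
  also have "\<dots> = (\<Sum>i\<in>J. \<Sum>k\<in>J. (m i k)\<^sup>2)"
  proof (rule sum.cong[OF refl])
    fix i assume i: "i \<in> J"
    have "(\<integral>z. (\<Sum>k\<in>J. (Z i (fst z) * Z k (fst z)) * (Z i (snd z) * Z k (snd z))) \<partial>PP)
        = (\<Sum>k\<in>J. \<integral>z. (Z i (fst z) * Z k (fst z)) * (Z i (snd z) * Z k (snd z)) \<partial>PP)"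
      by (rule Bochner_Integration.integral_sum) (rule iPP[OF i])
    also have "\<dots> = (\<Sum>k\<in>J. (m i k)\<^sup>2)" by (rule sum.cong[OF refl]) (rule EPP[OF i])
    finally show "(\<integral>z. (\<Sum>k\<in>J. (Z i (fst z) * Z k (fst z)) * (Z i (snd z) * Z k (snd z))) \<partial>PP) = (\<Sum>k\<in>J. (m i k)\<^sup>2)" .
  qed
  finally have "(\<Sum>i\<in>J. \<Sum>k\<in>J. (m i k)\<^sup>2) = 0" by simp
  then have "(m j j)\<^sup>2 = 0"
    using finite_J j by (simp add: sum_nonneg_eq_0_iff sum_nonneg)
  then have "(\<integral>x. Z j x * Z j x \<partial>P) = 0" by (simp add: m_def)
  then have "AE x in P. Z j x * Z j x = 0"
    using integral_nonneg_eq_0_iff_AE[OF iP[OF j j]] by simp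
  then show ?thesis
  proof (rule AE_mp, intro AE_I2 impI)
    fix x assume "Z j x * Z j x = 0"
    then show "F j x = 0" using d[of x] by (simp add: Z_def)
  qed
qed

text \<open>Used in contrapositive form: positive variance of the total-sum statistic forces
  positive variance of the trace statistic, so the hypothesis on the former permits both
  standardizations.\<close>

lemma AE_W_zero:
  assumes G0: "AE z in PP. G z = 0"
  shows "AE z in PP. W z = 0"
proof -
  have "AE x in P. \<forall>j\<in>J. F j x = 0" using AE_F_zero[OF G0] finite_J by (intro AE_finite_allI) auto
  then have V0: "AE x in P. V x = 0" by (rule AE_mp) (auto simp: V_def)
  show ?thesis
  proof (rule pair.AE_pair_measure)
    show "{z \<in> space PP. W z = 0} \<in> sets PP" by measurable
    show "AE x in P. AE y in P. W (x, y) = 0"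
    proof (rule AE_mp[OF V0], rule AE_I2, rule impI)
      fix x assume "V x = 0"
      then show "AE y in P. W (x, y) = 0" using V0 by (simp add: W_def)
    qed
  qed
qed

end

section \<open>The covariance statistics as sums of features\<close>

definition off_pairs :: "nat \<Rightarrow> nat \<Rightarrow> (nat \<times> nat) set" where
  "off_pairs p \<tau> = {j \<in> {1..p} \<times> {1..p}. int \<tau> \<le> \<bar>int (fst j) - int (snd j)\<bar>}"

definition cross_dev :: "rvec \<Rightarrow> nat \<times> nat \<Rightarrow> rvec \<Rightarrow> real" where
  "cross_dev \<mu> j x = (x (fst j) - \<mu> (fst j)) * (x (snd j) - \<mu> (snd j))"

lemma finite_off_pairs: "finite (off_pairs p \<tau>)"
  by (simp add: off_pairs_def)

lemma sum_off_pairs: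
  "(\<Sum>k=1..p. \<Sum>l=1..p. if int \<tau> \<le> \<bar>int k - int l\<bar> then f k l else 0) = (\<Sum>j\<in>off_pairs p \<tau>. f (fst j) (snd j))"
  for f :: "nat \<Rightarrow> nat \<Rightarrow> real"
  unfolding off_pairs_def sum.cartesian_product case_prod_beta'
  by (rule sum.inter_filter[symmetric]) simp

text \<open>Only the entries outside the band enter, so the true covariance matrix can replace any
  hypothesized one with the same vanishing entries.\<close>

lemma pair_trace_cong:
  assumes "\<forall>k\<in>{1..p}. \<forall>l\<in>{1..p}. off_band \<tau> C k l = off_band \<tau> C' k l"
  shows "pair_trace p \<tau> c A B C = pair_trace p \<tau> c A B C'"
  unfolding pair_trace_def mat_trace_def mat_mult_def using assms by (intro sum.cong refl) simp

lemma pair_ones_cong: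
  assumes "\<forall>k\<in>{1..p}. \<forall>l\<in>{1..p}. off_band \<tau> C k l = off_band \<tau> C' k l"
  shows "pair_ones p \<tau> c A B C = pair_ones p \<tau> c A B C'"
  unfolding pair_ones_def quad_form_def using assms by (intro sum.cong refl) simp

text \<open>The trace pairs entry (k, l) of one matrix with (l, k) of the other; symmetry of outer
  products and of the band turns this into a product of equal features.\<close>

lemma e_prime_eq:
  assumes "\<forall>k\<in>{1..p}. \<forall>l\<in>{1..p}. off_band \<tau> C k l = 0"
  shows "e_prime n p \<tau> \<mu> x C i = (\<Sum>j\<in>off_pairs p \<tau>. cross_dev \<mu> j (x i) * cross_dev \<mu> j (x (n div 2 + i)))"
proof -
  have "e_prime n p \<tau> \<mu> x C i = (\<Sum>k=1..p. \<Sum>l=1..p. if int \<tau> \<le> \<bar>int k - int l\<bar>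
      then cross_dev \<mu> (k, l) (x i) * cross_dev \<mu> (k, l) (x (n div 2 + i)) else 0)"
    unfolding e_prime_def pair_trace_def mat_trace_def mat_mult_def
  proof (intro sum.cong refl)
    fix k l assume "k \<in> {1..p}" "l \<in> {1..p}"
    then have C: "off_band \<tau> C k l = 0" "off_band \<tau> C l k = 0" using assms by blast+
    show "(off_band \<tau> (outer_Y \<mu> x i) k l - 1 * off_band \<tau> C k l) *
        (off_band \<tau> (outer_Y \<mu> x (n div 2 + i)) l k - 1 * off_band \<tau> C l k) =
      (if int \<tau> \<le> \<bar>int k - int l\<bar> then cross_dev \<mu> (k, l) (x i) * cross_dev \<mu> (k, l) (x (n div 2 + i)) else 0)"
      unfolding C by (simp add: off_band_def outer_Y_def cross_dev_def abs_minus_commute)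
  qed
  then show ?thesis unfolding sum_off_pairs by simp
qed

lemma v_prime_eq:
  assumes "\<forall>k\<in>{1..p}. \<forall>l\<in>{1..p}. off_band \<tau> C k l = 0"
  shows "v_prime n p \<tau> \<mu> x C i = (\<Sum>j\<in>off_pairs p \<tau>. cross_dev \<mu> j (x i)) + (\<Sum>j\<in>off_pairs p \<tau>. cross_dev \<mu> j (x (n div 2 + i)))"
proof -
  have "v_prime n p \<tau> \<mu> x C i = (\<Sum>k=1..p. \<Sum>l=1..p. if int \<tau> \<le> \<bar>int k - int l\<bar>
      then cross_dev \<mu> (k, l) (x i) + cross_dev \<mu> (k, l) (x (n div 2 + i)) else 0)"
    unfolding v_prime_def pair_ones_def quad_form_def
    by (intro sum.cong refl) (use assms in \<open>auto simp: off_band_def outer_Y_def cross_dev_def\<close>)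
  then show ?thesis unfolding sum_off_pairs by (simp add: sum.distrib)
qed

abbreviation obs_space :: "nat \<Rightarrow> rvec measure" where
  "obs_space p \<equiv> \<Pi>\<^sub>M k\<in>{1..p}. (borel :: real measure)"

locale iid_obs =
  fixes M :: "'a measure" and n p \<tau> :: nat and X :: "'a \<Rightarrow> nat \<Rightarrow> rvec" and \<mu> :: rvec and S :: rmat
  assumes model: "iid_sample M n p X \<mu> S"
    and n: "2 \<le> n"
    and H0: "\<forall>i\<in>{1..p}. \<forall>j\<in>{1..p}. int \<tau> \<le> \<bar>int i - int j\<bar> \<longrightarrow> S i j = 0"
begin

sublocale prob_space M
  using model by (simp add: iid_sample_def)

abbreviation "N \<equiv> n div 2"

lemma N_pos: "0 < N"
  using n by simp

lemma two_N: "2 * N \<le> n"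
  by simp

lemma indep_X: "indep_vars (\<lambda>_. obs_space p) (\<lambda>i w. X w i) {1..n}"
  using model by (simp add: iid_sample_def)

lemma measurable_X: "i \<in> {1..n} \<Longrightarrow> (\<lambda>w. X w i) \<in> measurable M (obs_space p)"
  using indep_X by (simp add: indep_vars_def)

lemma measurable_X_component: "i \<in> {1..n} \<Longrightarrow> k \<in> {1..p} \<Longrightarrow> (\<lambda>w. X w i k) \<in> borel_measurable M"
  using measurable_compose[OF measurable_X measurable_component_singleton] .

lemma off_band_S: "\<forall>k\<in>{1..p}. \<forall>l\<in>{1..p}. off_band \<tau> S k l = 0"
  using H0 by (auto simp: off_band_def)

definition obs_law :: "rvec measure" where
  "obs_law = distr M (obs_space p) (\<lambda>w. X w 1)"

lemma distr_X: "i \<in> {1..n} \<Longrightarrow> distr M (obs_space p) (\<lambda>w. X w i) = obs_law"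
  using model unfolding iid_sample_def obs_law_def by blast

lemma sets_obs_law [measurable_cong]: "sets obs_law = sets (obs_space p)"
  by (simp add: obs_law_def)

lemma distr_pair:
  assumes "i \<in> {1..N}"
  shows "distr M (obs_space p \<Otimes>\<^sub>M obs_space p) (\<lambda>w. (X w i, X w (N + i))) = obs_law \<Otimes>\<^sub>M obs_law"
proof -
  have i: "i \<in> {1..n}" "N + i \<in> {1..n}" "i \<noteq> N + i" using assms two_N N_pos by auto
  have "indep_var (obs_space p) (\<lambda>w. X w i) (obs_space p) (\<lambda>w. X w (N + i))"
    using indep_vars_pair[OF indep_X i] .
  then show ?thesis
    unfolding indep_var_distribution_eq using distr_X[OF i(1)] distr_X[OF i(2)] by simp
qed

lemma measurable_pair:
  assumes "i \<in> {1..N}"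
  shows "(\<lambda>w. (X w i, X w (N + i))) \<in> measurable M (obs_space p \<Otimes>\<^sub>M obs_space p)"
proof -
  have i: "i \<in> {1..n}" "N + i \<in> {1..n}" using assms two_N by auto
  show ?thesis by (rule measurable_Pair[OF measurable_X[OF i(1)] measurable_X[OF i(2)]])
qed

text \<open>The index blocks {i, N + i} are disjoint for different i, so functions of them are
  independent; each block has the product law.\<close>

lemma iid_row_pair:
  assumes h [measurable]: "h \<in> borel_measurable (obs_space p \<Otimes>\<^sub>M obs_space p)"
  shows "iid_row M N (\<lambda>i w. h (X w i, X w (N + i)))"
proof
  show "0 < N" by (rule N_pos)
  have r: "indep_vars (\<lambda>i. PiM {i, N + i} (\<lambda>_. obs_space p)) (\<lambda>i w. restrict (\<lambda>i. X w i) {i, N + i}) {1..N}"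
  proof (rule indep_vars_restrict[OF indep_X])
    show "{i, N + i} \<subseteq> {1..n}" if "i \<in> {1..N}" for i using that two_N by auto
    show "disjoint_family_on (\<lambda>i. {i, N + i}) {1..N}" by (auto simp: disjoint_family_on_def)
  qed
  have "indep_vars (\<lambda>_. borel) (\<lambda>i w. (\<lambda>f. h (f i, f (N + i))) (restrict (\<lambda>i. X w i) {i, N + i})) {1..N}"
    by (rule indep_vars_compose2[OF r]) measurable
  then show "indep_vars (\<lambda>_. borel) (\<lambda>i w. h (X w i, X w (N + i))) {1..N}" by simp
  have d: "distr M borel (\<lambda>w. h (X w i, X w (N + i))) = distr (obs_law \<Otimes>\<^sub>M obs_law) borel h" if "i \<in> {1..N}" for i
    unfolding distr_pair[OF that, symmetric]
    by (subst distr_distr[OF h measurable_pair[OF that]]) (simp add: comp_def)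
  fix i assume "i \<in> {1..N}"
  then show "distr M borel (\<lambda>w. h (X w i, X w (N + i))) = distr M borel (\<lambda>w. h (X w 1, X w (N + 1)))"
    using d[of i] d[of 1] N_pos by simp
qed

lemma measurable_cross_dev: "j \<in> off_pairs p \<tau> \<Longrightarrow> cross_dev \<mu> j \<in> borel_measurable (obs_space p)"
  unfolding cross_dev_def[abs_def] off_pairs_def
  by (intro borel_measurable_times borel_measurable_diff borel_measurable_const measurable_component_singleton) auto

sublocale features: centered_features obs_law "off_pairs p \<tau>" "cross_dev \<mu>"
proof (intro centered_features.intro centered_features_axioms.intro)
  have one: "(1::nat) \<in> {1..n}" using n by simp
  show "prob_space obs_law"
    unfolding obs_law_def by (rule prob_space_distr[OF measurable_X[OF one]])
  show "finite (off_pairs p \<tau>)" by (rule finite_off_pairs)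
  fix j assume j: "j \<in> off_pairs p \<tau>"
  then have kl: "fst j \<in> {1..p}" "snd j \<in> {1..p}" "int \<tau> \<le> \<bar>int (fst j) - int (snd j)\<bar>"
    by (auto simp: off_pairs_def)
  have sq: "integrable M (\<lambda>w. (X w 1 k)\<^sup>2)" if "k \<in> {1..p}" for k
    using model one that unfolding iid_sample_def by blast
  have sq': "integrable M (\<lambda>w. (X w 1 k - \<mu> k)\<^sup>2)" if k: "k \<in> {1..p}" for k
  proof -
    have "integrable M (\<lambda>w. X w 1 k)"
      by (rule square_integrable_imp_integrable[OF measurable_X_component[OF one k] sq[OF k]])
    then show ?thesis unfolding power2_diff using sq[OF k] by simp
  qed
  \<comment> \<open>Second moments of both coordinates make their product integrable. Its mean is
    the covariance at a pair outside the band, hence 0 under the null hypothesis.\<close>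
  note [measurable] = measurable_X_component[OF one kl(1)] measurable_X_component[OF one kl(2)]
  have "integrable M (\<lambda>w. (X w 1 (fst j) - \<mu> (fst j)) * (X w 1 (snd j) - \<mu> (snd j)))"
    by (rule integrable_mult_of_squares[OF _ _ sq'[OF kl(1)] sq'[OF kl(2)]]) measurable
  then have "integrable M (\<lambda>w. cross_dev \<mu> j (X w 1))" by (simp add: cross_dev_def)
  then show "integrable obs_law (cross_dev \<mu> j)"
    unfolding obs_law_def by (subst integrable_distr_eq[OF measurable_X[OF one] measurable_cross_dev[OF j]])
  have "(\<integral>x. cross_dev \<mu> j x \<partial>obs_law) = (\<integral>w. cross_dev \<mu> j (X w 1) \<partial>M)"
    unfolding obs_law_def by (rule integral_distr[OF measurable_X[OF one] measurable_cross_dev[OF j]])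
  also have "\<dots> = (\<integral>w. (X w 1 (fst j) - \<mu> (fst j)) * (X w 1 (snd j) - \<mu> (snd j)) \<partial>M)"
    by (simp add: cross_dev_def)
  also have "\<dots> = S (fst j) (snd j)"
    using model one kl unfolding iid_sample_def by blast
  also have "\<dots> = 0" using H0 kl by blast
  finally show "(\<integral>x. cross_dev \<mu> j x \<partial>obs_law) = 0" .
qed

lemma e_prime_features: "e_prime n p \<tau> \<mu> (X w) S i = features.G (X w i, X w (N + i))"
  by (simp add: e_prime_eq[OF off_band_S] features.G_def)

lemma v_prime_features: "v_prime n p \<tau> \<mu> (X w) S i = features.W (X w i, X w (N + i))"
  by (simp add: v_prime_eq[OF off_band_S] features.W_def features.V_def)

lemma measurable_features:
  "features.G \<in> borel_measurable (obs_space p \<Otimes>\<^sub>M obs_space p)"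
  "features.W \<in> borel_measurable (obs_space p \<Otimes>\<^sub>M obs_space p)"
  using features.measurable_G features.measurable_W
  by (simp_all cong: measurable_cong_sets add: measurable_cong_sets[OF sets_pair_measure_cong[OF sets_obs_law sets_obs_law] refl])

lemma pair_transfer:
  fixes h :: "rvec \<times> rvec \<Rightarrow> real"
  assumes h: "h \<in> borel_measurable (obs_space p \<Otimes>\<^sub>M obs_space p)"
  shows "integrable M (\<lambda>w. h (X w 1, X w (N + 1))) \<longleftrightarrow> integrable (obs_law \<Otimes>\<^sub>M obs_law) h"
    and "(\<integral>w. h (X w 1, X w (N + 1)) \<partial>M) = (\<integral>z. h z \<partial>(obs_law \<Otimes>\<^sub>M obs_law))"
proof -
  have one: "1 \<in> {1..N}" using N_pos by simp
  show "integrable M (\<lambda>w. h (X w 1, X w (N + 1))) \<longleftrightarrow> integrable (obs_law \<Otimes>\<^sub>M obs_law) h"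
    unfolding distr_pair[OF one, symmetric] by (rule integrable_distr_eq[OF measurable_pair[OF one] h, symmetric])
  show "(\<integral>w. h (X w 1, X w (N + 1)) \<partial>M) = (\<integral>z. h z \<partial>(obs_law \<Otimes>\<^sub>M obs_law))"
    unfolding distr_pair[OF one, symmetric] by (rule integral_distr[OF measurable_pair[OF one] h, symmetric])
qed

abbreviation "e i w \<equiv> e_prime n p \<tau> \<mu> (X w) S i"
abbreviation "v i w \<equiv> v_prime n p \<tau> \<mu> (X w) S i"

lemma iid_row_ev:
  assumes g: "g \<in> borel_measurable borel"
  shows "iid_row M N (\<lambda>i w. g (e i w, v i w))"
proof -
  note [measurable] = measurable_features g
  have "(\<lambda>z. g (features.G z, features.W z)) \<in> borel_measurable (obs_space p \<Otimes>\<^sub>M obs_space p)"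
    by measurable
  from iid_row_pair[OF this] show ?thesis by (simp add: e_prime_features v_prime_features)
qed

text \<open>Positivity is assumed for the nonnegative integral, which is meaningful without
  integrability; \<open>v2\<close> then transfers it to the Bochner integral, where it is needed for
  the division.\<close>

lemma moments_ev:
  assumes e2: "integrable M (\<lambda>w. (e 1 w)\<^sup>2)" and v2: "integrable M (\<lambda>w. (v 1 w)\<^sup>2)"
    and pos: "0 < (\<integral>\<^sup>+w. ennreal ((v 1 w)\<^sup>2) \<partial>M)"
  shows "(\<integral>w. e 1 w \<partial>M) = 0" "(\<integral>w. v 1 w \<partial>M) = 0" "(\<integral>w. e 1 w * v 1 w \<partial>M) = 0"
    "0 < (\<integral>w. (e 1 w)\<^sup>2 \<partial>M)" "0 < (\<integral>w. (v 1 w)\<^sup>2 \<partial>M)"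
proof -
  note [measurable] = measurable_features
  have mG2: "(\<lambda>z. (features.G z)\<^sup>2) \<in> borel_measurable (obs_space p \<Otimes>\<^sub>M obs_space p)"
    and mW2: "(\<lambda>z. (features.W z)\<^sup>2) \<in> borel_measurable (obs_space p \<Otimes>\<^sub>M obs_space p)"
    and mGW: "(\<lambda>z. features.G z * features.W z) \<in> borel_measurable (obs_space p \<Otimes>\<^sub>M obs_space p)"
    by measurable
  have G2: "integrable (obs_law \<Otimes>\<^sub>M obs_law) (\<lambda>z. (features.G z)\<^sup>2)"
    using e2 unfolding e_prime_features pair_transfer(1)[OF mG2] .
  have W2: "integrable (obs_law \<Otimes>\<^sub>M obs_law) (\<lambda>z. (features.W z)\<^sup>2)"
    using v2 unfolding v_prime_features pair_transfer(1)[OF mW2] .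
  show "(\<integral>w. e 1 w \<partial>M) = 0"
    unfolding e_prime_features pair_transfer(2)[OF measurable_features(1)] by (rule features.integral_G(2)[OF G2])
  show "(\<integral>w. v 1 w \<partial>M) = 0"
    unfolding v_prime_features pair_transfer(2)[OF measurable_features(2)] by (rule features.integral_W(2)[OF W2])
  show "(\<integral>w. e 1 w * v 1 w \<partial>M) = 0"
    unfolding e_prime_features v_prime_features pair_transfer(2)[OF mGW] by (rule features.integral_GW[OF G2 W2])
  have Ev: "(\<integral>w. (v 1 w)\<^sup>2 \<partial>M) = (\<integral>z. (features.W z)\<^sup>2 \<partial>(obs_law \<Otimes>\<^sub>M obs_law))"
    unfolding v_prime_features by (rule pair_transfer(2)[OF mW2])
  have "(\<integral>\<^sup>+w. ennreal ((v 1 w)\<^sup>2) \<partial>M) = ennreal (\<integral>w. (v 1 w)\<^sup>2 \<partial>M)"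
    by (rule nn_integral_eq_integral[OF v2]) simp
  then show vp: "0 < (\<integral>w. (v 1 w)\<^sup>2 \<partial>M)" using pos by simp
  have "(\<integral>w. (e 1 w)\<^sup>2 \<partial>M) \<noteq> 0"
  proof
    assume "(\<integral>w. (e 1 w)\<^sup>2 \<partial>M) = 0"
    then have "(\<integral>z. (features.G z)\<^sup>2 \<partial>(obs_law \<Otimes>\<^sub>M obs_law)) = 0"
      unfolding e_prime_features pair_transfer(2)[OF mG2] .
    then have "AE z in obs_law \<Otimes>\<^sub>M obs_law. features.G z = 0"
      using integral_nonneg_eq_0_iff_AE[OF G2] by simp
    from features.AE_W_zero[OF this] have "AE z in obs_law \<Otimes>\<^sub>M obs_law. (features.W z)\<^sup>2 = 0" by (auto elim!: AE_mp)
    then have "(\<integral>z. (features.W z)\<^sup>2 \<partial>(obs_law \<Otimes>\<^sub>M obs_law)) = 0" by (rule integral_eq_zero_AE)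
    then show False using vp Ev by simp
  qed
  moreover have "0 \<le> (\<integral>w. (e 1 w)\<^sup>2 \<partial>M)" by simp
  ultimately show "0 < (\<integral>w. (e 1 w)\<^sup>2 \<partial>M)" by linarith
qed

lemma measurable_pair_stats:
  assumes A: "\<And>k l. k \<in> {1..p} \<Longrightarrow> l \<in> {1..p} \<Longrightarrow> (\<lambda>w. A w k l) \<in> borel_measurable M"
    and B: "\<And>k l. k \<in> {1..p} \<Longrightarrow> l \<in> {1..p} \<Longrightarrow> (\<lambda>w. B w k l) \<in> borel_measurable M"
  shows "(\<lambda>w. pair_trace p \<tau> c (A w) (B w) C) \<in> borel_measurable M"
    and "(\<lambda>w. pair_ones p \<tau> c (A w) (B w) C) \<in> borel_measurable M"
proof -
  have off: "(\<lambda>w. off_band \<tau> (D w) k l) \<in> borel_measurable M"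
    if "(\<lambda>w. D w k l) \<in> borel_measurable M" for D :: "'a \<Rightarrow> rmat" and k l
    using that by (simp add: off_band_def)
  show "(\<lambda>w. pair_trace p \<tau> c (A w) (B w) C) \<in> borel_measurable M"
    unfolding pair_trace_def mat_trace_def mat_mult_def
    by (intro borel_measurable_sum borel_measurable_times borel_measurable_diff borel_measurable_const off A B)
  show "(\<lambda>w. pair_ones p \<tau> c (A w) (B w) C) \<in> borel_measurable M"
    unfolding pair_ones_def quad_form_def
    by (intro borel_measurable_sum borel_measurable_times borel_measurable_diff borel_measurable_add borel_measurable_const off A B)
qed

lemma measurable_outer_Y_star:
  assumes "i \<in> {1..2 * N}" "k \<in> {1..p}" "l \<in> {1..p}"
  shows "(\<lambda>w. outer_Y_star N (X w) i k l) \<in> borel_measurable M"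
proof -
  have m: "(\<lambda>w. X w i k) \<in> borel_measurable M" if "i \<in> {1..2 * N}" "k \<in> {1..p}" for i k
    using that two_N by (intro measurable_X_component) auto
  have m1: "(\<lambda>w. mean_first N (X w) k) \<in> borel_measurable M" if "k \<in> {1..p}" for k
    unfolding mean_first_def by (intro borel_measurable_divide borel_measurable_sum borel_measurable_const m that) auto
  have m2: "(\<lambda>w. mean_second N (X w) k) \<in> borel_measurable M" if "k \<in> {1..p}" for k
    unfolding mean_second_def by (intro borel_measurable_divide borel_measurable_sum borel_measurable_const m that) auto
  show ?thesis
    unfolding outer_Y_star_def outer_Y_def
    using assms by (cases "i \<le> N") (auto intro!: borel_measurable_times borel_measurable_diff m m1 m2)
qed

lemma measurable_stars:
  assumes "i \<in> {1..N}"
  shows "(\<lambda>w. e_star n p \<tau> (X w) C i) \<in> borel_measurable M" "(\<lambda>w. v_star n p \<tau> (X w) C i) \<in> borel_measurable M"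
  unfolding e_star_def v_star_def Let_def
  using assms by (intro measurable_pair_stats measurable_outer_Y_star; auto)+

lemma measurable_ev:
  assumes "i \<in> {1..N}"
  shows "e i \<in> borel_measurable M" "v i \<in> borel_measurable M"
proof -
  have "fst \<in> borel_measurable (borel :: (real \<times> real) measure)" "snd \<in> borel_measurable (borel :: (real \<times> real) measure)"
    by (intro borel_measurable_continuous_onI continuous_intros)+
  from iid_row.Z_measurable[OF iid_row_ev[OF this(1)] assms] iid_row.Z_measurable[OF iid_row_ev[OF this(2)] assms]
  show "e i \<in> borel_measurable M" "v i \<in> borel_measurable M" by simp_all
qed

end

section \<open>From the moment hypotheses to a standardized array\<close>

lemma integrable_square_of_powr:
  fixes f :: "'a \<Rightarrow> real"
  assumes "finite_measure M" and [measurable]: "f \<in> borel_measurable M" and d: "0 < \<delta>" and int: "integrable M (\<lambda>x. \<bar>f x\<bar> powr (2 + \<delta>))"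
  shows "integrable M (\<lambda>x. (f x)\<^sup>2)"
proof (rule Bochner_Integration.integrable_bound)
  interpret finite_measure M by fact
  show "integrable M (\<lambda>x. 1 + \<bar>f x\<bar> powr (2 + \<delta>))" using int by simp
  have "t\<^sup>2 \<le> 1 + \<bar>t\<bar> powr (2 + \<delta>)" for t :: real
  proof (cases "\<bar>t\<bar> \<le> 1")
    case True
    then have "t\<^sup>2 \<le> 1" by (simp add: abs_square_le_1)
    then show ?thesis using powr_ge_zero[of "\<bar>t\<bar>" "2 + \<delta>"] by linarith
  next
    case False
    then have "\<bar>t\<bar> powr 2 \<le> \<bar>t\<bar> powr (2 + \<delta>)" using d by (intro powr_mono) auto
    moreover have "\<bar>t\<bar> powr 2 = t\<^sup>2" by simp
    ultimately show ?thesis by linarith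
  qed
  then show "AE x in M. norm ((f x)\<^sup>2) \<le> norm (1 + \<bar>f x\<bar> powr (2 + \<delta>))" by simp
qed measurable

text \<open>Since N is at least 1, enlarging the exponent in the denominator only decreases the
  quotient.\<close>

lemma lyapunov_of_moment_ratio:
  fixes r s :: "nat \<Rightarrow> real"
  assumes o: "(\<lambda>n. max (r n) (s n)) \<in> o(\<lambda>n. real (N n) powr c)"
    and r: "\<And>n. 0 \<le> r n" and c: "c \<le> d" and N: "\<And>n. 0 < N n"
  shows "(\<lambda>n. r n / real (N n) powr d) \<longlonglongrightarrow> 0"
proof -
  have lim: "(\<lambda>n. max (r n) (s n) / real (N n) powr c) \<longlonglongrightarrow> 0"
    by (rule smalloD_tendsto[OF o])
  show ?thesis
  proof (rule tendsto_sandwich[OF _ _ tendsto_const lim])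
    show "\<forall>\<^sub>F n in sequentially. 0 \<le> r n / real (N n) powr d" using r by simp
    show "\<forall>\<^sub>F n in sequentially. r n / real (N n) powr d \<le> max (r n) (s n) / real (N n) powr c"
    proof (rule always_eventually, rule allI)
      fix n
      have "1 \<le> N n" using N[of n] by simp
      then have "real (N n) powr c \<le> real (N n) powr d" using c by (intro powr_mono) auto
      then show "r n / real (N n) powr d \<le> max (r n) (s n) / real (N n) powr c"
        using r[of n] N[of n] by (intro frac_le) auto
    qed
  qed
qed

lemma moment_exponent_le: "0 < \<delta> \<Longrightarrow> (\<delta> + min 2 \<delta>) / 4 \<le> \<delta> / 2" for \<delta> :: real
  by (simp add: min_def)

lemma smallo_shift:
  fixes f g :: "nat \<Rightarrow> real"
  assumes "f \<in> o(g)"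
  shows "(\<lambda>n. f (n + k)) \<in> o(\<lambda>n. g (n + k))"
  using landau_o.small.compose[OF assms filterlim_add_const_nat_at_top[of k]] .

text \<open>Integrability is assumed only eventually, while the array needs it in every row. Initial
  rows are therefore dropped by an index shift, which does not affect the limit.\<close>

lemma weak_conv_shift:
  assumes "weak_conv (\<lambda>n. F (n + k)) G"
  shows "weak_conv F G"
  using assms unfolding weak_conv_def by (blast intro: LIMSEQ_offset)

text \<open>Stated for an arbitrary measurable perturbation of the two statistics, so that known and
  estimated mean are two instances.\<close>

lemma el_ratio_converges:
  fixes M :: "nat \<Rightarrow> 'a measure"
    and X :: "nat \<Rightarrow> 'a \<Rightarrow> nat \<Rightarrow> nat \<Rightarrow> real"
    and p \<tau> :: "nat \<Rightarrow> nat"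
    and \<mu> :: "nat \<Rightarrow> nat \<Rightarrow> real"
    and S :: "nat \<Rightarrow> nat \<Rightarrow> nat \<Rightarrow> real"
    and \<delta> :: real
    and e' v' :: "nat \<Rightarrow> nat \<Rightarrow> 'a \<Rightarrow> real"
  defines "e \<equiv> \<lambda>n i w. e_prime n (p n) (\<tau> n) (\<mu> n) (X n w) (S n) i"
    and "v \<equiv> \<lambda>n i w. v_prime n (p n) (\<tau> n) (\<mu> n) (X n w) (S n) i"
  assumes model: "\<forall>n\<ge>1. iid_sample (M n) n (p n) (X n) (\<mu> n) (S n)"
    and v_pos: "\<forall>n\<ge>2. 0 < (\<integral>\<^sup>+w. ennreal ((v n 1 w)\<^sup>2) \<partial>M n)"
    and delta: "\<delta> > 0"
    and e_moment: "\<forall>\<^sub>F n in sequentially. integrable (M n) (\<lambda>w. \<bar>e n 1 w\<bar> powr (2 + \<delta>))"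
    and v_moment: "\<forall>\<^sub>F n in sequentially. integrable (M n) (\<lambda>w. \<bar>v n 1 w\<bar> powr (2 + \<delta>))"
    and moment_ratio: "(\<lambda>n. max
          ((\<integral>w. \<bar>e n 1 w\<bar> powr (2 + \<delta>) \<partial>M n) / (\<integral>w. (e n 1 w)\<^sup>2 \<partial>M n) powr ((2 + \<delta>) / 2))
          ((\<integral>w. \<bar>v n 1 w\<bar> powr (2 + \<delta>) \<partial>M n) / (\<integral>w. (v n 1 w)\<^sup>2 \<partial>M n) powr ((2 + \<delta>) / 2)))
        \<in> o(\<lambda>n. real (n div 2) powr ((\<delta> + min 2 \<delta>) / 4))"
    and H0: "\<forall>n\<ge>1. \<forall>i\<in>{1..p n}. \<forall>j\<in>{1..p n}. int (\<tau> n) \<le> \<bar>int i - int j\<bar> \<longrightarrow> S n i j = 0"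
    and meas: "\<And>n i. i \<in> {1..n div 2} \<Longrightarrow> e' n i \<in> borel_measurable (M n)"
      "\<And>n i. i \<in> {1..n div 2} \<Longrightarrow> v' n i \<in> borel_measurable (M n)"
    and de: "\<forall>\<^sub>F n in sequentially. integrable (M n) (\<lambda>w. sum_dev (n div 2) (\<lambda>i. e' n i w) (\<lambda>i. e n i w))"
      "(\<lambda>n. \<integral>w. sum_dev (n div 2) (\<lambda>i. e' n i w) (\<lambda>i. e n i w) \<partial>M n)
        \<in> o(\<lambda>n. real (n div 2) * (\<integral>w. (e n 1 w)\<^sup>2 \<partial>M n))"
    and dv: "\<forall>\<^sub>F n in sequentially. integrable (M n) (\<lambda>w. sum_dev (n div 2) (\<lambda>i. v' n i w) (\<lambda>i. v n i w))"
      "(\<lambda>n. \<integral>w. sum_dev (n div 2) (\<lambda>i. v' n i w) (\<lambda>i. v n i w) \<partial>M n)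
        \<in> o(\<lambda>n. real (n div 2) * (\<integral>w. (v n 1 w)\<^sup>2 \<partial>M n))"
  shows "converges_in_distribution M (\<lambda>n w. neg2_log (el_ratio (n div 2) (\<lambda>i. (e' n i w, v' n i w)))) (chi_square 2)"
proof -
  from eventually_conj[OF eventually_ge_at_top[of 2] eventually_conj[OF e_moment
      eventually_conj[OF v_moment eventually_conj[OF de(1) dv(1)]]]]
  obtain n0 where n0': "\<And>n. n \<ge> n0 \<Longrightarrow> 2 \<le> n \<and> integrable (M n) (\<lambda>w. \<bar>e n 1 w\<bar> powr (2 + \<delta>)) \<and>
     integrable (M n) (\<lambda>w. \<bar>v n 1 w\<bar> powr (2 + \<delta>)) \<and>
     integrable (M n) (\<lambda>w. sum_dev (n div 2) (\<lambda>i. e' n i w) (\<lambda>i. e n i w)) \<and>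
     integrable (M n) (\<lambda>w. sum_dev (n div 2) (\<lambda>i. v' n i w) (\<lambda>i. v n i w))"
    unfolding eventually_sequentially by blast
  have n0: "2 \<le> m + n0" "integrable (M (m + n0)) (\<lambda>w. \<bar>e (m + n0) 1 w\<bar> powr (2 + \<delta>))"
     "integrable (M (m + n0)) (\<lambda>w. \<bar>v (m + n0) 1 w\<bar> powr (2 + \<delta>))"
     "integrable (M (m + n0)) (\<lambda>w. sum_dev ((m + n0) div 2) (\<lambda>i. e' (m + n0) i w) (\<lambda>i. e (m + n0) i w))"
     "integrable (M (m + n0)) (\<lambda>w. sum_dev ((m + n0) div 2) (\<lambda>i. v' (m + n0) i w) (\<lambda>i. v (m + n0) i w))"
    for m
    using n0'[of "m + n0"] by auto
  define Q where "Q m = M (m + n0)" for m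
  define N where "N m = (m + n0) div 2" for m
  \<comment> \<open>These second moments are variances, since both statistics are centered, and
    positive by the degeneracy argument.\<close>
  define \<sigma>e where "\<sigma>e m = (\<integral>w. (e (m + n0) 1 w)\<^sup>2 \<partial>Q m)" for m
  define \<sigma>v where "\<sigma>v m = (\<integral>w. (v (m + n0) 1 w)\<^sup>2 \<partial>Q m)" for m
  define A where "A m i w = e (m + n0) i w / sqrt (\<sigma>e m)" for m i w
  define B where "B m i w = v (m + n0) i w / sqrt (\<sigma>v m)" for m i w
  have obs: "iid_obs (Q m) (m + n0) (p (m + n0)) (\<tau> (m + n0)) (X (m + n0)) (\<mu> (m + n0)) (S (m + n0))" for m
  proof
    have "1 \<le> m + n0" using n0(1)[of m] by simp
    then show "iid_sample (Q m) (m + n0) (p (m + n0)) (X (m + n0)) (\<mu> (m + n0)) (S (m + n0))"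
      "\<forall>i\<in>{1..p (m + n0)}. \<forall>j\<in>{1..p (m + n0)}. int (\<tau> (m + n0)) \<le> \<bar>int i - int j\<bar> \<longrightarrow> S (m + n0) i j = 0"
      unfolding Q_def using model H0 by blast+
    show "2 \<le> m + n0" by (rule n0(1))
  qed
  have prob: "prob_space (Q m)" for m
    using iid_obs.model[OF obs[of m]] by (simp add: iid_sample_def)
  have Npos: "0 < N m" for m using n0(1)[of m] by (simp add: N_def)
  have row: "iid_row (Q m) (N m) (\<lambda>i w. g (e (m + n0) i w, v (m + n0) i w))" if "g \<in> borel_measurable borel" for g m
    unfolding N_def e_def v_def by (rule iid_obs.iid_row_ev[OF obs that])
  have meas_ev: "e (m + n0) i \<in> borel_measurable (Q m)" "v (m + n0) i \<in> borel_measurable (Q m)" if "i \<in> {1..N m}" for m i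
    using iid_obs.measurable_ev[OF obs, of i m] that unfolding N_def e_def v_def by auto
  have one: "1 \<in> {1..N m}" for m using Npos[of m] by auto
  have fin: "finite_measure (Q m)" for m using prob[of m] by (simp add: prob_space.finite_measure)
  have e2: "integrable (Q m) (\<lambda>w. (e (m + n0) 1 w)\<^sup>2)" for m
    by (rule integrable_square_of_powr[OF fin meas_ev(1)[OF one] delta]) (use n0(2) in \<open>simp add: Q_def\<close>)
  have v2: "integrable (Q m) (\<lambda>w. (v (m + n0) 1 w)\<^sup>2)" for m
    by (rule integrable_square_of_powr[OF fin meas_ev(2)[OF one] delta]) (use n0(3) in \<open>simp add: Q_def\<close>)
  have pos: "0 < (\<integral>\<^sup>+w. ennreal ((v (m + n0) 1 w)\<^sup>2) \<partial>Q m)" for m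
    using v_pos n0(1)[of m] unfolding Q_def by blast
  have mom: "(\<integral>w. e (m + n0) 1 w \<partial>Q m) = 0" "(\<integral>w. v (m + n0) 1 w \<partial>Q m) = 0"
    "(\<integral>w. e (m + n0) 1 w * v (m + n0) 1 w \<partial>Q m) = 0"
    "0 < (\<integral>w. (e (m + n0) 1 w)\<^sup>2 \<partial>Q m)" "0 < (\<integral>w. (v (m + n0) 1 w)\<^sup>2 \<partial>Q m)" for m
    using e2[of m] v2[of m] pos[of m] unfolding e_def v_def by (rule iid_obs.moments_ev[OF obs])+
  have \<sigma>: "0 < \<sigma>e m" "0 < \<sigma>v m" for m unfolding \<sigma>e_def \<sigma>v_def by (rule mom)+
  have powr_div: "\<bar>x / sqrt s\<bar> powr (2 + \<delta>) = \<bar>x\<bar> powr (2 + \<delta>) / s powr ((2 + \<delta>) / 2)" if "0 < s" for x s :: real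
    using that by (simp add: abs_divide powr_divide powr_half_sqrt[symmetric] powr_powr)
  have Nlim: "filterlim N at_top sequentially"
  proof (rule filterlim_at_top_mono[of "\<lambda>m. m div 2"])
    show "filterlim (\<lambda>m::nat. m div 2) at_top sequentially"
      unfolding filterlim_at_top
    proof
      fix Z :: nat
      show "\<forall>\<^sub>F m in sequentially. Z \<le> m div 2"
        using eventually_ge_at_top[of "2 * Z"] by eventually_elim simp
    qed
    show "\<forall>\<^sub>F m in sequentially. m div 2 \<le> N m" by (simp add: N_def div_le_mono)
  qed
  have ratio: "(\<lambda>m. max
          ((\<integral>w. \<bar>e (m + n0) 1 w\<bar> powr (2 + \<delta>) \<partial>Q m) / (\<sigma>e m) powr ((2 + \<delta>) / 2))
          ((\<integral>w. \<bar>v (m + n0) 1 w\<bar> powr (2 + \<delta>) \<partial>Q m) / (\<sigma>v m) powr ((2 + \<delta>) / 2)))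
        \<in> o(\<lambda>m. real (N m) powr ((\<delta> + min 2 \<delta>) / 4))"
    using smallo_shift[OF moment_ratio, of n0] unfolding Q_def N_def \<sigma>e_def \<sigma>v_def .
  interpret arr: standardized_array Q N A B \<delta>
  proof (rule standardized_array.intro)
    show "prob_space (Q m)" for m by (rule prob)
    show "filterlim N at_top sequentially" by (rule Nlim)
    show "0 < \<delta>" by (rule delta)
    fix m
    show "iid_row (Q m) (N m) (\<lambda>i w. g (A m i w, B m i w))" if g: "g \<in> borel_measurable borel" for g
    proof -
      have "(\<lambda>z. (fst z / sqrt (\<sigma>e m), snd z / sqrt (\<sigma>v m))) \<in> borel_measurable (borel :: (real \<times> real) measure)"
        using \<sigma>[of m] by (intro borel_measurable_continuous_onI continuous_intros) auto
      from row[OF measurable_compose[OF this g], of m] show ?thesis by (simp add: A_def B_def)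
    qed
    have sq: "(A m 1 w)\<^sup>2 = (e (m + n0) 1 w)\<^sup>2 / \<sigma>e m" "(B m 1 w)\<^sup>2 = (v (m + n0) 1 w)\<^sup>2 / \<sigma>v m" for w
      using \<sigma>[of m] by (simp_all add: A_def B_def power_divide)
    show "(\<integral>w. A m 1 w \<partial>Q m) = 0" "(\<integral>w. B m 1 w \<partial>Q m) = 0"
      using mom(1,2)[of m] by (simp_all add: A_def B_def)
    show "integrable (Q m) (\<lambda>w. (A m 1 w)\<^sup>2)" "integrable (Q m) (\<lambda>w. (B m 1 w)\<^sup>2)"
      unfolding sq using e2[of m] v2[of m] by simp_all
    show "(\<integral>w. (A m 1 w)\<^sup>2 \<partial>Q m) = 1" "(\<integral>w. (B m 1 w)\<^sup>2 \<partial>Q m) = 1"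
      unfolding sq using \<sigma>[of m] by (simp_all add: \<sigma>e_def[symmetric, simplified] \<sigma>v_def[symmetric, simplified])
    have "(\<integral>w. A m 1 w * B m 1 w \<partial>Q m) = (\<integral>w. e (m + n0) 1 w * v (m + n0) 1 w \<partial>Q m) / (sqrt (\<sigma>e m) * sqrt (\<sigma>v m))"
      by (simp add: A_def B_def)
    then show "(\<integral>w. A m 1 w * B m 1 w \<partial>Q m) = 0" unfolding mom by simp
    show "integrable (Q m) (\<lambda>w. \<bar>A m 1 w\<bar> powr (2 + \<delta>))" "integrable (Q m) (\<lambda>w. \<bar>B m 1 w\<bar> powr (2 + \<delta>))"
      unfolding A_def B_def powr_div[OF \<sigma>(1)] powr_div[OF \<sigma>(2)] Q_def using n0(2,3)[of m] by simp_all
  next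
    show "(\<lambda>m. (\<integral>w. \<bar>A m 1 w\<bar> powr (2 + \<delta>) \<partial>Q m) / real (N m) powr (\<delta> / 2)) \<longlonglongrightarrow> 0"
      using lyapunov_of_moment_ratio[OF ratio _ moment_exponent_le[OF delta] Npos] \<sigma>
      unfolding A_def powr_div[OF \<sigma>(1)] by simp
    have "(\<lambda>m. max
          ((\<integral>w. \<bar>v (m + n0) 1 w\<bar> powr (2 + \<delta>) \<partial>Q m) / (\<sigma>v m) powr ((2 + \<delta>) / 2))
          ((\<integral>w. \<bar>e (m + n0) 1 w\<bar> powr (2 + \<delta>) \<partial>Q m) / (\<sigma>e m) powr ((2 + \<delta>) / 2)))
        \<in> o(\<lambda>m. real (N m) powr ((\<delta> + min 2 \<delta>) / 4))"
      using ratio by (simp only: max.commute)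
    from lyapunov_of_moment_ratio[OF this _ moment_exponent_le[OF delta] Npos]
    show "(\<lambda>m. (\<integral>w. \<bar>B m 1 w\<bar> powr (2 + \<delta>) \<partial>Q m) / real (N m) powr (\<delta> / 2)) \<longlonglongrightarrow> 0"
      unfolding B_def powr_div[OF \<sigma>(2)] by simp
  qed
  define A' where "A' m i w = e' (m + n0) i w / sqrt (\<sigma>e m)" for m i w
  define B' where "B' m i w = v' (m + n0) i w / sqrt (\<sigma>v m)" for m i w
  \<comment> \<open>Markov's inequality: the expected deviation is o(N s), and dividing the
    statistics by sqrt s divides the deviation by s.\<close>
  have perturb: "whp Q (\<lambda>m w. sum_dev (N m) (\<lambda>i. f' m i w / sqrt (s m)) (\<lambda>i. f m i w / sqrt (s m)) \<le> \<epsilon> * real (N m))"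
    if s: "\<And>m. 0 < s m" and \<epsilon>: "0 < \<epsilon>"
      and int: "\<And>m. integrable (Q m) (\<lambda>w. sum_dev (N m) (\<lambda>i. f' m i w) (\<lambda>i. f m i w))"
      and o: "(\<lambda>m. \<integral>w. sum_dev (N m) (\<lambda>i. f' m i w) (\<lambda>i. f m i w) \<partial>Q m) \<in> o(\<lambda>m. real (N m) * s m)"
    for f f' :: "nat \<Rightarrow> nat \<Rightarrow> 'a \<Rightarrow> real" and s and \<epsilon>
  proof -
    define Y where "Y m w = sum_dev (N m) (\<lambda>i. f' m i w) (\<lambda>i. f m i w)" for m w
    have eq: "sum_dev (N m) (\<lambda>i. f' m i w / sqrt (s m)) (\<lambda>i. f m i w / sqrt (s m)) = Y m w / s m" for m w
      using s[of m] by (simp add: Y_def sum_dev_divide)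
    have "whp Q (\<lambda>m w. Y m w \<le> \<epsilon> * real (N m) * s m)"
    proof (rule whp_of_expectation[OF prob])
      show "integrable (Q m) (Y m)" for m using int[of m] by (simp add: Y_def[abs_def])
      show "0 \<le> Y m w" for m w unfolding Y_def by (rule sum_dev_nonneg)
      show "0 < \<epsilon> * real (N m) * s m" for m using \<epsilon> Npos s by simp
      have "(\<lambda>m. (\<integral>w. Y m w \<partial>Q m) / (real (N m) * s m) / \<epsilon>) \<longlonglongrightarrow> 0"
        using smalloD_tendsto[OF o] unfolding Y_def by (rule tendsto_divide_zero)
      then show "(\<lambda>m. (\<integral>w. Y m w \<partial>Q m) / (\<epsilon> * real (N m) * s m)) \<longlonglongrightarrow> 0"
        by (simp add: mult_ac)
    qed
    then show ?thesis
      unfolding eq using s by (simp add: pos_divide_le_eq)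
  qed
  have "weak_conv (\<lambda>m t. measure (Q m) {w \<in> space (Q m). neg2_log (el_ratio (N m) (\<lambda>i. (A' m i w, B' m i w))) \<le> ereal t})
    (cdf (chi_square 2))"
  proof (rule arr.wilks)
    fix m i assume "i \<in> {1..N m}"
    then show "A' m i \<in> borel_measurable (Q m)" "B' m i \<in> borel_measurable (Q m)"
      unfolding A'_def[abs_def] B'_def[abs_def] Q_def N_def by (auto intro!: borel_measurable_divide meas)
  next
    fix \<epsilon> :: real assume \<epsilon>: "0 < \<epsilon>"
    show "whp Q (\<lambda>m w. sum_dev (N m) (\<lambda>i. A' m i w) (\<lambda>i. A m i w) \<le> \<epsilon> * real (N m))"
      unfolding A_def A'_def
    proof (rule perturb[OF \<sigma>(1) \<epsilon>])
      show "integrable (Q m) (\<lambda>w. sum_dev (N m) (\<lambda>i. e' (m + n0) i w) (\<lambda>i. e (m + n0) i w))" for m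
        unfolding Q_def N_def by (rule n0(4))
      show "(\<lambda>m. \<integral>w. sum_dev (N m) (\<lambda>i. e' (m + n0) i w) (\<lambda>i. e (m + n0) i w) \<partial>Q m)
         \<in> o(\<lambda>m. real (N m) * \<sigma>e m)"
        using smallo_shift[OF de(2), of n0] unfolding Q_def N_def \<sigma>e_def .
    qed
    show "whp Q (\<lambda>m w. sum_dev (N m) (\<lambda>i. B' m i w) (\<lambda>i. B m i w) \<le> \<epsilon> * real (N m))"
      unfolding B_def B'_def
    proof (rule perturb[OF \<sigma>(2) \<epsilon>])
      show "integrable (Q m) (\<lambda>w. sum_dev (N m) (\<lambda>i. v' (m + n0) i w) (\<lambda>i. v (m + n0) i w))" for m
        unfolding Q_def N_def by (rule n0(5))
      show "(\<lambda>m. \<integral>w. sum_dev (N m) (\<lambda>i. v' (m + n0) i w) (\<lambda>i. v (m + n0) i w) \<partial>Q m)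
         \<in> o(\<lambda>m. real (N m) * \<sigma>v m)"
        using smallo_shift[OF dv(2), of n0] unfolding Q_def N_def \<sigma>v_def .
    qed
  qed
  moreover have "el_ratio (N m) (\<lambda>i. (A' m i w, B' m i w)) = el_ratio (N m) (\<lambda>i. (e' (m + n0) i w, v' (m + n0) i w))" for m w
    using el_ratio_scale[of "1 / sqrt (\<sigma>e m)" "1 / sqrt (\<sigma>v m)" "N m" "\<lambda>i. e' (m + n0) i w" "\<lambda>i. v' (m + n0) i w"] \<sigma>[of m]
    by (simp add: A'_def B'_def)
  ultimately have "weak_conv (\<lambda>m t. measure (M (m + n0)) {w \<in> space (M (m + n0)).
     neg2_log (el_ratio ((m + n0) div 2) (\<lambda>i. (e' (m + n0) i w, v' (m + n0) i w))) \<le> ereal t}) (cdf (chi_square 2))"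
    by (simp add: Q_def N_def)
  then have "weak_conv (\<lambda>n t. measure (M n) {w \<in> space (M n).
     neg2_log (el_ratio (n div 2) (\<lambda>i. (e' n i w, v' n i w))) \<le> ereal t}) (cdf (chi_square 2))"
    by (rule weak_conv_shift[of _ n0])
  moreover have "(\<lambda>w. neg2_log (el_ratio (n div 2) (\<lambda>i. (e' n i w, v' n i w)))) \<in> borel_measurable (M n)" for n
    by (rule measurable_compose[OF borel_measurable_el_ratio[OF meas] borel_measurable_neg2_log])
  ultimately show ?thesis unfolding converges_in_distribution_def by blast
qed

theorem theorem2p2:
  fixes M :: "nat \<Rightarrow> 'a measure"
    and X :: "nat \<Rightarrow> 'a \<Rightarrow> nat \<Rightarrow> nat \<Rightarrow> real"
    and p \<tau> :: "nat \<Rightarrow> nat"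
    and \<mu> :: "nat \<Rightarrow> nat \<Rightarrow> real"
    and S S0 :: "nat \<Rightarrow> nat \<Rightarrow> nat \<Rightarrow> real"
    and \<delta> :: real
  assumes model: "\<forall>n\<ge>1. iid_sample (M n) n (p n) (X n) (\<mu> n) (S n)"
    and tau: "\<forall>n\<ge>1. \<tau> n < p n"
    and v_pos: "\<forall>n\<ge>2. 0 < (\<integral>\<^sup>+\<omega>. ennreal ((v_prime n (p n) (\<tau> n) (\<mu> n) (X n \<omega>) (S n) 1)\<^sup>2) \<partial>M n)"
    and delta: "\<delta> > 0"
    and e_moment: "\<forall>\<^sub>F n in sequentially. integrable (M n)
          (\<lambda>\<omega>. \<bar>e_prime n (p n) (\<tau> n) (\<mu> n) (X n \<omega>) (S n) 1\<bar> powr (2 + \<delta>))"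
    and v_moment: "\<forall>\<^sub>F n in sequentially. integrable (M n)
          (\<lambda>\<omega>. \<bar>v_prime n (p n) (\<tau> n) (\<mu> n) (X n \<omega>) (S n) 1\<bar> powr (2 + \<delta>))"
    and moment_ratio: "(\<lambda>n. max
          ((\<integral>\<omega>. \<bar>e_prime n (p n) (\<tau> n) (\<mu> n) (X n \<omega>) (S n) 1\<bar> powr (2 + \<delta>) \<partial>M n) /
           (\<integral>\<omega>. (e_prime n (p n) (\<tau> n) (\<mu> n) (X n \<omega>) (S n) 1)\<^sup>2 \<partial>M n) powr ((2 + \<delta>) / 2))
          ((\<integral>\<omega>. \<bar>v_prime n (p n) (\<tau> n) (\<mu> n) (X n \<omega>) (S n) 1\<bar> powr (2 + \<delta>) \<partial>M n) /
           (\<integral>\<omega>. (v_prime n (p n) (\<tau> n) (\<mu> n) (X n \<omega>) (S n) 1)\<^sup>2 \<partial>M n) powr ((2 + \<delta>) / 2)))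
        \<in> o(\<lambda>n. real (n div 2) powr ((\<delta> + min 2 \<delta>) / 4))"
    and H0: "\<forall>n\<ge>1. \<forall>i\<in>{1..p n}. \<forall>j\<in>{1..p n}. int (\<tau> n) \<le> \<bar>int i - int j\<bar> \<longrightarrow> S n i j = 0"
    and S0: "\<forall>n\<ge>1. \<forall>i\<in>{1..p n}. \<forall>j\<in>{1..p n}. off_band (\<tau> n) (S0 n) i j = 0"
  shows "converges_in_distribution M
           (\<lambda>n \<omega>. neg2_log (L3 n (p n) (\<tau> n) (\<mu> n) (X n \<omega>) (S0 n))) (chi_square 2) \<and>
    ((\<forall>\<^sub>F n in sequentially. integrable (M n) (\<lambda>\<omega>.
        (\<Sum>i=1..n div 2. (e_star n (p n) (\<tau> n) (X n \<omega>) (S n) i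
                         - e_prime n (p n) (\<tau> n) (\<mu> n) (X n \<omega>) (S n) i)\<^sup>2)
        + (\<Sum>i=1..n div 2. e_star n (p n) (\<tau> n) (X n \<omega>) (S n) i
                         - e_prime n (p n) (\<tau> n) (\<mu> n) (X n \<omega>) (S n) i)\<^sup>2)) \<and>
     (\<lambda>n. \<integral>\<omega>.
        (\<Sum>i=1..n div 2. (e_star n (p n) (\<tau> n) (X n \<omega>) (S n) i
                         - e_prime n (p n) (\<tau> n) (\<mu> n) (X n \<omega>) (S n) i)\<^sup>2)
        + (\<Sum>i=1..n div 2. e_star n (p n) (\<tau> n) (X n \<omega>) (S n) i
                         - e_prime n (p n) (\<tau> n) (\<mu> n) (X n \<omega>) (S n) i)\<^sup>2 \<partial>M n)
       \<in> o(\<lambda>n. real (n div 2) *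
              (\<integral>\<omega>. (e_prime n (p n) (\<tau> n) (\<mu> n) (X n \<omega>) (S n) 1)\<^sup>2 \<partial>M n)) \<and>
     (\<forall>\<^sub>F n in sequentially. integrable (M n) (\<lambda>\<omega>.
        (\<Sum>i=1..n div 2. (v_star n (p n) (\<tau> n) (X n \<omega>) (S n) i
                         - v_prime n (p n) (\<tau> n) (\<mu> n) (X n \<omega>) (S n) i)\<^sup>2)
        + (\<Sum>i=1..n div 2. v_star n (p n) (\<tau> n) (X n \<omega>) (S n) i
                         - v_prime n (p n) (\<tau> n) (\<mu> n) (X n \<omega>) (S n) i)\<^sup>2)) \<and>
     (\<lambda>n. \<integral>\<omega>.
        (\<Sum>i=1..n div 2. (v_star n (p n) (\<tau> n) (X n \<omega>) (S n) i
                         - v_prime n (p n) (\<tau> n) (\<mu> n) (X n \<omega>) (S n) i)\<^sup>2)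
        + (\<Sum>i=1..n div 2. v_star n (p n) (\<tau> n) (X n \<omega>) (S n) i
                         - v_prime n (p n) (\<tau> n) (\<mu> n) (X n \<omega>) (S n) i)\<^sup>2 \<partial>M n)
       \<in> o(\<lambda>n. real (n div 2) *
              (\<integral>\<omega>. (v_prime n (p n) (\<tau> n) (\<mu> n) (X n \<omega>) (S n) 1)\<^sup>2 \<partial>M n))
     \<longrightarrow> converges_in_distribution M
           (\<lambda>n \<omega>. neg2_log (L4 n (p n) (\<tau> n) (X n \<omega>) (S0 n))) (chi_square 2))"
proof -
  have obs: "iid_obs (M n) n (p n) (\<tau> n) (X n) (\<mu> n) (S n)" if "2 \<le> n" for n
  proof
    have "1 \<le> n" using that by simp
    then show "iid_sample (M n) n (p n) (X n) (\<mu> n) (S n)"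
      "\<forall>i\<in>{1..p n}. \<forall>j\<in>{1..p n}. int (\<tau> n) \<le> \<bar>int i - int j\<bar> \<longrightarrow> S n i j = 0"
      using model H0 by blast+
  qed (rule that)
  \<comment> \<open>For n < 2 there are no indices in {1..n div 2}. Measurability is then vacuous in
    the components, so it can be claimed for every n.\<close>
  have two: "2 \<le> n" if "i \<in> {1..n div 2}" for i n :: nat
    using that by auto
  have meas_ev: "(\<lambda>\<omega>. e_prime n (p n) (\<tau> n) (\<mu> n) (X n \<omega>) (S n) i) \<in> borel_measurable (M n)"
    "(\<lambda>\<omega>. v_prime n (p n) (\<tau> n) (\<mu> n) (X n \<omega>) (S n) i) \<in> borel_measurable (M n)"
    if "i \<in> {1..n div 2}" for i n
    using iid_obs.measurable_ev[OF obs[OF two[OF that]] that] by simp_all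
  have meas_stars: "(\<lambda>\<omega>. e_star n (p n) (\<tau> n) (X n \<omega>) (S n) i) \<in> borel_measurable (M n)"
    "(\<lambda>\<omega>. v_star n (p n) (\<tau> n) (X n \<omega>) (S n) i) \<in> borel_measurable (M n)"
    if "i \<in> {1..n div 2}" for i n
    using iid_obs.measurable_stars[OF obs[OF two[OF that]] that] by simp_all
  note conv = el_ratio_converges[OF model v_pos delta e_moment v_moment moment_ratio H0]
  have S_S0: "\<forall>k\<in>{1..p n}. \<forall>l\<in>{1..p n}. off_band (\<tau> n) (S n) k l = off_band (\<tau> n) (S0 n) k l"
    if "i \<in> {1..n div 2}" for i n
    using iid_obs.off_band_S[OF obs[OF two[OF that]]] S0 two[OF that] by auto
  \<comment> \<open>Under the null hypothesis both S and S0 vanish outside the band, so the ratio at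
    S0 is the ratio at S, about which the moment hypotheses speak.\<close>
  have L3: "L3 n (p n) (\<tau> n) (\<mu> n) (X n \<omega>) (S0 n) = el_ratio (n div 2)
      (\<lambda>i. (e_prime n (p n) (\<tau> n) (\<mu> n) (X n \<omega>) (S n) i, v_prime n (p n) (\<tau> n) (\<mu> n) (X n \<omega>) (S n) i))" for n \<omega>
    unfolding L3_def e_prime_def v_prime_def
    by (rule el_ratio_cong) (simp only: pair_trace_cong[OF S_S0] pair_ones_cong[OF S_S0])
  have L4: "L4 n (p n) (\<tau> n) (X n \<omega>) (S0 n) = el_ratio (n div 2)
      (\<lambda>i. (e_star n (p n) (\<tau> n) (X n \<omega>) (S n) i, v_star n (p n) (\<tau> n) (X n \<omega>) (S n) i))" for n \<omega>
    unfolding L4_def e_star_def v_star_def Let_def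
    by (rule el_ratio_cong) (simp only: pair_trace_cong[OF S_S0] pair_ones_cong[OF S_S0])
  show ?thesis
    unfolding L3 L4
  proof (intro conjI impI, goal_cases)
    \<comment> \<open>The unperturbed instance: the statistics are compared with themselves and the
      deviation is identically 0.\<close>
    case 1
    show ?case by (rule conv) (simp_all add: meas_ev sum_dev_def)
  next
    case 2
    then show ?case by (elim conjE) (rule conv[unfolded sum_dev_def, OF meas_stars])
  qed
qed

end
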